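(* Let $m\ge 2$ and $n\ge 1$ be integers with $m\ge n$, let $\alpha_1,\dots,\alpha_n$ be real with $0<2\alpha_j<1$ for $j=1,\dots,n$, and let $\lambda$ be a real or purely imaginary constant. Let $R_m^{n+}=\{(x_1,\dots,x_m)\in\mathbb{R}^m: x_1>0,\dots,x_n>0\}$ and fix $x_0=(x_{01},\dots,x_{0m})\in R_m^{n+}$. For $k\in\{0,1,\dots,n\}$ put $$\tilde\alpha_k=\frac m2+k-1-\sum_{i=1}^{k}\alpha_i+\sum_{i=k+1}^{n}\alpha_i,\qquad \gamma_k=2^{2\tilde\alpha_k-m}\,\frac{\Gamma(\tilde\alpha_k)}{\pi^{m/2}}\prod_{j=1}^{k}\frac{\Gamma(1-\alpha_j)}{\Gamma(2-2\alpha_j)}\prod_{i=k+1}^{n}\frac{\Gamma(\alpha_i)}{\Gamma(2\alpha_i)},$$ assume $\tilde\alpha_k\notin\{1,2,3,\dots\}$, and for $x\in R_m^{n+}\setminus\{x_0\}$ define $$q_k(x,x_0)=\gamma_k\prod_{i=1}^{k}(x_ix_{0i})^{1-2\alpha_i}\; r^{-2\tilde\alpha_k}\;\mathrm{H}_A^{(n,1)}\bigl(\tilde\alpha_k,\,1-\alpha_1,\dots,1-\alpha_k,\alpha_{k+1},\dots,\alpha_n;\,2-2\alpha_1,\dots,2-2\alpha_k,2\alpha_{k+1},\dots,2\alpha_n;\,\xi,\eta_1\bigr),$$ where $$r^2=\sum_{i=1}^{m}(x_i-x_{0i})^2,\quad r_j^2=(x_j+x_{0j})^2+\sum_{i=1,\,i\ne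 j}^{m}(x_i-x_{0i})^2,\quad \xi=(\xi_1,\dots,\xi_n),\ \ \xi_j=\frac{r^2-r_j^2}{r^2}\ (j=1,\dots,n),\quad \eta_1=-\frac14\lambda^2r^2 .$$ Then for each $k=0,1,\dots,n$ the function $q_k(\cdot,x_0)$ is a fundamental solution of the generalized Helmholtz equation with singularity of order $r^{2-m}$ (for $m>2$), i.e.: (1) $u(x)=q_k(x,x_0)$ satisfies $$\sum_{i=1}^{m}\frac{\partial^2u}{\partial x_i^2}+\sum_{j=1}^{n}\frac{2\alpha_j}{x_j}\frac{\partial u}{\partial x_j}-\lambda^2u=0\qquad\text{in } R_m^{n+}\setminus\{x_0\};$$ (2) if $m>2$, then $q_k(x,x_0)$ tends to infinity with order $r^{2-m}$ as $r\to0$, i.e. $r^{m-2}q_k(x,x_0)$ has a finite nonzero limit as $x\to x_0$.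
   Context: The Pochhammer symbol is $(\kappa)_\nu=\Gamma(\kappa+\nu)/\Gamma(\kappa)$; for an integer $l\ge 1$, $(\kappa)_l=\kappa(\kappa+1)\cdots(\kappa+l-1)$, $(\kappa)_0=1$, and $(\kappa)_{-l}=(-1)^l/(1-\kappa)_l$. The confluent hypergeometric function $\mathrm{H}_A^{(n,1)}$ is $$\mathrm{H}_A^{(n,1)}(a,b_1,\dots,b_n;c_1,\dots,c_n;\xi,\eta_1)=\sum_{m_1,\dots,m_{n+1}=0}^{\infty}\frac{(a)_{m_1+\dots+m_n-m_{n+1}}\,(b_1)_{m_1}\cdots(b_n)_{m_n}}{m_1!\cdots m_{n+1}!\,(c_1)_{m_1}\cdots(c_n)_{m_n}}\,\xi_1^{m_1}\cdots\xi_n^{m_n}\,\eta_1^{m_{n+1}},\qquad |\xi_1|+\dots+|\xi_n|<1 .$$ At the points used in the claim one has $\xi_j=-4x_jx_{0j}/r^2<0$. Where $|\xi_1|+\dots+|\xi_n|\ge1$, $\mathrm{H}_A^{(n,1)}$ denotes the analytic continuation of this series from a neighbourhood of the origin to the convex domain $\{(\xi,\eta_1)\in\mathbb{C}^{n}\times\mathbb{C}:\operatorname{Re}\xi_j<1/n,\ j=1,\dots,n\}$ (which exists for the parameter values in the claim, as there $c_j>b_j>0$). Empty products equal $1$ and empty sums equal $0$. *)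

theory Defs
  imports "HOL-Complex_Analysis.Complex_Analysis"
begin

text \<open>
  Points of \<open>\<real>\<^sup>m\<close> and \<open>\<complex>\<^sup>n\<close> are extensional functions on \<open>{1..m}\<close> and \<open>{1..n}\<close>. On sets of such
  functions the product topology of HOL-Analysis induces the Euclidean topology.
\<close>

text \<open>The Pochhammer symbol for integer indices, with \<open>(\<kappa>)\<^sub>-\<^sub>l = (-1)^l / (1-\<kappa>)\<^sub>l\<close>.\<close>

definition int_pochhammer :: "complex \<Rightarrow> int \<Rightarrow> complex" where
  "int_pochhammer \<kappa> l =
     (if l \<ge> 0 then pochhammer \<kappa> (nat l)
      else (-1) ^ nat (-l) / pochhammer (1 - \<kappa>) (nat (-l)))"

text \<open>
  The multi-index \<open>\<mu>\<close> has entries \<open>\<mu> 1, \<dots>, \<mu> n\<close> for the variables \<open>\<xi>\<close>, and \<open>\<mu> (n+1)\<close> for \<open>\<eta>\<close>.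
\<close>

definition HA_series ::
  "nat \<Rightarrow> complex \<Rightarrow> (nat \<Rightarrow> complex) \<Rightarrow> (nat \<Rightarrow> complex) \<Rightarrow> (nat \<Rightarrow> complex) \<times> complex \<Rightarrow> complex"
where
  "HA_series n a b c = (\<lambda>(\<xi>, \<eta>).
     \<Sum>\<^sub>\<infinity>\<mu>\<in>{1..n+1} \<rightarrow>\<^sub>E (UNIV :: nat set).
       int_pochhammer a ((\<Sum>j=1..n. int (\<mu> j)) - int (\<mu> (n+1)))
       * (\<Prod>j=1..n. pochhammer (b j) (\<mu> j))
       / ((\<Prod>j=1..n+1. fact (\<mu> j)) * (\<Prod>j=1..n. pochhammer (c j) (\<mu> j)))
       * (\<Prod>j=1..n. \<xi> j ^ \<mu> j) * \<eta> ^ \<mu> (n+1))"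

text \<open>
  Holomorphy of a function of \<open>n+1\<close> complex variables on an open subset of \<open>\<complex>\<^sup>n \<times> \<complex>\<close>:
  joint continuity together with complex differentiability in each variable.
\<close>

definition holomorphic_several_on ::
  "nat \<Rightarrow> ((nat \<Rightarrow> complex) \<times> complex \<Rightarrow> complex) \<Rightarrow> ((nat \<Rightarrow> complex) \<times> complex) set \<Rightarrow> bool"
where
  "holomorphic_several_on n F S \<longleftrightarrow>
     continuous_on S F \<and>
     (\<forall>(\<xi>, \<eta>)\<in>S.
        (\<forall>j\<in>{1..n}. (\<lambda>z. F (\<xi>(j := z), \<eta>)) field_differentiable at (\<xi> j)) \<and>
        (\<lambda>z. F (\<xi>, z)) field_differentiable at \<eta>)"

definition HA_domain :: "nat \<Rightarrow> ((nat \<Rightarrow> complex) \<times> complex) set" where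
  "HA_domain n = ({1..n} \<rightarrow>\<^sub>E {z. Re z < 1 / real n}) \<times> UNIV"

definition HA_continuation ::
  "nat \<Rightarrow> complex \<Rightarrow> (nat \<Rightarrow> complex) \<Rightarrow> (nat \<Rightarrow> complex)
     \<Rightarrow> ((nat \<Rightarrow> complex) \<times> complex \<Rightarrow> complex) \<Rightarrow> bool"
where
  "HA_continuation n a b c F \<longleftrightarrow>
     holomorphic_several_on n F (HA_domain n) \<and>
     (\<exists>\<epsilon>>0. \<forall>\<xi>\<in>{1..n} \<rightarrow>\<^sub>E ball 0 \<epsilon>. \<forall>\<eta>\<in>ball 0 \<epsilon>. F (\<xi>, \<eta>) = HA_series n a b c (\<xi>, \<eta>))"

text \<open>
  By the identity theorem any two continuations agree on \<open>HA_domain n\<close>, so the choice below does not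
  affect the values there.
\<close>

definition HA ::
  "nat \<Rightarrow> complex \<Rightarrow> (nat \<Rightarrow> complex) \<Rightarrow> (nat \<Rightarrow> complex) \<Rightarrow> (nat \<Rightarrow> complex) \<times> complex \<Rightarrow> complex"
where
  "HA n a b c = (\<lambda>(\<xi>, \<eta>).
     if (\<Sum>j=1..n. norm (\<xi> j)) < 1 then HA_series n a b c (\<xi>, \<eta>)
     else (SOME F. HA_continuation n a b c F) (\<xi>, \<eta>))"

definition positive_part :: "nat \<Rightarrow> nat \<Rightarrow> (nat \<Rightarrow> real) set" where
  "positive_part m n = {x \<in> {1..m} \<rightarrow>\<^sub>E UNIV. \<forall>j\<in>{1..n}. x j > 0}"

definition alpha_tilde :: "nat \<Rightarrow> nat \<Rightarrow> (nat \<Rightarrow> real) \<Rightarrow> nat \<Rightarrow> real" where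
  "alpha_tilde m n \<alpha> k = real m / 2 + real k - 1 - (\<Sum>i=1..k. \<alpha> i) + (\<Sum>i=k+1..n. \<alpha> i)"

definition gamma_coeff :: "nat \<Rightarrow> nat \<Rightarrow> (nat \<Rightarrow> real) \<Rightarrow> nat \<Rightarrow> real" where
  "gamma_coeff m n \<alpha> k =
     2 powr (2 * alpha_tilde m n \<alpha> k - real m)
     * (Gamma (alpha_tilde m n \<alpha> k) / pi powr (real m / 2))
     * (\<Prod>j=1..k. Gamma (1 - \<alpha> j) / Gamma (2 - 2 * \<alpha> j))
     * (\<Prod>i=k+1..n. Gamma (\<alpha> i) / Gamma (2 * \<alpha> i))"

definition rdist :: "nat \<Rightarrow> (nat \<Rightarrow> real) \<Rightarrow> (nat \<Rightarrow> real) \<Rightarrow> real" where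
  "rdist m x x0 = sqrt (\<Sum>i=1..m. (x i - x0 i)\<^sup>2)"

definition rdist_refl :: "nat \<Rightarrow> nat \<Rightarrow> (nat \<Rightarrow> real) \<Rightarrow> (nat \<Rightarrow> real) \<Rightarrow> real" where
  "rdist_refl m j x x0 = sqrt ((x j + x0 j)\<^sup>2 + (\<Sum>i\<in>{1..m} - {j}. (x i - x0 i)\<^sup>2))"

definition xi_var :: "nat \<Rightarrow> nat \<Rightarrow> (nat \<Rightarrow> real) \<Rightarrow> (nat \<Rightarrow> real) \<Rightarrow> nat \<Rightarrow> complex" where
  "xi_var m n x x0 =
     (\<lambda>j\<in>{1..n}. complex_of_real
        (((rdist m x x0)\<^sup>2 - (rdist_refl m j x x0)\<^sup>2) / (rdist m x x0)\<^sup>2))"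

definition eta_var :: "nat \<Rightarrow> complex \<Rightarrow> (nat \<Rightarrow> real) \<Rightarrow> (nat \<Rightarrow> real) \<Rightarrow> complex" where
  "eta_var m lam x x0 = - (1/4) * lam\<^sup>2 * complex_of_real ((rdist m x x0)\<^sup>2)"

definition q_fun ::
  "nat \<Rightarrow> nat \<Rightarrow> (nat \<Rightarrow> real) \<Rightarrow> complex \<Rightarrow> nat \<Rightarrow> (nat \<Rightarrow> real) \<Rightarrow> (nat \<Rightarrow> real) \<Rightarrow> complex"
where
  "q_fun m n \<alpha> lam k x x0 =
     complex_of_real
       (gamma_coeff m n \<alpha> k
        * (\<Prod>i=1..k. (x i * x0 i) powr (1 - 2 * \<alpha> i))
        * rdist m x x0 powr (- 2 * alpha_tilde m n \<alpha> k))
     * HA n (complex_of_real (alpha_tilde m n \<alpha> k))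
         (\<lambda>i. complex_of_real (if i \<le> k then 1 - \<alpha> i else \<alpha> i))
         (\<lambda>i. complex_of_real (if i \<le> k then 2 - 2 * \<alpha> i else 2 * \<alpha> i))
         (xi_var m n x x0, eta_var m lam x x0)"

definition pderiv_fun ::
  "nat \<Rightarrow> ((nat \<Rightarrow> real) \<Rightarrow> 'a::real_normed_vector) \<Rightarrow> (nat \<Rightarrow> real) \<Rightarrow> 'a"
where
  "pderiv_fun i u x = vector_derivative (\<lambda>t. u (x(i := t))) (at (x i))"

definition pdiff_on ::
  "nat \<Rightarrow> ((nat \<Rightarrow> real) \<Rightarrow> 'a::real_normed_vector) \<Rightarrow> (nat \<Rightarrow> real) set \<Rightarrow> bool"
where
  "pdiff_on i u S \<longleftrightarrow> (\<forall>x\<in>S. (\<lambda>t. u (x(i := t))) differentiable at (x i))"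

definition C2_on ::
  "nat \<Rightarrow> ((nat \<Rightarrow> real) \<Rightarrow> 'a::real_normed_vector) \<Rightarrow> (nat \<Rightarrow> real) set \<Rightarrow> bool"
where
  "C2_on m u S \<longleftrightarrow>
     continuous_on S u \<and>
     (\<forall>i\<in>{1..m}. pdiff_on i u S \<and> continuous_on S (pderiv_fun i u) \<and>
        (\<forall>j\<in>{1..m}. pdiff_on j (pderiv_fun i u) S \<and>
           continuous_on S (pderiv_fun j (pderiv_fun i u))))"

text \<open>Classical solutions; \<open>u\<close> is complex-valued because \<open>HA\<close> is.\<close>

definition solves_gen_Helmholtz ::
  "nat \<Rightarrow> nat \<Rightarrow> (nat \<Rightarrow> real) \<Rightarrow> complex \<Rightarrow> ((nat \<Rightarrow> real) \<Rightarrow> complex) \<Rightarrow> (nat \<Rightarrow> real) set \<Rightarrow> bool"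
where
  "solves_gen_Helmholtz m n \<alpha> lam u S \<longleftrightarrow>
     C2_on m u S \<and>
     (\<forall>x\<in>S. (\<Sum>i=1..m. pderiv_fun i (pderiv_fun i u) x)
            + (\<Sum>j=1..n. complex_of_real (2 * \<alpha> j / x j) * pderiv_fun j u x)
            - lam\<^sup>2 * u x = 0)"

end

theory Submission
  imports Defs "HOL-Real_Asymp.Real_Asymp"
begin

text \<open>
  Every \<open>q\<^sub>k\<close> is an average of a radial solution. Write \<open>a\<close> for the first parameter of \<open>H\<^sub>A\<close>, let
  \<open>b\<^sub>j = 1 - \<alpha>\<^sub>j\<close> for \<open>j \<le> k\<close> and \<open>b\<^sub>j = \<alpha>\<^sub>j\<close> for \<open>j > k\<close>, and let
  \<open>g(s) = s\<^sup>-\<^sup>a \<cdot> 0F1(; 1 - a; \<lambda>\<^sup>2s/4)\<close>. As a function of the squared distance \<open>s\<close>, \<open>g\<close> is a radial solution of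
  the Helmholtz equation in dimension \<open>2a + 2\<close>. Since \<open>2a + 2 = m + 2(b\<^sub>1 + \<dots> + b\<^sub>n)\<close>, this is the
  dimension that the operator with singular coefficients \<open>2b\<^sub>j/x\<^sub>j\<close> behaves like, and the claim
  is that \<open>q\<^sub>k\<close> is the generalized translate of \<open>g\<close>:
  \<open>q\<^sub>k(x, x\<^sub>0) = \<gamma>\<^sub>k \<cdot> \<Prod>\<^sub>i\<^sub>\<le>\<^sub>k (x\<^sub>i x\<^sub>0\<^sub>i)\<^bsup>1-2\<alpha>\<^sub>i\<^esup> \<cdot> E[g(s(x, T))]\<close> with \<open>s(x, t) = r\<^sup>2 + 4 \<Sum>\<^sub>j x\<^sub>j x\<^sub>0\<^sub>j t\<^sub>j\<close>, where the
  \<open>T\<^sub>j\<close> are independent with density proportional to \<open>(t(1 - t))\<^bsup>b\<^sub>j-1\<^esup>\<close> on \<open>[0, 1]\<close>.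

  This representation is Euler's integral for \<open>H\<^sub>A\<close>. Expanding the kernel in powers of \<open>\<xi>\<close> and \<open>\<eta>\<close>
  (\<open>rker_series\<close>) and inserting the moments of the beta laws gives the defining series
  (\<open>HA_series_eq_integral\<close>); the integral is holomorphic on the whole convex domain, and the identity
  theorem, applied to one variable after the other, identifies it with the continuation
  (\<open>HA_eq_integral\<close>).

  For the differential equation, the factor \<open>\<Prod>\<^sub>i\<^sub>\<le>\<^sub>k x\<^sub>i\<^bsup>1-2\<alpha>\<^sub>i\<^esup>\<close> turns the coefficients \<open>2\<alpha>\<^sub>i/x\<^sub>i\<close> into
  \<open>2b\<^sub>i/x\<^sub>i\<close>. Applied to the average, the operator in \<open>x\<^sub>j\<close> produces terms in \<open>g'\<close> and \<open>g''\<close>;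
  integration by parts in \<open>t\<^sub>j\<close> brings them into a form (\<open>one_variable_identity\<close>) whose sum over all
  variables is the radial equation of \<open>g\<close> under the expectation (\<open>V_pde\<close>).

  For the order at the pole, \<open>\<Gamma>(a) s\<^sup>-\<^sup>a = \<integral> y\<^bsup>a-1\<^esup> e\<^bsup>-sy\<^esup> dy\<close> makes the expectation of \<open>s\<^sup>-\<^sup>a\<close> a single
  integral of a product of Laplace transforms of beta laws. Each of them decays like a multiple of
  \<open>y\<^bsup>-b\<^sub>j\<^esup>\<close>, so the expectation grows like \<open>(r\<^sup>2)\<^bsup>b\<^sub>1+\<dots>+b\<^sub>n-a\<^esup> = r\<^bsup>2-m\<^esup>\<close>, with a positive constant when
  \<open>m > 2\<close> (\<open>expectation_powr_limit\<close>). The factor \<open>0F1\<close> tends to \<open>1\<close> where the mass concentrates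
  (\<open>expectation_rker_limit\<close>).
\<close>

section \<open>The radial kernel\<close>

text \<open>
  The entire function \<open>0F1(; c; z)\<close>.
\<close>

definition hyp01 :: "complex \<Rightarrow> complex \<Rightarrow> complex" where
  "hyp01 c z = (\<Sum>l. z ^ l / (pochhammer c l * fact l))"

lemma summable_hyp01:
  fixes c z :: complex
  shows "summable (\<lambda>l. norm (z ^ l / (pochhammer c l * fact l)))"
proof (rule summable_ratio_test[of "1/2" "nat \<lceil>norm c + 1 + 2 * norm z\<rceil>"])
  fix n assume n: "nat \<lceil>norm c + 1 + 2 * norm z\<rceil> \<le> n"
  then have n': "norm c + 1 + 2 * norm z \<le> real n" by linarith
  have "real n - norm c \<le> norm (c + of_nat n)"
    using norm_triangle_ineq4[of "c + of_nat n" c] by simp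
  with n' have 1: "1 \<le> norm (c + of_nat n)"
    using norm_ge_zero[of z] by linarith
  have 2: "2 * norm z \<le> real (Suc n)"
    unfolding of_nat_Suc using n' norm_ge_zero[of c] by linarith
  have "norm z / (norm (c + of_nat n) * real (Suc n)) \<le> 1 / 2"
  proof -
    have "1 * real (Suc n) \<le> norm (c + of_nat n) * real (Suc n)"
      using 1 by (intro mult_right_mono) auto
    with 2 have "2 * norm z \<le> norm (c + of_nat n) * real (Suc n)" by (simp only: mult_1)
    moreover have "0 < norm (c + of_nat n) * real (Suc n)" using 1 by (intro mult_pos_pos) auto
    ultimately show ?thesis by (simp add: pos_divide_le_eq del: of_nat_Suc)
  qed
  then have "norm (z ^ n / (pochhammer c n * fact n)) * (norm z / (norm (c + of_nat n) * real (Suc n)))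
     \<le> norm (z ^ n / (pochhammer c n * fact n)) * (1/2)"
    by (intro mult_left_mono) auto
  also have "norm (z ^ n / (pochhammer c n * fact n)) * (norm z / (norm (c + of_nat n) * real (Suc n)))
     = norm (z ^ Suc n / (pochhammer c (Suc n) * fact (Suc n)))"
    by (simp add: norm_mult norm_divide norm_power pochhammer_Suc mult_ac del: of_nat_Suc)
  finally show "norm (norm (z ^ Suc n / (pochhammer c (Suc n) * fact (Suc n)))) \<le>
      1/2 * norm (norm (z ^ n / (pochhammer c n * fact n)))" by simp
qed simp

lemma hyp01_sums: "(\<lambda>l. z ^ l / (pochhammer c l * fact l)) sums hyp01 c z"
  unfolding hyp01_def using summable_hyp01 by (intro summable_sums) (rule summable_norm_cancel)

lemma hyp01_0 [simp]: "hyp01 c 0 = 1"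
proof -
  have "(\<lambda>l. 0 ^ l / (pochhammer c l * fact l)) sums (0 ^ 0 / (pochhammer c 0 * fact 0))"
    using sums_finite[of "{0}" "\<lambda>l. (0::complex) ^ l / (pochhammer c l * fact l)"] by simp
  from sums_unique2[OF hyp01_sums this] show ?thesis by simp
qed

lemma hyp01_deriv:
  "(hyp01 c has_field_derivative hyp01 (c + 1) z / c) (at z)"
proof -
  let ?f = "\<lambda>l. 1 / (pochhammer c l * fact l)"
  have h: "hyp01 c z = (\<Sum>l. ?f l * z ^ l)" for z by (simp add: hyp01_def)
  have d: "diffs ?f l * z ^ l = z ^ l / (pochhammer (c + 1) l * fact l) / c" for l
    by (simp add: diffs_def pochhammer_rec field_simps del: of_nat_Suc)
  have "((\<lambda>z. \<Sum>l. ?f l * z ^ l) has_field_derivative (\<Sum>l. diffs ?f l * z ^ l)) (at z)"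
    by (rule termdiffs_strong_converges_everywhere)
       (use summable_norm_cancel[OF summable_hyp01[of _ c]] in simp)
  also have "(\<lambda>z. \<Sum>l. ?f l * z ^ l) = hyp01 c" by (simp add: h fun_eq_iff)
  also have "(\<Sum>l. diffs ?f l * z ^ l) = hyp01 (c + 1) z / c"
    unfolding d using sums_divide[OF hyp01_sums, of z "c+1" c] by (simp add: sums_iff)
  finally show ?thesis .
qed

text \<open>
  Comparing coefficients. This single relation is behind both the differentiation rule and the
  differential equation of the kernel.
\<close>

lemma hyp01_contiguous:
  assumes "c \<notin> \<int>"
  shows "hyp01 (c - 1) z - hyp01 c z = z * hyp01 (c + 1) z / (c * (c - 1))"
proof -
  have nz: "pochhammer c l \<noteq> 0" "pochhammer (c+1) l \<noteq> 0" "c \<noteq> 0" "c - 1 \<noteq> 0"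
      "pochhammer (c-1) l \<noteq> 0" "c + of_nat l \<noteq> 0" for l :: nat
  proof -
    have *: "c + of_int k \<noteq> 0" for k
    proof
      assume "c + of_int k = 0"
      then have "c = of_int (- k)" by (simp add: add_eq_0_iff2)
      then show False using assms by simp
    qed
    from *[of 0] *[of "-1"] *[of "int l"]
      show "c \<noteq> 0" "c - 1 \<noteq> 0" "c + of_nat l \<noteq> 0" by simp_all
    have "c \<noteq> - of_nat k" "c + 1 \<noteq> - of_nat k" "c - 1 \<noteq> - of_nat k" for k
      using *[of "int k"] *[of "int k + 1"] *[of "int k - 1"]
      by (auto simp: eq_neg_iff_add_eq_0 algebra_simps)
    then show "pochhammer c l \<noteq> 0" "pochhammer (c+1) l \<noteq> 0" "pochhammer (c-1) l \<noteq> 0"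
      by (auto simp: pochhammer_eq_0_iff)
  qed
  let ?g = "\<lambda>l. z ^ l / (pochhammer (c - 1) l * fact l) - z ^ l / (pochhammer c l * fact l)"
  have g: "?g (Suc l) = z / (c * (c - 1)) * (z ^ l / (pochhammer (c + 1) l * fact l))" for l
  proof -
    have a: "pochhammer (c - 1) (Suc l) = (c - 1) * pochhammer c l"
      using pochhammer_rec[of "c-1" l] by simp
    have b: "pochhammer c (Suc l) = pochhammer c l * (c + of_nat l)" by (simp add: pochhammer_Suc)
    have e: "c * pochhammer (c+1) l = pochhammer c l * (c + of_nat l)"
      using b pochhammer_rec[of c l] by simp
    have "1 / pochhammer (c - 1) (Suc l) - 1 / pochhammer c (Suc l) =
       (of_nat l + 1) / ((c - 1) * (pochhammer c l * (c + of_nat l)))"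
      unfolding a b using nz(1,6)[of l] nz(4) by (simp add: divide_simps)
    also have "\<dots> = (of_nat l + 1) / (c * (c - 1)) / pochhammer (c + 1) l"
      unfolding e[symmetric] by (simp add: mult_ac)
    finally have "(1 / pochhammer (c - 1) (Suc l) - 1 / pochhammer c (Suc l)) * (z ^ Suc l / fact (Suc l)) =
       (of_nat l + 1) / (c * (c - 1)) / pochhammer (c + 1) l * (z ^ Suc l / fact (Suc l))" by simp
    also have "\<dots> = z / (c * (c - 1)) * (z ^ l / (pochhammer (c + 1) l * fact l)) * ((of_nat l + 1) / of_nat (Suc l))"
      by (simp add: mult_ac del: of_nat_Suc)
    also have "(of_nat l + 1) / of_nat (Suc l) = (1 :: complex)"
      using of_nat_neq_0[of l, where ?'a = complex] by (simp add: add.commute)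
    finally show ?thesis
      by (simp only: left_diff_distrib times_divide_times_eq mult_1 mult_1_right divide_divide_eq_left)
  qed
  have "?g sums (hyp01 (c - 1) z - hyp01 c z)"
    by (intro sums_diff hyp01_sums)
  then have "(\<lambda>l. ?g (Suc l)) sums (hyp01 (c - 1) z - hyp01 c z)"
    by (subst sums_Suc_iff) simp
  moreover have "(\<lambda>l. ?g (Suc l)) sums (z / (c * (c - 1)) * hyp01 (c + 1) z)"
    unfolding g by (intro sums_mult hyp01_sums)
  ultimately have "hyp01 (c - 1) z - hyp01 c z = z / (c * (c - 1)) * hyp01 (c + 1) z"
    by (rule sums_unique2)
  then show ?thesis by simp
qed

text \<open>
  Up to a constant this is the Bessel function \<open>w\<^bsup>-a/2\<^esup> I\<^sub>-\<^sub>a(2 (\<mu>w)\<^bsup>1/2\<^esup>)\<close>, that is, as a function of the squared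
  distance \<open>w\<close>, a radial solution of the Helmholtz equation in dimension \<open>2a + 2\<close> with parameter
  \<open>\<lambda>\<^sup>2 = 4\<mu>\<close>. The same kernel with complex \<open>w\<close> is the integrand of Euler's integral for \<open>H\<^sub>A\<close>.
\<close>

definition rker :: "complex \<Rightarrow> complex \<Rightarrow> complex \<Rightarrow> complex" where
  "rker a \<mu> w = w powr (- a) * hyp01 (1 - a) (\<mu> * w)"

lemma hyp01_deriv' [derivative_intros]:
  "(f has_field_derivative f') (at x within S) \<Longrightarrow>
   ((\<lambda>x. hyp01 c (f x)) has_field_derivative hyp01 (c + 1) (f x) / c * f') (at x within S)"
  using DERIV_chain2[of "hyp01 c" "hyp01 (c + 1) (f x) / c" f x f' S] hyp01_deriv by blast

lemma continuous_on_hyp01 [continuous_intros]: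
  assumes "continuous_on S f"
  shows "continuous_on S (\<lambda>x. hyp01 c (f x))"
proof -
  have "continuous_on UNIV (hyp01 c)"
    using hyp01_deriv by (intro continuous_at_imp_continuous_on ballI DERIV_isCont)
  then show ?thesis using assms by (rule continuous_on_compose2) simp
qed

lemma continuous_on_rker [continuous_intros]:
  assumes "continuous_on S f" "continuous_on S g" "\<And>x. x \<in> S \<Longrightarrow> Re (g x) > 0"
  shows "continuous_on S (\<lambda>x. rker a (f x) (g x))"
  unfolding rker_def using assms
  by (intro continuous_intros) (auto simp: complex_nonpos_Reals_iff dest!: assms(3))

lemma Re_pos_not_nonpos: "Re w > 0 \<Longrightarrow> w \<notin> \<real>\<^sub>\<le>\<^sub>0"
  by (auto simp: complex_nonpos_Reals_iff)

lemma rker_shift: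
  "rker (a + 1) \<mu> w = w powr (- a - 1) * hyp01 (- a) (\<mu> * w)"
  "rker (a + 2) \<mu> w = w powr (- a - 2) * hyp01 (- a - 1) (\<mu> * w)"
proof -
  have "- (a + 1) = - a - 1" "1 - (a + 1) = - a" "- (a + 2) = - a - 2" "1 - (a + 2) = - a - 1"
    by simp_all
  then show "rker (a + 1) \<mu> w = w powr (- a - 1) * hyp01 (- a) (\<mu> * w)"
    "rker (a + 2) \<mu> w = w powr (- a - 2) * hyp01 (- a - 1) (\<mu> * w)"
    unfolding rker_def by (simp_all only:)
qed

text \<open>
  Differentiation only shifts \<open>a\<close>, so that all derivatives needed below are again kernels.
\<close>

lemma rker_deriv:
  assumes "a \<notin> \<int>" "Re w > 0"
  shows "(rker a \<mu> has_field_derivative - a * rker (a + 1) \<mu> w) (at w)"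
proof -
  have w0: "w \<noteq> 0" using assms by auto
  have a0: "a \<noteq> 0" "1 - a \<noteq> 0" using assms by auto
  have c: "1 - a \<notin> \<int>" using Ints_diff[OF Ints_1, of "1 - a"] assms(1) by auto
  have D: "(rker a \<mu> has_field_derivative
     (w powr (-a) * (hyp01 (1 - a + 1) (\<mu> * w) / (1 - a) * \<mu>) +
      (- a) * w powr (-a - 1) * hyp01 (1 - a) (\<mu> * w))) (at w)"
    unfolding rker_def using assms(2) w0
    by (auto intro!: derivative_eq_intros Re_pos_not_nonpos)
  have E: "w powr (- a - 1) * w = w powr (-a)"
    using w0 by (simp add: powr_diff)
  have "hyp01 (1 - a - 1) (\<mu>*w) - hyp01 (1 - a) (\<mu>*w) = \<mu> * w * hyp01 (1 - a + 1) (\<mu>*w) / ((1-a) * (1-a-1))"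
    by (rule hyp01_contiguous[OF c])
  then have "- a * hyp01 (-a) (\<mu>*w) = \<mu> * w * hyp01 (2 - a) (\<mu>*w) / (1-a) - a * hyp01 (1 - a) (\<mu>*w)"
    using a0 by (simp add: field_simps)
  from arg_cong[OF this, of "\<lambda>x. w powr (-a-1) * x"]
  have "w powr (-a-1) * (- a * hyp01 (-a) (\<mu>*w)) =
     (w powr (-a-1) * w) * (\<mu> * hyp01 (2 - a) (\<mu>*w) / (1-a)) - w powr (-a-1) * a * hyp01 (1 - a) (\<mu>*w)"
    by (simp add: right_diff_distrib mult_ac)
  then have "- a * rker (a + 1) \<mu> w =
    (w powr (-a) * (hyp01 (1 - a + 1) (\<mu> * w) / (1 - a) * \<mu>) +
      (- a) * w powr (-a - 1) * hyp01 (1 - a) (\<mu> * w))"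
    unfolding E rker_shift by (simp add: algebra_simps)
  with D show ?thesis by simp
qed

lemma rker_deriv_param:
  assumes "w \<noteq> 0"
  shows "((\<lambda>\<mu>. rker a \<mu> w) has_field_derivative rker (a - 1) \<mu> w / (1 - a)) (at \<mu>)"
proof -
  have "w powr (- (a - 1)) = w powr (- a) * w"
    using assms by (simp add: powr_diff powr_minus field_simps)
  then show ?thesis
    unfolding rker_def by (auto intro!: derivative_eq_intros simp: algebra_simps)
qed

text \<open>
  By the differentiation rule this is the radial equation \<open>w g'' + (a + 1) g' = \<mu> g\<close>.
\<close>

lemma rker_ode:
  assumes "a \<notin> \<int>" "w \<noteq> 0"
  shows "a * (a + 1) * (w * rker (a + 2) \<mu> w - rker (a + 1) \<mu> w) = \<mu> * rker a \<mu> w"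
proof -
  have c: "- a \<notin> \<int>" using assms(1) by simp
  have a0: "a \<noteq> 0" "a + 1 \<noteq> 0" using assms(1)
    by (auto simp: add_eq_0_iff2)
  have E: "w powr (- a - 2) * w = w powr (- a - 1)"
    using assms by (simp add: powr_diff power2_eq_square field_simps)
  have F: "w powr (- a - 1) * w = w powr (- a)"
    using assms by (simp add: powr_diff power2_eq_square field_simps)
  have "hyp01 (- a - 1) (\<mu> * w) - hyp01 (- a) (\<mu> * w) = \<mu> * w * hyp01 (- a + 1) (\<mu> * w) / (- a * (- a - 1))"
    by (rule hyp01_contiguous[OF c])
  then have "hyp01 (- a - 1) (\<mu> * w) - hyp01 (- a) (\<mu> * w) = \<mu> * w * hyp01 (1 - a) (\<mu> * w) / (a * (a + 1))"
    by (simp add: algebra_simps)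
  then have "a * (a + 1) * (hyp01 (- a - 1) (\<mu> * w) - hyp01 (- a) (\<mu> * w)) = \<mu> * w * hyp01 (1 - a) (\<mu> * w)"
    using a0 by simp
  then have "w powr (- a - 1) * (a * (a + 1) * (hyp01 (- a - 1) (\<mu> * w) - hyp01 (- a) (\<mu> * w)))
    = \<mu> * ((w powr (-a-1) * w) * hyp01 (1 - a) (\<mu> * w))" by (simp add: mult_ac)
  moreover have "w * rker (a + 2) \<mu> w - rker (a + 1) \<mu> w =
    w powr (- a - 1) * (hyp01 (- a - 1) (\<mu> * w) - hyp01 (- a) (\<mu> * w))"
  proof -
    have "w * rker (a + 2) \<mu> w = (w powr (- a - 2) * w) * hyp01 (-a-1) (\<mu> * w)"
      unfolding rker_shift by (simp only: mult_ac)
    then show ?thesis unfolding E rker_shift by (simp only: right_diff_distrib)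
  qed
  ultimately show ?thesis unfolding F rker_def[of a] by (simp add: mult_ac)
qed

section \<open>Averages over the unit cube\<close>

text \<open>
  When the integration variable ranges over a compact space, joint continuity of the integrand gives
  uniform estimates near each parameter value. Joint continuity is then the only thing to check
  before differentiating under the integral.
\<close>

locale compact_measure = finite_measure P for P :: "'t::topological_space measure" +
  fixes T :: "'t set"
  assumes compact_T: "compact T" and space_T: "space P = T"
    and id_measurable: "(\<lambda>t. t) \<in> measurable P (restrict_space borel T)"
begin

lemma borel_measurable_cont:
  fixes f :: "'t \<Rightarrow> 'b::topological_space"
  shows "continuous_on T f \<Longrightarrow> f \<in> borel_measurable P"
  using measurable_compose[OF id_measurable borel_measurable_continuous_on_restrict] by auto

lemma integrable_cont:
  fixes f :: "'t \<Rightarrow> 'b::{banach, second_countable_topology}"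
  assumes "continuous_on T f"
  shows "integrable P f"
proof -
  have "bounded (f ` T)"
    using assms compact_T compact_continuous_image compact_imp_bounded by blast
  then obtain B where "\<And>t. t \<in> T \<Longrightarrow> norm (f t) \<le> B"
    by (auto simp: bounded_iff)
  then show ?thesis
    using borel_measurable_cont[OF assms] space_T by (intro integrable_const_bound[of _ B]) auto
qed

lemma norm_integral_le:
  fixes f :: "'t \<Rightarrow> 'b::{banach, second_countable_topology}"
  assumes "continuous_on T f" "\<And>t. t \<in> T \<Longrightarrow> norm (f t) \<le> B"
  shows "norm (\<integral>t. f t \<partial>P) \<le> B * measure P T"
proof -
  have "norm (\<integral>t. f t \<partial>P) \<le> (\<integral>t. norm (f t) \<partial>P)"
    by (rule integral_norm_bound)
  also have "\<dots> \<le> (\<integral>t. B \<partial>P)"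
    using assms space_T by (intro integral_mono integrable_norm integrable_cont) auto
  also have "\<dots> = B * measure P T" by (simp add: space_T)
  finally show ?thesis .
qed

lemma continuous_on_slice:
  assumes "continuous_on (S \<times> T) (\<lambda>(x, t). f x t)" "x \<in> S"
  shows "continuous_on T (f x)"
  using assms by (auto intro!: continuous_intros continuous_on_compose2[OF assms(1), of T "\<lambda>t. (x, t)", simplified])

lemma continuous_on_integral:
  fixes f :: "'x::topological_space \<Rightarrow> 't \<Rightarrow> 'b::{banach, second_countable_topology}"
  assumes f: "continuous_on (S \<times> T) (\<lambda>(x, t). f x t)"
  shows "continuous_on S (\<lambda>x. \<integral>t. f x t \<partial>P)"
  unfolding continuous_on_def
proof
  fix x assume x: "x \<in> S"
  show "((\<lambda>x. \<integral>t. f x t \<partial>P) \<longlongrightarrow> (\<integral>t. f x t \<partial>P)) (at x within S)"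
  proof (rule tendstoI)
    fix e :: real assume e: "e > 0"
    define d where "d = e / (measure P T + 1)"
    have d: "d > 0" "d * measure P T < e"
      using e measure_nonneg[of P T] by (auto simp: d_def divide_simps add_nonneg_pos)
    obtain X where X: "x \<in> X" "open X"
        "\<forall>y\<in>X \<inter> S. \<forall>t\<in>T. dist ((\<lambda>(x, t). f x t) (y, t)) ((\<lambda>(x, t). f x t) (x, t)) \<le> d"
      by (rule continuous_on_prod_compactE[OF f compact_T x d(1)])
    show "\<forall>\<^sub>F y in at x within S. dist (\<integral>t. f y t \<partial>P) (\<integral>t. f x t \<partial>P) < e"
      unfolding eventually_at_topological
    proof (intro exI[of _ X] conjI ballI impI X)
      fix y assume y: "y \<in> X" "y \<noteq> x" "y \<in> S"
      have c: "continuous_on T (f x)" "continuous_on T (f y)"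
        using continuous_on_slice[OF f] x y by auto
      have "dist (\<integral>t. f y t \<partial>P) (\<integral>t. f x t \<partial>P) = norm (\<integral>t. f y t - f x t \<partial>P)"
        using c by (simp add: dist_norm integrable_cont)
      also have "\<dots> \<le> d * measure P T"
        using X(3) y c by (intro norm_integral_le continuous_intros) (auto simp: dist_norm)
      finally show "dist (\<integral>t. f y t \<partial>P) (\<integral>t. f x t \<partial>P) < e" using d by simp
    qed
  qed
qed

text \<open>
  The bilinear map \<open>mul\<close> makes one statement serve complex derivatives (multiplication) and
  derivatives with respect to a real coordinate (scaling). The estimate is the mean value inequality
  for \<open>f y t - mul y (f' y0 t)\<close>, uniformly in \<open>t\<close>.
\<close>

lemma has_derivative_integral:
  fixes f :: "'x::real_normed_vector \<Rightarrow> 't \<Rightarrow> 'b::{banach, second_countable_topology}"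
    and mul :: "'x \<Rightarrow> 'b \<Rightarrow> 'b"
  assumes mul: "bounded_bilinear mul" and U: "open U" "y0 \<in> U"
    and f: "\<And>y. y \<in> U \<Longrightarrow> continuous_on T (f y)"
    and f': "continuous_on (U \<times> T) (\<lambda>(y, t). f' y t)"
    and D: "\<And>y t. y \<in> U \<Longrightarrow> t \<in> T \<Longrightarrow> ((\<lambda>y. f y t) has_derivative (\<lambda>h. mul h (f' y t))) (at y)"
  shows "((\<lambda>y. \<integral>t. f y t \<partial>P) has_derivative (\<lambda>h. mul h (\<integral>t. f' y0 t \<partial>P))) (at y0)"
  unfolding has_derivative_at_alt
proof (intro conjI allI impI)
  interpret bounded_bilinear mul by fact
  show "bounded_linear (\<lambda>h. mul h (\<integral>t. f' y0 t \<partial>P))" by (rule bounded_linear_left)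
  obtain K where K: "K > 0" "\<And>a b. norm (mul a b) \<le> norm a * norm b * K"
    using pos_bounded by blast
  fix e :: real assume e: "e > 0"
  define d where "d = e / (K * (measure P T + 1))"
  have d: "d > 0" "d * K * measure P T \<le> e"
    using e K measure_nonneg[of P T] by (auto simp: d_def field_simps add_pos_nonneg)
  obtain X where X: "y0 \<in> X" "open X"
      "\<forall>y\<in>X \<inter> U. \<forall>t\<in>T. dist ((\<lambda>(y, t). f' y t) (y, t)) ((\<lambda>(y, t). f' y t) (y0, t)) \<le> d"
    by (rule continuous_on_prod_compactE[OF f' compact_T U(2) d(1)])
  obtain r where r: "r > 0" "ball y0 r \<subseteq> X \<inter> U"
    using X U by (metis IntI open_Int open_contains_ball_eq)
  show "\<exists>r>0. \<forall>y. norm (y - y0) < r \<longrightarrow>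
      norm ((\<integral>t. f y t \<partial>P) - (\<integral>t. f y0 t \<partial>P) - mul (y - y0) (\<integral>t. f' y0 t \<partial>P)) \<le> e * norm (y - y0)"
  proof (intro exI[of _ r] conjI r allI impI)
    fix y assume "norm (y - y0) < r"
    then have y: "y \<in> ball y0 r" by (simp add: dist_norm norm_minus_commute)
    have yU: "y \<in> U" using y r by auto
    have c: "continuous_on T (f' y0)"
      using continuous_on_slice[OF f'] U by auto
    have cm: "continuous_on T (\<lambda>t. mul (y - y0) (f' y0 t))"
      by (intro continuous_on continuous_intros c)
    have bound: "norm (f y t - f y0 t - mul (y - y0) (f' y0 t)) \<le> d * K * norm (y - y0)" if t: "t \<in> T" for t
    proof -
      have "norm ((f y t - mul y (f' y0 t)) - (f y0 t - mul y0 (f' y0 t))) \<le> d * K * norm (y - y0)"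
      proof (rule differentiable_bound[of "ball y0 r" "\<lambda>z. f z t - mul z (f' y0 t)" "\<lambda>z h. mul h (f' z t) - mul h (f' y0 t)"])
        fix z assume z: "z \<in> ball y0 r"
        then have zU: "z \<in> U" "z \<in> X" using r by auto
        show "((\<lambda>z. f z t - mul z (f' y0 t)) has_derivative (\<lambda>h. mul h (f' z t) - mul h (f' y0 t))) (at z within ball y0 r)"
          using D[OF zU(1) t] by (intro has_derivative_diff bounded_linear.has_derivative[OF bounded_linear_left] has_derivative_ident)
            (auto intro: has_derivative_at_withinI)
        have "norm (mul h (f' z t) - mul h (f' y0 t)) \<le> d * K * norm h" for h
        proof -
          have "norm (mul h (f' z t) - mul h (f' y0 t)) = norm (mul h (f' z t - f' y0 t))"
            by (simp add: diff_right)
          also have "\<dots> \<le> norm h * norm (f' z t - f' y0 t) * K" by (rule K)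
          also have "\<dots> \<le> norm h * d * K"
            using X(3) zU t K by (intro mult_right_mono mult_left_mono) (auto simp: dist_norm)
          finally show ?thesis by (simp add: mult_ac)
        qed
        then show "onorm (\<lambda>h. mul h (f' z t) - mul h (f' y0 t)) \<le> d * K"
          using d K by (intro onorm_bound) auto
      qed (use y r in auto)
      then show ?thesis by (simp add: diff_left algebra_simps)
    qed
    have "mul (y - y0) (\<integral>t. f' y0 t \<partial>P) = (\<integral>t. mul (y - y0) (f' y0 t) \<partial>P)"
      using integral_bounded_linear[OF bounded_linear_right integrable_cont[OF c]] by simp
    then have "norm ((\<integral>t. f y t \<partial>P) - (\<integral>t. f y0 t \<partial>P) - mul (y - y0) (\<integral>t. f' y0 t \<partial>P))
       = norm (\<integral>t. f y t - f y0 t - mul (y - y0) (f' y0 t) \<partial>P)"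
      using f[OF yU] f[OF U(2)] cm by (simp add: integrable_cont)
    also have "\<dots> \<le> (d * K * norm (y - y0)) * measure P T"
      using f[OF yU] f[OF U(2)] cm bound by (intro norm_integral_le continuous_intros) auto
    also have "\<dots> = d * K * measure P T * norm (y - y0)" by simp
    also have "\<dots> \<le> e * norm (y - y0)" using d by (intro mult_right_mono) auto
    finally show "norm ((\<integral>t. f y t \<partial>P) - (\<integral>t. f y0 t \<partial>P) - mul (y - y0) (\<integral>t. f' y0 t \<partial>P)) \<le> e * norm (y - y0)" .
  qed
qed

end

text \<open>
  The symmetric beta law. Its space is \<open>[0, 1]\<close> and not the real line, so that finite products live
  on a compact cube and no statement has to be qualified by a null set.
\<close>

definition beta_law :: "real \<Rightarrow> real measure" where
  "beta_law b = density (restrict_space lborel {0..1})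
     (\<lambda>t. ennreal (t powr (b - 1) * (1 - t) powr (b - 1) / Beta b b))"

lemma space_beta_law [simp]: "space (beta_law b) = {0..1}"
  by (simp add: beta_law_def space_restrict_space)

lemma sets_beta_law [measurable_cong]: "sets (beta_law b) = sets (restrict_space borel {0..1})"
  by (simp add: beta_law_def sets_restrict_space)

lemma Beta_pos: "b > 0 \<Longrightarrow> Beta b b > (0::real)"
  by (simp add: Beta_def Gamma_real_pos)

lemma integral_beta_law:
  fixes f :: "real \<Rightarrow> 'b::{banach, second_countable_topology}"
  assumes "b > 0" "f \<in> borel_measurable (restrict_space borel {0..1})"
  shows "(\<integral>t. f t \<partial>beta_law b) =
     (LINT t:{0..1}|lborel. (t powr (b - 1) * (1 - t) powr (b - 1) / Beta b b) *\<^sub>R f t)"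
proof -
  have m: "f \<in> borel_measurable (restrict_space lborel {0..1})"
    using assms(2) by (simp cong: measurable_cong_sets add: sets_restrict_space)
  have m': "(\<lambda>t::real. t powr (b - 1) * (1 - t) powr (b - 1) / Beta b b) \<in> borel_measurable (restrict_space lborel {0..1})"
    by (rule measurable_restrict_space1) simp
  have "(\<integral>t. f t \<partial>beta_law b) = (\<integral>t. (t powr (b - 1) * (1 - t) powr (b - 1) / Beta b b) *\<^sub>R f t \<partial>restrict_space lborel {0..1})"
    unfolding beta_law_def using m m' Beta_pos[OF assms(1)]
    by (intro integral_density AE_I2) auto
  also have "\<dots> = (LINT t:{0..1}|lborel. (t powr (b - 1) * (1 - t) powr (b - 1) / Beta b b) *\<^sub>R f t)"
    by (subst integral_restrict_space) (auto simp: set_lebesgue_integral_def)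
  finally show ?thesis .
qed

lemma emeasure_beta_law: "b > 0 \<Longrightarrow> emeasure (beta_law b) {0..1} = 1"
proof -
  assume b: "b > 0"
  have m': "(\<lambda>t::real. ennreal (t powr (b - 1) * (1 - t) powr (b - 1) / Beta b b)) \<in> borel_measurable (restrict_space lborel {0..1})"
    by (rule measurable_restrict_space1) simp
  have s: "{0..1} \<in> sets (restrict_space lborel {0..1::real})"
    by (auto simp: sets_restrict_space)
  have "((\<lambda>t. t powr (b - 1) * (1 - t) powr (b - 1) / Beta b b) has_integral Beta b b / Beta b b) {0..1}"
    using has_integral_Beta_real[OF b b] by (rule has_integral_divide)
  then have h: "((\<lambda>t. t powr (b - 1) * (1 - t) powr (b - 1) / Beta b b) has_integral 1) {0..1}"
    using Beta_pos[OF b] by simp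
  have "emeasure (beta_law b) {0..1} =
    (\<integral>\<^sup>+t. ennreal (t powr (b - 1) * (1 - t) powr (b - 1) / Beta b b) * indicator {0..1} t \<partial>restrict_space lborel {0..1})"
    unfolding beta_law_def by (rule emeasure_density[OF m' s])
  also have "\<dots> = (\<integral>\<^sup>+t. ennreal (t powr (b - 1) * (1 - t) powr (b - 1) / Beta b b) * indicator {0..1} t \<partial>lborel)"
    by (subst nn_integral_restrict_space) (auto simp: indicator_def intro!: nn_integral_cong)
  also have "\<dots> = (\<integral>\<^sup>+t. ennreal (indicator {0..1} t * (t powr (b - 1) * (1 - t) powr (b - 1) / Beta b b)) \<partial>lborel)"
    by (intro nn_integral_cong) (auto simp: indicator_def)
  also have "\<dots> = ennreal 1"
    using nn_integral_has_integral_lebesgue[OF _ h] Beta_pos[OF b] by simp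
  finally show "emeasure (beta_law b) {0..1} = 1" by simp
qed

lemma finite_measure_beta_law: "b > 0 \<Longrightarrow> finite_measure (beta_law b)"
  by (rule finite_measureI) (simp add: emeasure_beta_law)

definition unit_box :: "nat \<Rightarrow> (nat \<Rightarrow> real) set" where
  "unit_box n = {1..n} \<rightarrow>\<^sub>E {0..1}"

definition unit_box_law :: "nat \<Rightarrow> (nat \<Rightarrow> real) \<Rightarrow> (nat \<Rightarrow> real) measure" where
  "unit_box_law n b = (\<Pi>\<^sub>M j\<in>{1..n}. beta_law (b j))"

lemma unit_boxD: "t \<in> unit_box n \<Longrightarrow> j \<in> {1..n} \<Longrightarrow> 0 \<le> t j \<and> t j \<le> 1"
  by (auto simp: unit_box_def PiE_iff)

lemma compact_unit_box: "compact (unit_box n)"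
proof -
  have eq: "unit_box n = (\<Pi>\<^sub>E i\<in>UNIV. if i \<in> {1..n} then {0..1} else {undefined})"
    by (auto simp: unit_box_def PiE_def Pi_def extensional_def split: if_splits)
  have "compactin (product_topology (\<lambda>_. euclidean) UNIV)
      (\<Pi>\<^sub>E i\<in>UNIV. if i \<in> {1..n} then {0..1} else {undefined :: real})"
    by (subst compactin_PiE) auto
  then show ?thesis
    unfolding eq by (simp add: euclidean_product_topology)
qed

lemma compact_measure_unit_box_law:
  assumes b: "\<And>j. b j > 0"
  shows "compact_measure (unit_box_law n b) (unit_box n)" "measure (unit_box_law n b) (unit_box n) = 1"
proof -
  interpret product_sigma_finite "\<lambda>j. beta_law (b j)"
    using finite_measure_beta_law[OF b]
    by (intro product_sigma_finite.intro) (auto simp: finite_measure.axioms(1))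
  have sp: "space (unit_box_law n b) = unit_box n"
    by (simp add: unit_box_law_def space_PiM unit_box_def)
  have e: "emeasure (unit_box_law n b) (unit_box n) = 1"
    unfolding unit_box_law_def unit_box_def
    by (subst emeasure_PiM) (auto simp: emeasure_beta_law b sets_beta_law sets_restrict_space)
  then show "measure (unit_box_law n b) (unit_box n) = 1" by (simp add: measure_def)
  interpret finite_measure "unit_box_law n b"
    by (rule finite_measureI) (simp add: sp e)
  have "(\<lambda>t. t) \<in> measurable (unit_box_law n b) (\<Pi>\<^sub>M i\<in>UNIV. borel)"
  proof (rule measurable_PiM_single')
    fix i :: nat
    show "(\<lambda>t. t i) \<in> measurable (unit_box_law n b) borel"
    proof (cases "i \<in> {1..n}")
      case True
      have "(\<lambda>t. t i) \<in> measurable (unit_box_law n b) (beta_law (b i))"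
        unfolding unit_box_law_def using True by (rule measurable_component_singleton)
      then have "(\<lambda>t. t i) \<in> measurable (unit_box_law n b) (restrict_space borel {0..1})"
        by (simp cong: measurable_cong_sets add: sets_beta_law)
      then show ?thesis by (simp add: measurable_restrict_space2_iff)
    next
      case False
      then have "t i = undefined" if "t \<in> space (unit_box_law n b)" for t
        using that by (auto simp: sp unit_box_def PiE_def extensional_def)
      then have "(\<lambda>t. t i) \<in> measurable (unit_box_law n b) borel \<longleftrightarrow>
          (\<lambda>t. undefined :: real) \<in> measurable (unit_box_law n b) borel"
        by (rule measurable_cong)
      then show ?thesis by simp
    qed
  qed auto
  then have "(\<lambda>t. t) \<in> measurable (unit_box_law n b) borel"
    by (simp cong: measurable_cong_sets add: sets_PiM_equal_borel)
  then show "compact_measure (unit_box_law n b) (unit_box n)"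
    by unfold_locales (auto simp: sp compact_unit_box measurable_restrict_space2_iff)
qed

section \<open>Power series of the kernel\<close>

definition multi_indices :: "'i set \<Rightarrow> nat \<Rightarrow> ('i \<Rightarrow> nat) set" where
  "multi_indices I M = {\<mu> \<in> I \<rightarrow>\<^sub>E UNIV. sum \<mu> I = M}"

lemma finite_multi_indices: "finite I \<Longrightarrow> finite (multi_indices I M)"
proof (rule finite_subset)
  assume "finite I"
  then show "multi_indices I M \<subseteq> I \<rightarrow>\<^sub>E {..M}"
    by (auto simp: multi_indices_def PiE_iff extensional_def intro: member_le_sum)
  show "finite (I \<rightarrow>\<^sub>E {..M})" if "finite I"
    using that by (intro finite_PiE) auto
qed

text \<open>
  The multinomial theorem with factorials distributed over both sides, by induction on the index set:
  splitting off one index is the binomial theorem.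
\<close>

lemma multinomial:
  fixes z :: "'i \<Rightarrow> 'a::{field_char_0}"
  assumes "finite I"
  shows "(\<Sum>\<mu>\<in>multi_indices I M. \<Prod>j\<in>I. z j ^ \<mu> j / fact (\<mu> j)) = (\<Sum>j\<in>I. z j) ^ M / fact M"
  using assms
proof (induction I arbitrary: M)
  case empty
  show ?case by (cases M) (auto simp: multi_indices_def)
next
  case (insert i I)
  have "(\<Sum>\<mu>\<in>multi_indices (insert i I) M. \<Prod>j\<in>insert i I. z j ^ \<mu> j / fact (\<mu> j)) =
    (\<Sum>(p,\<mu>)\<in>(SIGMA p:{..M}. multi_indices I (M - p)). z i ^ p / fact p * (\<Prod>j\<in>I. z j ^ \<mu> j / fact (\<mu> j)))"
  proof (rule sum.reindex_bij_witness[where i = "\<lambda>(p,\<mu>). \<mu>(i := p)" and j = "\<lambda>\<mu>. (\<mu> i, restrict \<mu> I)"], goal_cases)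
    case (1 \<mu>)
    then show ?case using insert.hyps by (auto simp: multi_indices_def PiE_def extensional_def fun_eq_iff)
  next
    case (2 \<mu>)
    then show ?case using insert.hyps by (auto simp: multi_indices_def)
  next
    case (3 x)
    then show ?case using insert.hyps
      by (cases x) (auto simp: multi_indices_def PiE_def extensional_def fun_eq_iff restrict_def)
  next
    case (4 x)
    have "(\<Sum>j\<in>I. if j = i then a else f j) = sum f I" for a :: nat and f
      using insert.hyps by (intro sum.cong) auto
    with 4 show ?case using insert.hyps
      by (cases x) (auto simp: multi_indices_def PiE_def extensional_def)
  next
    case (5 \<mu>)
    have "(\<Prod>j\<in>I. z j ^ \<mu> j / fact (\<mu> j)) = (\<Prod>j\<in>I. z j ^ restrict \<mu> I j / fact (restrict \<mu> I j))"
      by (intro prod.cong) auto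
    then show ?case using insert.hyps by simp
  qed
  also have "\<dots> = (\<Sum>p\<le>M. z i ^ p / fact p * ((\<Sum>j\<in>I. z j) ^ (M - p) / fact (M - p)))"
    using insert.hyps finite_multi_indices[OF insert.hyps(1)]
    by (subst sum.Sigma[symmetric]) (simp_all add: sum_distrib_left sum_divide_distrib flip: insert.IH)
  also have "\<dots> = (\<Sum>p\<le>M. of_nat (M choose p) * z i ^ p * (\<Sum>j\<in>I. z j) ^ (M - p)) / fact M"
    unfolding sum_divide_distrib by (intro sum.cong) (auto simp: binomial_fact)
  also have "\<dots> = (z i + (\<Sum>j\<in>I. z j)) ^ M / fact M"
    by (simp add: binomial_ring)
  finally show ?case using insert.hyps by simp
qed

text \<open>
  Coefficients that depend on \<open>\<mu>\<^sub>1, \<dots>, \<mu>\<^sub>n\<close> only through their sum: grouping the multi-indices by that sum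
  reduces the multiple series to a double series in \<open>Z = z\<^sub>1 + \<dots> + z\<^sub>n\<close>, and its absolute convergence to
  that of the double series in \<open>X = |z\<^sub>1| + \<dots> + |z\<^sub>n|\<close>.
\<close>

lemma multi_series:
  fixes A :: "nat \<Rightarrow> nat \<Rightarrow> complex" and z :: "nat \<Rightarrow> complex" and n :: nat
  defines "X \<equiv> \<Sum>j=1..n. norm (z j)" and "Z \<equiv> \<Sum>j=1..n. z j"
  defines "f \<equiv> \<lambda>\<mu>. A (\<mu> (n+1)) (\<Sum>j=1..n. \<mu> j) * (\<Prod>j=1..n. z j ^ \<mu> j / fact (\<mu> j))"
  assumes s1: "\<And>l. summable (\<lambda>M. norm (A l M) * (X ^ M / fact M))"
    and s2: "summable (\<lambda>l. \<Sum>M. norm (A l M) * (X ^ M / fact M))"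
    and v1: "\<And>l. (\<lambda>M. A l M * (Z ^ M / fact M)) sums B l" and v2: "B sums S"
  shows "(f has_sum S) ({1..n+1} \<rightarrow>\<^sub>E UNIV)" "(\<lambda>\<mu>. norm (f \<mu>)) summable_on ({1..n+1} \<rightarrow>\<^sub>E UNIV)"
proof -
  let ?K = "multi_indices {1..n}"
  define h where "h = (\<lambda>(l, M, \<mu>). A l M * (\<Prod>j=1..n. z j ^ \<mu> j / fact (\<mu> j)))"
  define E where "E = (SIGMA l:(UNIV :: nat set). SIGMA M:UNIV. ?K M)"
  define \<phi> where "\<phi> = (\<lambda>(l, M::nat, \<mu>::nat\<Rightarrow>nat). \<mu>(n+1 := l :: nat))"
  have X0: "X \<ge> 0" unfolding X_def by (intro sum_nonneg) auto
  have fin: "finite (?K M)" for M by (intro finite_multi_indices) simp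
  have nh: "norm (h (l, M, \<mu>)) = norm (A l M) * (\<Prod>j=1..n. norm (z j) ^ \<mu> j / fact (\<mu> j))" for l M \<mu>
    by (simp add: h_def norm_mult norm_power norm_divide flip: prod_norm)
  have nK: "(\<Sum>\<mu>\<in>?K M. norm (h (l, M, \<mu>))) = norm (A l M) * (X ^ M / fact M)" for l M
    unfolding nh sum_distrib_left[symmetric] X_def by (subst multinomial) simp_all
  have vK: "(\<Sum>\<mu>\<in>?K M. h (l, M, \<mu>)) = A l M * (Z ^ M / fact M)" for l M
    unfolding h_def prod.case sum_distrib_left[symmetric] Z_def by (subst multinomial) simp_all
  have n1: "((\<lambda>M. norm (A l M) * (X ^ M / fact M)) has_sum (\<Sum>M. norm (A l M) * (X ^ M / fact M))) UNIV" for l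
    by (rule sums_nonneg_imp_has_sum[OF summable_sums[OF s1]]) (use X0 in auto)
  have n2: "(\<lambda>y. norm (h (l, y))) summable_on Sigma UNIV ?K" for l
    by (rule summable_on_SigmaI[OF _ has_sum_imp_summable[OF n1]])
       (auto intro!: has_sum_finiteI fin simp: nK simp del: One_nat_def)
  have n3: "((\<lambda>y. norm (h (l, y))) has_sum (\<Sum>M. norm (A l M) * (X ^ M / fact M))) (Sigma UNIV ?K)" for l
    by (rule has_sum_SigmaI[OF _ n1 n2]) (auto intro!: has_sum_finiteI fin simp: nK simp del: One_nat_def)
  have n4: "(\<lambda>y. norm (h y)) summable_on E"
    unfolding E_def
  proof (rule summable_on_SigmaI[OF n3])
    show "(\<lambda>l. \<Sum>M. norm (A l M) * (X ^ M / fact M)) summable_on UNIV"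
      by (rule summable_nonneg_imp_summable_on[OF s2]) (intro suminf_nonneg s1, use X0 in auto)
  qed auto
  have h4: "h summable_on E" using n4 by (rule abs_summable_summable)
  have w1: "norm (A l M * (Z ^ M / fact M)) \<le> norm (A l M) * (X ^ M / fact M)" for l M
    unfolding Z_def X_def norm_mult norm_divide norm_power
    by (intro mult_left_mono divide_mono power_mono norm_sum) auto
  have h1: "((\<lambda>M. A l M * (Z ^ M / fact M)) has_sum B l) UNIV" for l
    by (rule norm_summable_imp_has_sum[OF summable_comparison_test'[OF s1[of l], of 0] v1])
       (use w1 in auto)
  have h2: "(\<lambda>y. h (l, y)) summable_on Sigma UNIV ?K" for l
    using n2 by (rule abs_summable_summable)
  have h3: "((\<lambda>y. h (l, y)) has_sum B l) (Sigma UNIV ?K)" for l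
    by (rule has_sum_SigmaI[OF _ h1 h2]) (auto intro!: has_sum_finiteI fin simp: vK simp del: One_nat_def)
  have B: "norm (B l) \<le> (\<Sum>M. norm (A l M) * (X ^ M / fact M))" for l
    by (rule norm_infsum_le[OF h1 n1]) (use w1 in auto)
  have hB: "(B has_sum S) UNIV"
    by (rule norm_summable_imp_has_sum[OF summable_comparison_test'[OF s2, of 0] v2]) (use B in auto)
  have hE: "(h has_sum S) E"
    unfolding E_def by (rule has_sum_SigmaI[OF h3 hB]) (use h4 in \<open>simp add: E_def\<close>)
  have bij: "bij_betw \<phi> E ({1..n+1} \<rightarrow>\<^sub>E UNIV)"
    by (rule bij_betw_byWitness[where f' = "\<lambda>\<nu>. (\<nu> (n+1), \<Sum>j=1..n. \<nu> j, restrict \<nu> {1..n})"])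
       (auto simp: E_def \<phi>_def multi_indices_def PiE_def extensional_def fun_eq_iff restrict_def intro!: sum.cong split: if_splits)
  have fh: "f (\<phi> y) = h y" if "y \<in> E" for y
    using that by (auto simp: f_def h_def \<phi>_def E_def multi_indices_def)
  have "((\<lambda>y. f (\<phi> y)) has_sum S) E"
    using hE fh by (simp cong: has_sum_cong)
  then show "(f has_sum S) ({1..n+1} \<rightarrow>\<^sub>E UNIV)"
    using has_sum_reindex_bij_betw[OF bij] by blast
  have "(\<lambda>y. norm (f (\<phi> y))) summable_on E"
    using n4 fh by (simp cong: summable_on_cong)
  then show "(\<lambda>\<mu>. norm (f \<mu>)) summable_on ({1..n+1} \<rightarrow>\<^sub>E UNIV)"
    using summable_on_reindex_bij_betw[OF bij, of "\<lambda>\<mu>. norm (f \<mu>)"] by blast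
qed

lemma negative_binomial:
  fixes c z :: complex
  assumes "norm z < 1"
  shows "(\<lambda>M. pochhammer c M * (z ^ M / fact M)) sums (1 - z) powr (- c)"
proof -
  have "(\<lambda>M. (- c gchoose M) * (- z) ^ M) sums (1 + (- z)) powr (- c)"
    using assms by (intro gen_binomial_complex) simp
  moreover have "(- c gchoose M) * (- z) ^ M = pochhammer c M * (z ^ M / fact M)" for M
  proof -
    have "(- 1) ^ M * (- z) ^ M = z ^ M" by (simp flip: power_mult_distrib)
    then show ?thesis by (simp add: gbinomial_pochhammer mult_ac)
  qed
  ultimately show ?thesis by simp
qed

lemma negative_binomial_real:
  fixes c z :: real
  assumes "\<bar>z\<bar> < 1"
  shows "(\<lambda>M. pochhammer c M * (z ^ M / fact M)) sums (1 - z) powr (- c)"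
proof -
  have "(\<lambda>M. (- c gchoose M) * (- z) ^ M) sums (1 + (- z)) powr (- c)"
    using assms by (intro gen_binomial_real) simp
  moreover have "(- c gchoose M) * (- z) ^ M = pochhammer c M * (z ^ M / fact M)" for M
  proof -
    have "(- 1) ^ M * (- z) ^ M = z ^ M" by (simp flip: power_mult_distrib)
    then show ?thesis by (simp add: gbinomial_pochhammer mult_ac)
  qed
  ultimately show ?thesis by simp
qed

lemma norm_pochhammer_le:
  fixes c :: complex
  assumes "norm c \<le> r"
  shows "norm (pochhammer c M) \<le> pochhammer r M"
proof (induction M)
  case (Suc M)
  have "norm (c + of_nat M) \<le> r + real M"
    using norm_triangle_ineq[of c "of_nat M"] assms by simp
  then show ?case
    using Suc assms by (auto simp: pochhammer_Suc norm_mult intro!: mult_mono order.trans[OF norm_ge_zero Suc])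
qed simp

lemma pochhammer_neq_0:
  fixes c :: complex
  assumes "c \<notin> \<int>"
  shows "pochhammer c l \<noteq> 0"
  using assms by (auto simp: pochhammer_eq_0_iff)

text \<open>
  Separates the two summation variables of \<open>H\<^sub>A\<close>: for fixed \<open>l\<close> what remains is a binomial series with
  parameter \<open>a - l\<close>.
\<close>

lemma int_pochhammer_diff:
  assumes a: "a \<notin> \<int>"
  shows "int_pochhammer a (int M - int l) = (-1) ^ l * pochhammer (a - of_nat l) M / pochhammer (1 - a) l"
proof (cases "l \<le> M")
  case True
  have "- (a - 1) \<notin> \<int>" using a Ints_diff[OF Ints_1, of "1 - a"] by auto
  then have nz: "pochhammer (1 - a) l \<noteq> 0" by (intro pochhammer_neq_0) simp
  have "pochhammer (a - of_nat l) M = pochhammer (a - of_nat l) l * pochhammer a (M - l)"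
    using pochhammer_product[OF True, of "a - of_nat l"] by simp
  also have "pochhammer (a - of_nat l) l = (-1) ^ l * pochhammer (1 - a) l"
    using pochhammer_minus'[of "a - 1" l] by (simp add: algebra_simps)
  finally have "pochhammer (a - of_nat l) M = (-1) ^ l * pochhammer (1 - a) l * pochhammer a (M - l)" .
  then have "(-1) ^ l * pochhammer (a - of_nat l) M / pochhammer (1 - a) l
     = ((-1) ^ l * (-1) ^ l) * pochhammer a (M - l)"
    using nz by simp
  then have "(-1) ^ l * pochhammer (a - of_nat l) M / pochhammer (1 - a) l = pochhammer a (M - l)"
    by (simp flip: power_add)
  then show ?thesis using True by (simp add: int_pochhammer_def flip: of_nat_diff)
next
  case False
  then have Ml: "M \<le> l" by simp
  let ?d = "l - M"
  have d: "(of_nat ?d :: complex) = of_nat l - of_nat M" using Ml by (simp add: of_nat_diff)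
  have na: "1 - a + of_nat ?d \<notin> \<int>"
  proof
    assume "1 - a + of_nat ?d \<in> \<int>"
    then have "(1 + of_nat ?d) - (1 - a + of_nat ?d) \<in> \<int>" by (intro Ints_diff) auto
    then show False using a by simp
  qed
  have "pochhammer (1 - a) l = pochhammer (1 - a) ?d * pochhammer (1 - a + of_nat ?d) M"
    using pochhammer_product[of ?d l "1 - a"] Ml by simp
  moreover have "pochhammer (a - of_nat l) M = (-1) ^ M * pochhammer (1 - a + of_nat ?d) M"
  proof -
    have "of_nat l - a - of_nat M + 1 = 1 - a + of_nat ?d" unfolding d by simp
    with pochhammer_minus[of "of_nat l - a" M] show ?thesis by (simp only: minus_diff_eq)
  qed
  ultimately have "(-1) ^ l * pochhammer (a - of_nat l) M / pochhammer (1 - a) l = (-1) ^ l * (-1) ^ M / pochhammer (1 - a) ?d"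
    using pochhammer_neq_0[OF na, of M] by simp
  also have "(-1) ^ l * (-1) ^ M = (-1 :: complex) ^ ?d"
  proof -
    have "(-1 :: complex) ^ l = (-1) ^ ?d * (-1) ^ M" using Ml by (simp flip: power_add)
    then show ?thesis by (simp add: mult.assoc flip: power_mult_distrib)
  qed
  finally show ?thesis using False
    by (simp add: int_pochhammer_def nat_diff_distrib' flip: of_nat_diff)
qed

text \<open>
  For fixed exponent \<open>l\<close> of \<open>\<eta>\<close> the sum over the other indices is \<open>(1 - Z)\<^bsup>l-a\<^esup>\<close>, and the sum over \<open>l\<close> is then
  the series of \<open>0F1\<close> at \<open>-\<eta>(1 - Z)\<close>. Absolute convergence follows in the same way after replacing
  \<open>(a - l)\<^sub>M\<close> by \<open>(|a| + l)\<^sub>M\<close>.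
\<close>

lemma rker_series:
  fixes a \<eta> :: complex and z :: "nat \<Rightarrow> complex"
  assumes a: "a \<notin> \<int>" and z: "(\<Sum>j=1..n. norm (z j)) < 1"
  defines "f \<equiv> \<lambda>\<mu>. \<eta> ^ \<mu> (n+1) / fact (\<mu> (n+1)) * int_pochhammer a ((\<Sum>j=1..n. int (\<mu> j)) - int (\<mu> (n+1)))
       * (\<Prod>j=1..n. z j ^ \<mu> j / fact (\<mu> j))"
  shows "(f has_sum rker a (- \<eta>) (1 - (\<Sum>j=1..n. z j))) ({1..n+1} \<rightarrow>\<^sub>E UNIV)"
    and "(\<lambda>\<mu>. norm (f \<mu>)) summable_on ({1..n+1} \<rightarrow>\<^sub>E UNIV)"
proof -
  define X where "X = (\<Sum>j=1..n. norm (z j))"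
  define Z where "Z = (\<Sum>j=1..n. z j)"
  have X: "0 \<le> X" "X < 1" using z unfolding X_def by (auto intro: sum_nonneg)
  then have aX: "\<bar>X\<bar> < 1" by simp
  have Z: "norm Z < 1" using norm_sum[of z "{1..n}"] z unfolding Z_def by simp
  define A where "A = (\<lambda>l M. \<eta> ^ l / fact l * int_pochhammer a (int M - int l))"
  define C where "C = (\<lambda>l. (- \<eta>) ^ l / (pochhammer (1 - a) l * fact l))"
  have A: "A l M = C l * pochhammer (a - of_nat l) M" for l M
    unfolding A_def C_def int_pochhammer_diff[OF a] by (simp add: power_minus[of \<eta>] mult_ac)
  have f: "f = (\<lambda>\<mu>. A (\<mu> (n+1)) (\<Sum>j=1..n. \<mu> j) * (\<Prod>j=1..n. z j ^ \<mu> j / fact (\<mu> j)))"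
    by (simp add: f_def A_def fun_eq_iff)
  let ?r = "norm a"
  have n1: "(\<lambda>M. norm (C l) * (pochhammer (?r + real l) M * (X ^ M / fact M))) sums (norm (C l) * (1 - X) powr (- (?r + real l)))" for l
    by (intro sums_mult negative_binomial_real aX)
  have le: "norm (A l M) * (X ^ M / fact M) \<le> norm (C l) * (pochhammer (?r + real l) M * (X ^ M / fact M))" for l M
  proof -
    have "norm (pochhammer (a - of_nat l) M) \<le> pochhammer (?r + real l) M"
      using norm_triangle_ineq4[of a "of_nat l"] by (intro norm_pochhammer_le) simp
    then show ?thesis unfolding A norm_mult mult.assoc using X
      by (intro mult_left_mono mult_right_mono) auto
  qed
  have s1: "summable (\<lambda>M. norm (A l M) * (X ^ M / fact M))" for l
    by (rule summable_comparison_test'[OF sums_summable[OF n1[of l]], of 0])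
       (use le X in \<open>simp add: abs_mult\<close>)
  have t: "(\<Sum>M. norm (A l M) * (X ^ M / fact M)) \<le> norm (C l) * (1 - X) powr (- (?r + real l))" for l
    using suminf_le[OF le s1 sums_summable[OF n1]] n1 by (simp add: sums_iff)
  have s2: "summable (\<lambda>l. \<Sum>M. norm (A l M) * (X ^ M / fact M))"
  proof (rule summable_comparison_test'[of _ 0])
    let ?z = "\<eta> / of_real (1 - X)"
    show "summable (\<lambda>l. (1 - X) powr (- ?r) * norm (?z ^ l / (pochhammer (1 - a) l * fact l)))"
      by (intro summable_mult summable_hyp01)
    fix l
    have "norm (\<Sum>M. norm (A l M) * (X ^ M / fact M)) = (\<Sum>M. norm (A l M) * (X ^ M / fact M))"
      using X suminf_nonneg[OF s1[of l]] by simp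
    also have "\<dots> \<le> norm (C l) * (1 - X) powr (- (?r + real l))" by (rule t)
    also have "(1 - X) powr (- (?r + real l)) = (1 - X) powr (- ?r) / (1 - X) ^ l"
      using X by (simp add: powr_diff powr_realpow)
    also have "norm (C l) * ((1 - X) powr (- ?r) / (1 - X) ^ l) =
       (1 - X) powr (- ?r) * norm (?z ^ l / (pochhammer (1 - a) l * fact l))"
      using X by (simp add: C_def norm_divide norm_mult norm_power power_divide mult_ac del: of_real_diff)
    finally show "norm (\<Sum>M. norm (A l M) * (X ^ M / fact M)) \<le>
       (1 - X) powr (- ?r) * norm (?z ^ l / (pochhammer (1 - a) l * fact l))" .
  qed
  define B where "B = (\<lambda>l. C l * (1 - Z) powr (- (a - of_nat l)))"
  have v1: "(\<lambda>M. A l M * (Z ^ M / fact M)) sums B l" for l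
    unfolding A B_def mult.assoc by (intro sums_mult negative_binomial Z)
  have Z1: "1 - Z \<noteq> 0" using Z by auto
  have "B l = (1 - Z) powr (- a) * ((- \<eta> * (1 - Z)) ^ l / (pochhammer (1 - a) l * fact l))" for l
  proof -
    have "(1 - Z) powr (- (a - of_nat l)) = (1 - Z) powr (- a) * (1 - Z) ^ l"
      using Z1 powr_add[of "1 - Z" "- a" "of_nat l"] by (simp add: powr_nat)
    then show ?thesis by (simp add: B_def C_def flip: power_mult_distrib)
  qed
  then have v2: "B sums rker a (- \<eta>) (1 - Z)"
    unfolding rker_def using sums_mult[OF hyp01_sums] by presburger
  show "(f has_sum rker a (- \<eta>) (1 - (\<Sum>j=1..n. z j))) ({1..n+1} \<rightarrow>\<^sub>E UNIV)"
    and "(\<lambda>\<mu>. norm (f \<mu>)) summable_on ({1..n+1} \<rightarrow>\<^sub>E UNIV)"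
    unfolding f using multi_series[of A z n, OF s1[unfolded X_def] s2[unfolded X_def] v1[unfolded Z_def] v2]
    by (auto simp: Z_def)
qed

section \<open>Euler integral and analytic continuation\<close>

lemma (in compact_measure) has_sum_integral:
  fixes f :: "'i \<Rightarrow> 't \<Rightarrow> 'b::{banach, second_countable_topology}"
  assumes f: "\<And>i. i \<in> I \<Longrightarrow> continuous_on T (f i)"
    and le: "\<And>i t. i \<in> I \<Longrightarrow> t \<in> T \<Longrightarrow> norm (f i t) \<le> C i" and C: "C summable_on I"
    and s: "\<And>t. t \<in> T \<Longrightarrow> ((\<lambda>i. f i t) has_sum s t) I" "continuous_on T s"
  shows "((\<lambda>i. \<integral>t. f i t \<partial>P) has_sum (\<integral>t. s t \<partial>P)) I"
  unfolding has_sum_def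
proof (rule tendstoI)
  fix e :: real assume e: "e > 0"
  define d where "d = e / (measure P T + 1)"
  have d: "d > 0" "d * measure P T < e"
    using e measure_nonneg[of P T] by (auto simp: d_def divide_simps add_nonneg_pos)
  define c where "c = infsum C I"
  have c: "(C has_sum c) I" using C by (simp add: c_def)
  then have "eventually (\<lambda>F. dist (sum C F) c < d) (finite_subsets_at_top I)"
    unfolding has_sum_def using d tendstoD by blast
  moreover have "eventually (\<lambda>F. finite F \<and> F \<subseteq> I) (finite_subsets_at_top I)"
    by (rule eventually_finite_subsets_at_top_weakI) auto
  ultimately show "eventually (\<lambda>F. dist (\<Sum>i\<in>F. \<integral>t. f i t \<partial>P) (\<integral>t. s t \<partial>P) < e) (finite_subsets_at_top I)"
  proof eventually_elim
    case (elim F)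
    then have F: "finite F" "F \<subseteq> I" "dist (sum C F) c < d" by auto
    have cF: "continuous_on T (\<lambda>t. \<Sum>i\<in>F. f i t)"
      using F f by (intro continuous_intros) auto
    have "norm (s t - (\<Sum>i\<in>F. f i t)) \<le> d" if t: "t \<in> T" for t
    proof -
      have "norm (s t - (\<Sum>i\<in>F. f i t)) \<le> c - sum C F"
      proof (rule norm_infsum_le)
        show "((\<lambda>i. f i t) has_sum s t - (\<Sum>i\<in>F. f i t)) (I - F)"
          using s(1)[OF t] F by (intro has_sum_Diff) auto
        show "(C has_sum c - sum C F) (I - F)"
          using c F by (intro has_sum_Diff) auto
      qed (use le t in auto)
      then show ?thesis using F(3) by (simp add: dist_real_def)
    qed
    then have "norm (\<integral>t. s t - (\<Sum>i\<in>F. f i t) \<partial>P) \<le> d * measure P T"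
      using continuous_on_diff[OF s(2) cF] by (intro norm_integral_le)
    moreover have "(\<integral>t. s t - (\<Sum>i\<in>F. f i t) \<partial>P) = (\<integral>t. s t \<partial>P) - (\<Sum>i\<in>F. \<integral>t. f i t \<partial>P)"
      using F f s(2) cF by (subst Bochner_Integration.integral_diff) (auto intro!: integrable_cont Bochner_Integration.integral_sum)
    ultimately show ?case using d by (simp add: dist_norm norm_minus_commute)
  qed
qed

lemma beta_moment_real:
  assumes b: "b > 0"
  shows "(\<integral>t. t ^ p \<partial>beta_law b) = Beta (b + real p) b / Beta b b"
proof -
  have m: "(\<lambda>t::real. t ^ p) \<in> borel_measurable (restrict_space borel {0..1})"
    by (rule measurable_restrict_space1) simp
  have eq: "(t powr (b - 1) * (1 - t) powr (b - 1) / Beta b b) *\<^sub>R t ^ p =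
      t powr (b + real p - 1) * (1 - t) powr (b - 1) / Beta b b" if "t \<in> {0..1}" for t
  proof (cases "t = 0")
    case False
    then have "t powr (b + real p - 1) = t powr (b - 1) * t ^ p"
      using that powr_add[of t "b - 1" "real p"] by (simp add: powr_realpow algebra_simps)
    then show ?thesis by simp
  qed simp
  have "(\<integral>t. t ^ p \<partial>beta_law b) = (LINT t:{0..1}|lborel. (t powr (b - 1) * (1 - t) powr (b - 1) / Beta b b) *\<^sub>R t ^ p)"
    by (rule integral_beta_law[OF b m])
  also have "\<dots> = (LINT t:{0..1}|lborel. t powr (b + real p - 1) * (1 - t) powr (b - 1) / Beta b b)"
    using eq by (intro set_lebesgue_integral_cong) auto
  also have "\<dots> = (LINT t:{0..1}|lborel. t powr (b + real p - 1) * (1 - t) powr (b - 1)) / Beta b b"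
    by (rule set_integral_divide_zero)
  also have "\<dots> = Beta (b + real p) b / Beta b b"
    using b integrable_Beta[of "b + real p" b] has_integral_Beta_real[of "b + real p" b]
    by (simp add: set_borel_integral_eq_integral(2) integral_unique)
  finally show ?thesis .
qed

lemma compact_measure_beta_law:
  assumes "b > 0" shows "compact_measure (beta_law b) {0..1}"
proof -
  interpret finite_measure "beta_law b" using finite_measure_beta_law[OF assms] .
  show ?thesis
    by unfold_locales (simp_all cong: measurable_cong_sets add: sets_beta_law)
qed

text \<open>
  These quotients are the factors \<open>(b)\<^sub>p / (c)\<^sub>p\<close> of the series of \<open>H\<^sub>A\<close> in the case \<open>c = 2b\<close>.
\<close>

lemma beta_moment:
  assumes b: "b > 0"
  shows "(\<integral>t. complex_of_real t ^ p \<partial>beta_law b) =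
    pochhammer (complex_of_real b) p / pochhammer (complex_of_real (2 * b)) p"
proof -
  have g: "pochhammer x p = Gamma (x + real p) / Gamma x" "Gamma x > 0" "Gamma (x + real p) > 0" if "x > 0" for x :: real
    using that by (auto simp: pochhammer_Gamma Gamma_real_pos nonpos_Ints_def)
  have "Beta (b + real p) b / Beta b b = pochhammer b p / pochhammer (2 * b) p"
    using g[of b] g[of "2 * b"] b by (simp add: Beta_def field_simps)
  then have "(\<integral>t. t ^ p \<partial>beta_law b) = pochhammer b p / pochhammer (2 * b) p"
    using beta_moment_real[OF b] by simp
  moreover have "(\<integral>t. complex_of_real t ^ p \<partial>beta_law b) = complex_of_real (\<integral>t. t ^ p \<partial>beta_law b)"
    by (simp flip: of_real_power)
  ultimately show ?thesis by (simp only: of_real_divide pochhammer_of_real)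
qed

lemma continuous_on_coords [continuous_intros]:
  "continuous_on S (\<lambda>x. x i)" "continuous_on S' (\<lambda>p. fst p i)" "continuous_on S'' (\<lambda>p. snd p i)"
  "continuous_on S3 (\<lambda>p. fst (fst p) i)"
  by (rule continuous_on_product_then_coordinatewise, intro continuous_intros)+

lemma sum_fun_upd_mult:
  fixes \<xi> :: "nat \<Rightarrow> 'a::comm_semiring_1"
  assumes "j \<in> {1..n}"
  shows "(\<Sum>i=1..n. (\<xi>(j := y)) i * t i) = y * t j + (\<Sum>i\<in>{1..n}-{j}. \<xi> i * t i)"
  using assms by (subst sum.remove[of _ j]) auto

text \<open>
  Euler's integral for \<open>H\<^sub>A\<close> in the case \<open>c\<^sub>j = 2b\<^sub>j\<close>.
\<close>

definition HA_integral :: "nat \<Rightarrow> complex \<Rightarrow> (nat \<Rightarrow> real) \<Rightarrow> (nat \<Rightarrow> complex) \<times> complex \<Rightarrow> complex" where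
  "HA_integral n a b = (\<lambda>(\<xi>, \<eta>). \<integral>t. rker a (- \<eta>) (1 - (\<Sum>j=1..n. \<xi> j * of_real (t j))) \<partial>unit_box_law n b)"

text \<open>
  The convex domain \<open>Re \<xi>\<^sub>j < 1/n\<close> keeps the argument of the kernel in the right half-plane, where its
  principal branch is holomorphic.
\<close>

lemma Re_arg_pos:
  assumes n: "n \<ge> 1" and \<xi>: "\<xi> \<in> {1..n} \<rightarrow>\<^sub>E {z. Re z < 1 / real n}" and t: "t \<in> unit_box n"
  shows "Re (1 - (\<Sum>j=1..n. \<xi> j * of_real (t j))) > 0"
proof -
  have "Re (\<xi> j) * t j < 1 / real n" if j: "j \<in> {1..n}" for j
  proof (cases "Re (\<xi> j) \<le> 0")
    case True
    then have "Re (\<xi> j) * t j \<le> 0" using unit_boxD[OF t j] by (simp add: mult_nonpos_nonneg)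
    also have "0 < 1 / real n" using n by simp
    finally show ?thesis .
  next
    case False
    then have "Re (\<xi> j) * t j \<le> Re (\<xi> j)" using unit_boxD[OF t j] by (simp add: mult_left_le)
    also have "\<dots> < 1 / real n" using \<xi> j by (auto simp: PiE_iff)
    finally show ?thesis .
  qed
  then have "(\<Sum>j=1..n. Re (\<xi> j) * t j) < (\<Sum>j=1..n. 1 / real n)"
    using n by (intro sum_strict_mono) auto
  then show ?thesis using n by simp
qed

lemma HA_integral_holomorphic:
  assumes n: "n \<ge> 1" and a: "a \<notin> \<int>" and b: "\<And>j. b j > 0"
  shows "holomorphic_several_on n (HA_integral n a b) (HA_domain n)"
  unfolding holomorphic_several_on_def
proof (intro conjI)
  interpret compact_measure "unit_box_law n b" "unit_box n" by (rule compact_measure_unit_box_law[OF b])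
  note pos = Re_arg_pos[OF n]
  have "continuous_on (HA_domain n \<times> unit_box n) (\<lambda>(p, t). rker a (- snd p) (1 - (\<Sum>j=1..n. fst p j * of_real (t j))))"
    unfolding split_beta by (intro continuous_intros pos) (auto simp: HA_domain_def)
  from continuous_on_integral[OF this] show "continuous_on (HA_domain n) (HA_integral n a b)"
    by (simp add: HA_integral_def split_beta)
  have bb: "bounded_bilinear (\<lambda>h x :: complex. x * h)"
    by (rule bounded_bilinear.flip[OF bounded_bilinear_mult])
  show "\<forall>(\<xi>, \<eta>)\<in>HA_domain n. (\<forall>j\<in>{1..n}. (\<lambda>z. HA_integral n a b (\<xi>(j := z), \<eta>)) field_differentiable at (\<xi> j)) \<and>
      (\<lambda>z. HA_integral n a b (\<xi>, z)) field_differentiable at \<eta>"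
  proof (safe)
    fix \<xi> \<eta> j assume p: "(\<xi>, \<eta>) \<in> HA_domain n" and j: "j \<in> {1..n}"
    define U where "U = {z. Re z < 1 / real n}"
    define w where "w = (\<lambda>y t. 1 - (y * of_real (t j) + (\<Sum>i\<in>{1..n}-{j}. \<xi> i * complex_of_real (t i))))"
    have w: "1 - (\<Sum>i=1..n. (\<xi>(j := y)) i * of_real (t i)) = w y t" for y t
      unfolding w_def sum_fun_upd_mult[OF j] ..
    have posw: "Re (w y t) > 0" if "y \<in> U" "t \<in> unit_box n" for y t
      unfolding w[symmetric] using p that j by (intro pos) (auto simp: HA_domain_def U_def PiE_iff extensional_def)
    have "((\<lambda>y. \<integral>t. rker a (- \<eta>) (w y t) \<partial>unit_box_law n b) has_derivative
        (\<lambda>h. (\<integral>t. - a * rker (a + 1) (- \<eta>) (w (\<xi> j) t) * - of_real (t j) \<partial>unit_box_law n b) * h)) (at (\<xi> j))"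
    proof (rule has_derivative_integral[OF bb, of U])
      show "open U" unfolding U_def by (simp add: open_halfspace_Re_lt)
      show "\<xi> j \<in> U" using p j by (auto simp: HA_domain_def U_def PiE_iff)
      show "continuous_on (unit_box n) (\<lambda>t. rker a (- \<eta>) (w y t))" if "y \<in> U" for y
        using posw[OF that] by (intro continuous_intros) (auto simp: w_def intro!: continuous_intros)
      show "continuous_on (U \<times> unit_box n) (\<lambda>(y, t). - a * rker (a + 1) (- \<eta>) (w y t) * - of_real (t j))"
        unfolding split_beta using posw by (intro continuous_intros) (auto simp: w_def intro!: continuous_intros)
      fix y t assume yt: "y \<in> U" "t \<in> unit_box n"
      have "((\<lambda>y. rker a (- \<eta>) (w y t)) has_field_derivative - a * rker (a + 1) (- \<eta>) (w y t) * - of_real (t j)) (at y)"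
      proof (rule DERIV_chain2[where f = "rker a (- \<eta>)" and g = "\<lambda>y. w y t"])
        show "(rker a (- \<eta>) has_field_derivative - a * rker (a + 1) (- \<eta>) (w y t)) (at (w y t))"
          by (rule rker_deriv[OF a posw[OF yt]])
        show "((\<lambda>y. w y t) has_field_derivative - of_real (t j)) (at y)"
          unfolding w_def by (auto intro!: derivative_eq_intros)
      qed
      then show "((\<lambda>y. rker a (- \<eta>) (w y t)) has_derivative (\<lambda>h. - a * rker (a + 1) (- \<eta>) (w y t) * - of_real (t j) * h)) (at y)"
        unfolding has_field_derivative_def .
    qed
    then show "(\<lambda>z. HA_integral n a b (\<xi>(j := z), \<eta>)) field_differentiable at (\<xi> j)"
      unfolding HA_integral_def prod.case w field_differentiable_def has_field_derivative_def by (rule exI)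
  next
    fix \<xi> \<eta> assume p: "(\<xi>, \<eta>) \<in> HA_domain n"
    define w where "w = (\<lambda>t. 1 - (\<Sum>j=1..n. \<xi> j * complex_of_real (t j)))"
    have posw: "Re (w t) > 0" if "t \<in> unit_box n" for t
      unfolding w_def using p that by (intro pos) (auto simp: HA_domain_def)
    have "((\<lambda>y. \<integral>t. rker a (- y) (w t) \<partial>unit_box_law n b) has_derivative
        (\<lambda>h. (\<integral>t. rker (a - 1) (- \<eta>) (w t) / (1 - a) * - 1 \<partial>unit_box_law n b) * h)) (at \<eta>)"
    proof (rule has_derivative_integral[OF bb, of UNIV])
      show "continuous_on (unit_box n) (\<lambda>t. rker a (- y) (w t))" for y
        using posw by (intro continuous_intros) (auto simp: w_def intro!: continuous_intros)
      show "continuous_on (UNIV \<times> unit_box n) (\<lambda>(y, t). rker (a - 1) (- y) (w t) / (1 - a) * - 1)"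
        unfolding split_beta using posw a by (intro continuous_intros) (auto simp: w_def intro!: continuous_intros)
      fix y t assume yt: "t \<in> unit_box n"
      then have "w t \<noteq> 0" using posw by fastforce
      then have "((\<lambda>y. rker a (- y) (w t)) has_field_derivative rker (a - 1) (- y) (w t) / (1 - a) * - 1) (at y)"
        by (intro DERIV_chain2[OF rker_deriv_param]) (auto intro!: derivative_eq_intros)
      then show "((\<lambda>y. rker a (- y) (w t)) has_derivative (\<lambda>h. rker (a - 1) (- y) (w t) / (1 - a) * - 1 * h)) (at y)"
        unfolding has_field_derivative_def .
    qed auto
    then show "(\<lambda>z. HA_integral n a b (\<xi>, z)) field_differentiable at \<eta>"
      unfolding HA_integral_def prod.case w_def field_differentiable_def has_field_derivative_def by (rule exI)
  qed
qed

text \<open>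
  The identity theorem in several variables, reduced to one variable: if two continuations agree when
  all variables are small, the variables can be released from the small disc one after the other, \<open>\<eta>\<close>
  last.
\<close>

lemma HA_continuation_unique:
  assumes n: "n \<ge> 1" and F: "HA_continuation n a b c F" and G: "HA_continuation n a b c G"
    and p: "p \<in> HA_domain n"
  shows "F p = G p"
proof -
  define H where "H = {z. Re z < 1 / real n}"
  obtain e1 where e1: "e1 > 0" "\<And>\<xi> \<eta>. \<xi> \<in> {1..n} \<rightarrow>\<^sub>E ball 0 e1 \<Longrightarrow> \<eta> \<in> ball 0 e1 \<Longrightarrow> F (\<xi>, \<eta>) = HA_series n a b c (\<xi>, \<eta>)"
    using F unfolding HA_continuation_def by blast
  obtain e2 where e2: "e2 > 0" "\<And>\<xi> \<eta>. \<xi> \<in> {1..n} \<rightarrow>\<^sub>E ball 0 e2 \<Longrightarrow> \<eta> \<in> ball 0 e2 \<Longrightarrow> G (\<xi>, \<eta>) = HA_series n a b c (\<xi>, \<eta>)"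
    using G unfolding HA_continuation_def by blast
  \<comment> \<open>The bound \<open>1 / n\<close> keeps the disc inside the half-plane.\<close>
  define e where "e = Min {e1, e2, 1 / real n}"
  have e: "e > 0" "e \<le> e1" "e \<le> e2" "e \<le> 1 / real n" using e1(1) e2(1) n by (auto simp: e_def)
  have eH: "ball 0 e \<subseteq> H"
  proof
    fix z :: complex assume "z \<in> ball 0 e"
    then have "Re z < e" using complex_Re_le_cmod[of z] by simp
    then show "z \<in> H" using e by (simp add: H_def)
  qed
  have H: "open H" "connected H"
    by (auto simp: H_def open_halfspace_Re_lt intro!: convex_connected convex_halfspace_Re_lt)
  have hol: "(\<lambda>z. F' (\<xi>(j := z), \<eta>)) holomorphic_on H"
    if "HA_continuation n a b c F'" "\<xi> \<in> {1..n} \<rightarrow>\<^sub>E H" "j \<in> {1..n}" for F' \<xi> \<eta> j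
  proof (rule holomorphic_onI)
    fix z assume z: "z \<in> H"
    then have "(\<xi>(j := z), \<eta>) \<in> HA_domain n"
      using that by (auto simp: HA_domain_def H_def PiE_iff extensional_def)
    then have "(\<lambda>y. F' ((\<xi>(j := z))(j := y), \<eta>)) field_differentiable at ((\<xi>(j := z)) j)"
      using that unfolding HA_continuation_def holomorphic_several_on_def by fast
    then show "(\<lambda>z. F' (\<xi>(j := z), \<eta>)) field_differentiable at z within H"
      by (simp add: field_differentiable_at_within)
  qed
  have step: "\<forall>\<xi>\<in>{1..n} \<rightarrow>\<^sub>E H. (\<forall>j\<in>{q+1..n}. \<xi> j \<in> ball 0 e) \<longrightarrow> (\<forall>\<eta>\<in>ball 0 e. F (\<xi>, \<eta>) = G (\<xi>, \<eta>))" if "q \<le> n" for q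
    using that
  proof (induction q)
    case 0
    show ?case
    proof (intro ballI impI)
      fix \<xi> \<eta> assume x: "\<xi> \<in> {1..n} \<rightarrow>\<^sub>E H" "\<forall>j\<in>{0+1..n}. \<xi> j \<in> ball 0 e" "\<eta> \<in> ball (0::complex) e"
      then have "\<xi> \<in> {1..n} \<rightarrow>\<^sub>E ball 0 e1" "\<xi> \<in> {1..n} \<rightarrow>\<^sub>E ball 0 e2" "\<eta> \<in> ball 0 e1" "\<eta> \<in> ball 0 e2"
        using e by (auto simp: PiE_iff dest!: bspec)
      then show "F (\<xi>, \<eta>) = G (\<xi>, \<eta>)" using e1 e2 by simp
    qed
  next
    case (Suc q)
    let ?j = "Suc q"
    have j: "?j \<in> {1..n}" using Suc.prems by simp
    show ?case
    proof (intro ballI impI)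
      fix \<xi> \<eta> assume x: "\<xi> \<in> {1..n} \<rightarrow>\<^sub>E H" "\<forall>j\<in>{Suc q+1..n}. \<xi> j \<in> ball 0 e" and \<eta>: "\<eta> \<in> ball (0::complex) e"
      have "F (\<xi>(?j := \<xi> ?j), \<eta>) = G (\<xi>(?j := \<xi> ?j), \<eta>)"
      proof (rule analytic_continuation_open[of "ball 0 e" H "\<lambda>z. F (\<xi>(?j := z), \<eta>)" "\<lambda>z. G (\<xi>(?j := z), \<eta>)"])
        show "F (\<xi>(?j := z), \<eta>) = G (\<xi>(?j := z), \<eta>)" if z: "z \<in> ball 0 e" for z
        proof -
          have "\<xi>(?j := z) \<in> {1..n} \<rightarrow>\<^sub>E H"
            using x(1) z eH j by (auto simp: PiE_iff extensional_def)
          moreover have "\<forall>j\<in>{q+1..n}. (\<xi>(?j := z)) j \<in> ball 0 e"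
            using x(2) z by auto
          ultimately show ?thesis using Suc.IH Suc.prems \<eta> by auto
        qed
        show "\<xi> ?j \<in> H" using x j by (auto simp: PiE_iff)
      qed (use H e eH hol[OF F x(1) j] hol[OF G x(1) j] in auto)
      then show "F (\<xi>, \<eta>) = G (\<xi>, \<eta>)" by simp
    qed
  qed
  obtain \<xi> \<eta> where p': "p = (\<xi>, \<eta>)" "\<xi> \<in> {1..n} \<rightarrow>\<^sub>E H"
    using p by (auto simp: HA_domain_def H_def)
  have hol\<eta>: "(\<lambda>z. F' (\<xi>, z)) holomorphic_on UNIV" if "HA_continuation n a b c F'" for F'
  proof (rule holomorphic_onI)
    fix z
    have "(\<xi>, z) \<in> HA_domain n" using p' by (auto simp: HA_domain_def H_def)
    then have "(\<lambda>z. F' (\<xi>, z)) field_differentiable at z"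
      using that unfolding HA_continuation_def holomorphic_several_on_def by fast
    then show "(\<lambda>z. F' (\<xi>, z)) field_differentiable at z within UNIV" by simp
  qed
  have "F (\<xi>, \<eta>) = G (\<xi>, \<eta>)"
    by (rule analytic_continuation_open[of "ball 0 e" UNIV "\<lambda>z. F (\<xi>, z)" "\<lambda>z. G (\<xi>, z)"])
       (use step[of n] p' e hol\<eta>[OF F] hol\<eta>[OF G] in auto)
  then show ?thesis using p' by simp
qed

text \<open>
  Integrate the power series of the kernel term by term. Since \<open>0 \<le> t\<^sub>j \<le> 1\<close>, the series at \<open>t = (1, \<dots>, 1)\<close> is a
  majorant.
\<close>

lemma HA_series_eq_integral:
  assumes a: "a \<notin> \<int>" and b: "\<And>j. b j > 0" and \<xi>: "(\<Sum>j=1..n. norm (\<xi> j)) < 1"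
  shows "HA_series n a (\<lambda>j. of_real (b j)) (\<lambda>j. of_real (2 * b j)) (\<xi>, \<eta>) = HA_integral n a b (\<xi>, \<eta>)"
proof -
  interpret compact_measure "unit_box_law n b" "unit_box n" by (rule compact_measure_unit_box_law[OF b])
  interpret product_sigma_finite "\<lambda>j. beta_law (b j)"
    using finite_measure_beta_law[OF b]
    by (intro product_sigma_finite.intro) (auto simp: finite_measure.axioms(1))
  define f where "f = (\<lambda>z \<mu>. \<eta> ^ \<mu> (n+1) / fact (\<mu> (n+1)) * int_pochhammer a ((\<Sum>j=1..n. int (\<mu> j)) - int (\<mu> (n+1)))
       * (\<Prod>j=1..n. z j ^ \<mu> j / fact (\<mu> j)))"
  have f_mult: "f (\<lambda>j. \<xi> j * of_real (t j)) \<mu> = f \<xi> \<mu> * (\<Prod>j=1..n. complex_of_real (t j) ^ \<mu> j)" for t \<mu>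
    by (simp add: f_def power_mult_distrib prod.distrib prod_dividef)
  have le1: "norm (\<Prod>j=1..n. complex_of_real (t j) ^ \<mu> j) \<le> 1" if t: "t \<in> unit_box n" for t and \<mu> :: "nat \<Rightarrow> nat"
    unfolding prod_norm[symmetric] norm_power
    by (rule prod_le_1) (use unit_boxD[OF t] in \<open>auto intro!: power_le_one simp: abs_le_iff\<close>)
  have small: "(\<Sum>j=1..n. norm (\<xi> j * complex_of_real (t j))) < 1" if t: "t \<in> unit_box n" for t
  proof -
    have "(\<Sum>j=1..n. norm (\<xi> j * complex_of_real (t j))) \<le> (\<Sum>j=1..n. norm (\<xi> j))"
      using unit_boxD[OF t] by (intro sum_mono) (auto simp: norm_mult intro!: mult_left_le)
    then show ?thesis using \<xi> by simp
  qed
  have pos: "Re (1 - (\<Sum>j=1..n. \<xi> j * of_real (t j))) > 0" if t: "t \<in> unit_box n" for t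
  proof -
    have "Re (\<Sum>j=1..n. \<xi> j * of_real (t j)) \<le> norm (\<Sum>j=1..n. \<xi> j * complex_of_real (t j))"
      by (rule complex_Re_le_cmod)
    also have "\<dots> \<le> (\<Sum>j=1..n. norm (\<xi> j * complex_of_real (t j)))" by (rule norm_sum)
    also have "\<dots> < 1" by (rule small[OF t])
    finally show ?thesis by simp
  qed
  have "((\<lambda>\<mu>. \<integral>t. f (\<lambda>j. \<xi> j * of_real (t j)) \<mu> \<partial>unit_box_law n b) has_sum
      (\<integral>t. rker a (- \<eta>) (1 - (\<Sum>j=1..n. \<xi> j * of_real (t j))) \<partial>unit_box_law n b)) ({1..n+1} \<rightarrow>\<^sub>E UNIV)"
  proof (rule has_sum_integral[where C = "\<lambda>\<mu>. norm (f \<xi> \<mu>)"])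
    show "continuous_on (unit_box n) (\<lambda>t. f (\<lambda>j. \<xi> j * complex_of_real (t j)) \<mu>)" for \<mu>
      unfolding f_mult by (intro continuous_intros)
    show "norm (f (\<lambda>j. \<xi> j * complex_of_real (t j)) \<mu>) \<le> norm (f \<xi> \<mu>)" if "t \<in> unit_box n" for t \<mu>
      unfolding f_mult norm_mult using le1[OF that, of \<mu>] by (intro mult_left_le) auto
    show "(\<lambda>\<mu>. norm (f \<xi> \<mu>)) summable_on ({1..n+1} \<rightarrow>\<^sub>E UNIV)"
      unfolding f_def by (rule rker_series(2)[OF a \<xi>])
    show "((\<lambda>\<mu>. f (\<lambda>j. \<xi> j * complex_of_real (t j)) \<mu>) has_sum rker a (- \<eta>) (1 - (\<Sum>j=1..n. \<xi> j * of_real (t j))))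
       ({1..n+1} \<rightarrow>\<^sub>E UNIV)" if "t \<in> unit_box n" for t
      unfolding f_def by (rule rker_series(1)[OF a small[OF that]])
    show "continuous_on (unit_box n) (\<lambda>t. rker a (- \<eta>) (1 - (\<Sum>j=1..n. \<xi> j * of_real (t j))))"
      using pos by (intro continuous_intros) auto
  qed
  then have *: "HA_integral n a b (\<xi>, \<eta>) = (\<Sum>\<^sub>\<infinity>\<mu>\<in>{1..n+1} \<rightarrow>\<^sub>E UNIV. \<integral>t. f (\<lambda>j. \<xi> j * of_real (t j)) \<mu> \<partial>unit_box_law n b)"
    unfolding HA_integral_def prod.case by (rule infsumI[symmetric])
  have mom: "(\<integral>t. (\<Prod>j=1..n. complex_of_real (t j) ^ \<mu> j) \<partial>unit_box_law n b) =
     (\<Prod>j=1..n. pochhammer (of_real (b j)) (\<mu> j) / pochhammer (of_real (2 * b j)) (\<mu> j))" for \<mu> :: "nat \<Rightarrow> nat"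
  proof -
    have "integrable (beta_law (b j)) (\<lambda>t. complex_of_real t ^ p)" for j p
      by (intro compact_measure.integrable_cont[OF compact_measure_beta_law[OF b[of j]]] continuous_intros)
    then show ?thesis unfolding unit_box_law_def
      by (subst product_integral_prod) (auto simp: beta_moment[OF b] simp del: of_real_mult)
  qed
  show ?thesis
    unfolding * HA_series_def prod.case
  proof (rule infsum_cong)
    have insert_n: "{1..n+1} = insert (n+1) {1..n}" and n1: "n + 1 \<notin> {1..n}" by auto
    fix \<mu> :: "nat \<Rightarrow> nat"
    show "int_pochhammer a ((\<Sum>j=1..n. int (\<mu> j)) - int (\<mu> (n+1)))
       * (\<Prod>j=1..n. pochhammer (of_real (b j)) (\<mu> j))
       / ((\<Prod>j=1..n+1. fact (\<mu> j)) * (\<Prod>j=1..n. pochhammer (of_real (2 * b j)) (\<mu> j)))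
       * (\<Prod>j=1..n. \<xi> j ^ \<mu> j) * \<eta> ^ \<mu> (n+1) = (\<integral>t. f (\<lambda>j. \<xi> j * of_real (t j)) \<mu> \<partial>unit_box_law n b)"
      unfolding f_mult integral_mult_right_zero mom insert_n prod.insert[OF finite_atLeastAtMost n1]
      by (simp add: f_def prod_dividef mult_ac del: of_real_mult One_nat_def)
  qed
qed

lemma HA_eq_integral:
  assumes n: "n \<ge> 1" and a: "a \<notin> \<int>" and b: "\<And>j. b j > 0" and \<xi>: "(\<xi>, \<eta>) \<in> HA_domain n"
  shows "HA n a (\<lambda>j. of_real (b j)) (\<lambda>j. of_real (2 * b j)) (\<xi>, \<eta>) = HA_integral n a b (\<xi>, \<eta>)"
proof -
  let ?b = "\<lambda>j. complex_of_real (b j)" and ?c = "\<lambda>j. complex_of_real (2 * b j)"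
  have "HA_continuation n a ?b ?c (HA_integral n a b)"
    unfolding HA_continuation_def
  proof (intro conjI exI[of _ "1 / real n"] ballI)
    fix \<xi> \<eta> assume "\<xi> \<in> {1..n} \<rightarrow>\<^sub>E ball (0::complex) (1 / real n)"
    then have "(\<Sum>j=1..n. norm (\<xi> j)) < (\<Sum>j=1..n. 1 / real n)"
      using n by (intro sum_strict_mono) (auto simp: PiE_iff)
    then show "HA_integral n a b (\<xi>, \<eta>) = HA_series n a ?b ?c (\<xi>, \<eta>)"
      using n by (intro HA_series_eq_integral[OF a b, symmetric]) simp
  qed (use HA_integral_holomorphic[OF n a b] n in auto)
  note F = this
  have "(SOME F. HA_continuation n a ?b ?c F) (\<xi>, \<eta>) = HA_integral n a b (\<xi>, \<eta>)"
    by (rule HA_continuation_unique[OF n someI[of "HA_continuation n a ?b ?c", OF F] F \<xi>])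
  then show ?thesis using HA_series_eq_integral[OF a b] by (simp add: HA_def)
qed

section \<open>Integration by parts and partial derivatives\<close>

lemma integrable_beta_law_iff:
  fixes f :: "real \<Rightarrow> 'b::{banach, second_countable_topology}"
  assumes "b > 0" "f \<in> borel_measurable (restrict_space borel {0..1})"
  shows "integrable (beta_law b) f \<longleftrightarrow>
     set_integrable lborel {0..1} (\<lambda>t. (t powr (b - 1) * (1 - t) powr (b - 1) / Beta b b) *\<^sub>R f t)"
proof -
  have m: "f \<in> borel_measurable (restrict_space lborel {0..1})"
    using assms(2) by (simp cong: measurable_cong_sets add: sets_restrict_space)
  have m': "(\<lambda>t::real. t powr (b - 1) * (1 - t) powr (b - 1) / Beta b b) \<in> borel_measurable (restrict_space lborel {0..1})"
    by (rule measurable_restrict_space1) simp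
  have "integrable (beta_law b) f \<longleftrightarrow>
      integrable (restrict_space lborel {0..1}) (\<lambda>t. (t powr (b - 1) * (1 - t) powr (b - 1) / Beta b b) *\<^sub>R f t)"
    unfolding beta_law_def using m m' Beta_pos[OF assms(1)]
    by (intro integrable_density AE_I2) auto
  also have "\<dots> \<longleftrightarrow> set_integrable lborel {0..1} (\<lambda>t. (t powr (b - 1) * (1 - t) powr (b - 1) / Beta b b) *\<^sub>R f t)"
    by (subst integrable_restrict_space) (auto simp: set_integrable_def)
  finally show ?thesis .
qed

text \<open>
  The integrand is the derivative of \<open>(y(1 - y))\<^sup>b h\<close> divided by the weight \<open>(y(1 - y))\<^bsup>b-1\<^esup>\<close>; the boundary
  terms vanish because \<open>b > 0\<close>.
\<close>

lemma beta_law_integration_by_parts: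
  fixes h h' :: "real \<Rightarrow> complex"
  assumes b: "b > 0" and h: "continuous_on {0..1} h" "continuous_on {0..1} h'"
    and D: "\<And>y. y \<in> {0<..<1} \<Longrightarrow> (h has_vector_derivative h' y) (at y)"
  shows "(\<integral>y. of_real (b * (1 - 2 * y)) * h y + of_real (y * (1 - y)) * h' y \<partial>beta_law b) = 0"
proof -
  let ?F = "\<lambda>y. of_real (b * (1 - 2 * y)) * h y + of_real (y * (1 - y)) * h' y"
  let ?w = "\<lambda>t. t powr (b - 1) * (1 - t) powr (b - 1) / Beta b b"
  interpret compact_measure "beta_law b" "{0..1}" by (rule compact_measure_beta_law[OF b])
  have cF: "continuous_on {0..1} ?F" by (intro continuous_intros h)
  have mF: "?F \<in> borel_measurable (restrict_space borel {0..1})"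
    using cF by (rule borel_measurable_continuous_on_restrict)
  have si: "set_integrable lborel {0..1} (\<lambda>t. ?w t *\<^sub>R ?F t)"
    using integrable_cont[OF cF] integrable_beta_law_iff[OF b mF] by simp
  define G where "G = (\<lambda>y. (y powr b * (1 - y) powr b / Beta b b) *\<^sub>R h y)"
  have cG: "continuous_on {0..1} G"
    unfolding G_def using b Beta_pos[OF b] by (intro continuous_intros continuous_on_powr' h) auto
  have dG: "(G has_vector_derivative ?w y *\<^sub>R ?F y) (at y)" if y: "y \<in> {0<..<1}" for y
  proof -
    have p: "y powr b = y powr (b - 1) * y" "(1 - y) powr b = (1 - y) powr (b - 1) * (1 - y)"
      using y by (simp_all add: powr_diff)
    have "((\<lambda>y. y powr b * (1 - y) powr b / Beta b b) has_real_derivative ?w y * (b * (1 - 2 * y))) (at y)"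
      using y Beta_pos[OF b] by (auto intro!: derivative_eq_intros simp: p) (simp add: algebra_simps)
    then have "(G has_vector_derivative (y powr b * (1 - y) powr b / Beta b b) *\<^sub>R h' y + (?w y * (b * (1 - 2 * y))) *\<^sub>R h y) (at y)"
      unfolding G_def by (intro has_vector_derivative_scaleR D y)
    also have "(y powr b * (1 - y) powr b / Beta b b) *\<^sub>R h' y + (?w y * (b * (1 - 2 * y))) *\<^sub>R h y = ?w y *\<^sub>R ?F y"
    proof -
      define W where "W = ?w y"
      have W: "y powr b * (1 - y) powr b / Beta b b = W * (y * (1 - y))"
        unfolding p W_def by simp
      show ?thesis unfolding W W_def[symmetric] by (simp add: scaleR_conv_of_real algebra_simps)
    qed
    finally show ?thesis .
  qed
  have "((\<lambda>y. ?w y *\<^sub>R ?F y) has_integral (G 1 - G 0)) {0..1}"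
    by (rule fundamental_theorem_of_calculus_interior[OF _ cG dG]) auto
  then have "(LINT y:{0..1}|lborel. ?w y *\<^sub>R ?F y) = 0"
    using set_borel_integral_eq_integral(2)[OF si] b by (simp add: integral_unique G_def)
  then show ?thesis using integral_beta_law[OF b mF] by simp
qed

lemma continuous_on_fun_upd:
  fixes x :: "'i \<Rightarrow> 'b::topological_space"
  assumes "continuous_on S g"
  shows "continuous_on S (\<lambda>p. x(i := g p))"
proof (rule continuous_on_coordinatewise_then_product)
  fix l show "continuous_on S (\<lambda>p. (x(i := g p)) l)"
    using assms by (cases "l = i") auto
qed

lemma unit_box_law_integration_by_parts:
  fixes H H' :: "(nat \<Rightarrow> real) \<Rightarrow> complex"
  assumes b: "\<And>j. b j > 0" and j: "j \<in> {1..n}" and H: "continuous_on (unit_box n) H" "continuous_on (unit_box n) H'"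
    and D: "\<And>t. t \<in> unit_box n \<Longrightarrow> ((\<lambda>y. H (t(j := y))) has_vector_derivative H' t) (at (t j))"
  shows "(\<integral>t. of_real (b j * (1 - 2 * t j)) * H t + of_real (t j * (1 - t j)) * H' t \<partial>unit_box_law n b) = 0"
proof -
  let ?F = "\<lambda>t. of_real (b j * (1 - 2 * t j)) * H t + of_real (t j * (1 - t j)) * H' t"
  interpret compact_measure "unit_box_law n b" "unit_box n" by (rule compact_measure_unit_box_law[OF b])
  interpret product_sigma_finite "\<lambda>j. beta_law (b j)"
    using finite_measure_beta_law[OF b]
    by (intro product_sigma_finite.intro) (auto simp: finite_measure.axioms(1))
  let ?I = "{1..n} - {j}"
  have ins: "insert j ?I = {1..n}" using j by auto
  have "continuous_on (unit_box n) ?F" by (intro continuous_intros H)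
  then have "integrable (unit_box_law n b) ?F" by (rule integrable_cont)
  then have "(\<integral>t. ?F t \<partial>unit_box_law n b) =
     (\<integral>\<tau>. (\<integral>y. ?F (\<tau>(j := y)) \<partial>beta_law (b j)) \<partial>(\<Pi>\<^sub>M i\<in>?I. beta_law (b i)))"
    unfolding unit_box_law_def using product_integral_insert[of ?I j ?F] ins by simp
  also have "\<dots> = (\<integral>\<tau>. 0 \<partial>(\<Pi>\<^sub>M i\<in>?I. beta_law (b i)))"
  proof (rule Bochner_Integration.integral_cong[OF refl])
    fix \<tau> assume "\<tau> \<in> space (\<Pi>\<^sub>M i\<in>?I. beta_law (b i))"
    then have \<tau>: "\<tau>(j := y) \<in> unit_box n" if "y \<in> {0..1}" for y
      using that j by (auto simp: space_PiM unit_box_def PiE_iff extensional_def)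
    have c: "continuous_on {0..1} (\<lambda>y. \<tau>(j := y))"
      by (intro continuous_on_fun_upd continuous_intros)
    have d: "((\<lambda>y. H (\<tau>(j := y))) has_vector_derivative H' (\<tau>(j := y))) (at y)" if "y \<in> {0<..<1}" for y
      using D[OF \<tau>[of y]] that by simp
    have "(\<integral>y. of_real (b j * (1 - 2 * y)) * H (\<tau>(j := y)) + of_real (y * (1 - y)) * H' (\<tau>(j := y)) \<partial>beta_law (b j)) = 0"
      using \<tau> by (intro beta_law_integration_by_parts b d continuous_on_compose2[OF H(1) c] continuous_on_compose2[OF H(2) c]) auto
    then show "(\<integral>y. ?F (\<tau>(j := y)) \<partial>beta_law (b j)) = 0" by simp
  qed
  finally show ?thesis by simp
qed

text \<open>
  Partial derivatives at a point see the function only along coordinate lines. A set of extensional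
  functions is not open in the function space, but this weaker property is all that differentiation
  requires.
\<close>

definition line_open :: "nat \<Rightarrow> (nat \<Rightarrow> real) set \<Rightarrow> bool" where
  "line_open m S \<longleftrightarrow> (\<forall>x\<in>S. \<forall>i\<in>{1..m}. open {y. x(i := y) \<in> S})"

text \<open>
  First partial derivatives as explicit data. Unlike \<open>pderiv_fun\<close>, which picks a value everywhere, this
  relation is closed under sums, products and integrals.
\<close>

definition has_partials ::
  "nat \<Rightarrow> ((nat \<Rightarrow> real) \<Rightarrow> complex) \<Rightarrow> (nat \<Rightarrow> (nat \<Rightarrow> real) \<Rightarrow> complex) \<Rightarrow> (nat \<Rightarrow> real) set \<Rightarrow> bool" where
  "has_partials m u D S \<longleftrightarrow> continuous_on S u \<and> (\<forall>i\<in>{1..m}. continuous_on S (D i) \<and>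
     (\<forall>x\<in>S. ((\<lambda>y. u (x(i := y))) has_vector_derivative D i x) (at (x i))))"

lemma has_partialsI:
  assumes "continuous_on S u" "\<And>i. i \<in> {1..m} \<Longrightarrow> continuous_on S (D i)"
    "\<And>i x. i \<in> {1..m} \<Longrightarrow> x \<in> S \<Longrightarrow> ((\<lambda>y. u (x(i := y))) has_vector_derivative D i x) (at (x i))"
  shows "has_partials m u D S"
  using assms by (simp add: has_partials_def)

lemma has_partials_add:
  assumes "has_partials m u D S" "has_partials m v E S"
  shows "has_partials m (\<lambda>x. u x + v x) (\<lambda>i x. D i x + E i x) S"
  using assms unfolding has_partials_def
  by (auto intro!: continuous_intros has_vector_derivative_add)

lemma has_partials_mult:
  assumes "has_partials m u D S" "has_partials m v E S"
  shows "has_partials m (\<lambda>x. u x * v x) (\<lambda>i x. u x * E i x + D i x * v x) S"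
proof (rule has_partialsI)
  fix i x assume i: "i \<in> {1..m}" and x: "x \<in> S"
  have "((\<lambda>y. u (x(i := y))) has_vector_derivative D i x) (at (x i))"
       "((\<lambda>y. v (x(i := y))) has_vector_derivative E i x) (at (x i))"
    using assms i x by (auto simp: has_partials_def)
  from has_vector_derivative_mult[OF this]
  show "((\<lambda>y. u (x(i := y)) * v (x(i := y))) has_vector_derivative u x * E i x + D i x * v x) (at (x i))"
    by simp
qed (use assms in \<open>auto simp: has_partials_def intro!: continuous_intros\<close>)

lemma has_partials_cong:
  assumes u: "has_partials m u D S" and S: "line_open m S" and eq: "\<And>x. x \<in> S \<Longrightarrow> u x = u' x"
    and D: "\<And>i x. i \<in> {1..m} \<Longrightarrow> x \<in> S \<Longrightarrow> D i x = D' i x"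
  shows "has_partials m u' D' S"
proof (rule has_partialsI)
  fix i x assume i: "i \<in> {1..m}" and x: "x \<in> S"
  have d: "((\<lambda>y. u (x(i := y))) has_vector_derivative D i x) (at (x i))"
    using u i x by (auto simp: has_partials_def)
  have "((\<lambda>y. u' (x(i := y))) has_vector_derivative D i x) (at (x i))"
    by (rule has_vector_derivative_transform_within_open[OF d, of "{y. x(i := y) \<in> S}"])
       (use S i x eq in \<open>auto simp: line_open_def\<close>)
  then show "((\<lambda>y. u' (x(i := y))) has_vector_derivative D' i x) (at (x i))"
    using D i x by simp
next
  show "continuous_on S u'" using u eq by (simp add: has_partials_def cong: continuous_on_cong)
  show "continuous_on S (D' i)" if "i \<in> {1..m}" for i
  proof -
    have "continuous_on S (D i) \<longleftrightarrow> continuous_on S (D' i)"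
      by (rule continuous_on_cong) (use D that in auto)
    then show ?thesis using u that by (simp add: has_partials_def)
  qed
qed

lemma C2_on_partials:
  assumes u: "has_partials m u D S" and S: "line_open m S"
    and D: "\<And>i. i \<in> {1..m} \<Longrightarrow> has_partials m (D i) (DD i) S"
  shows "C2_on m u S"
    and "\<And>i x. i \<in> {1..m} \<Longrightarrow> x \<in> S \<Longrightarrow> pderiv_fun i u x = D i x"
    and "\<And>i j x. i \<in> {1..m} \<Longrightarrow> j \<in> {1..m} \<Longrightarrow> x \<in> S \<Longrightarrow> pderiv_fun j (pderiv_fun i u) x = DD i j x"
proof -
  have p: "pderiv_fun i f x = E i x" if "has_partials m f E S" "i \<in> {1..m}" "x \<in> S" for f E i x
    using that unfolding has_partials_def pderiv_fun_def by (intro vector_derivative_at) blast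
  have d: "pdiff_on i f S" if "has_partials m f E S" "i \<in> {1..m}" for f E i
    using that unfolding has_partials_def pdiff_on_def by (blast intro: differentiableI_vector)
  have c: "continuous_on S (pderiv_fun i f)" if "has_partials m f E S" "i \<in> {1..m}" for f E i
    using that p[OF that] continuous_on_cong[OF refl, of S "pderiv_fun i f" "E i"] by (auto simp: has_partials_def)
  show p1: "pderiv_fun i u x = D i x" if "i \<in> {1..m}" "x \<in> S" for i x
    by (rule p[OF u that])
  have h: "has_partials m (pderiv_fun i u) (DD i) S" if "i \<in> {1..m}" for i
    by (rule has_partials_cong[OF D[OF that] S]) (use p1 that in auto)
  show "pderiv_fun j (pderiv_fun i u) x = DD i j x" if "i \<in> {1..m}" "j \<in> {1..m}" "x \<in> S" for i j x
    by (rule p[OF h[OF that(1)] that(2,3)])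
  show "C2_on m u S"
    unfolding C2_on_def using u d[OF u] c[OF u] d[OF h] c[OF h] by (auto simp: has_partials_def)
qed

lemma (in compact_measure) has_partials_integral:
  fixes f :: "(nat \<Rightarrow> real) \<Rightarrow> 't \<Rightarrow> complex"
  assumes S: "line_open m S" and f: "continuous_on (S \<times> T) (\<lambda>(x, t). f x t)"
    and f': "\<And>i. i \<in> {1..m} \<Longrightarrow> continuous_on (S \<times> T) (\<lambda>(x, t). f' i x t)"
    and D: "\<And>i x t. i \<in> {1..m} \<Longrightarrow> x \<in> S \<Longrightarrow> t \<in> T \<Longrightarrow>
       ((\<lambda>y. f (x(i := y)) t) has_vector_derivative f' i x t) (at (x i))"
  shows "has_partials m (\<lambda>x. \<integral>t. f x t \<partial>P) (\<lambda>i x. \<integral>t. f' i x t \<partial>P) S"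
proof (rule has_partialsI)
  show "continuous_on S (\<lambda>x. \<integral>t. f x t \<partial>P)" by (rule continuous_on_integral[OF f])
  fix i assume i: "i \<in> {1..m}"
  show "continuous_on S (\<lambda>x. \<integral>t. f' i x t \<partial>P)" by (rule continuous_on_integral[OF f'[OF i]])
  fix x assume x: "x \<in> S"
  define U where "U = {y. x(i := y) \<in> S}"
  have c: "continuous_on (U \<times> T) (\<lambda>p. (x(i := fst p), snd p))"
    by (intro continuous_on_Pair continuous_on_fun_upd continuous_intros)
  have "((\<lambda>y. \<integral>t. f (x(i := y)) t \<partial>P) has_derivative (\<lambda>h. h *\<^sub>R (\<integral>t. f' i (x(i := x i)) t \<partial>P))) (at (x i))"
  proof (rule has_derivative_integral[OF bounded_bilinear_scaleR, where U = U])
    show "open U" "x i \<in> U" using S i x by (auto simp: U_def line_open_def)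
    show "continuous_on T (f (x(i := y)))" if "y \<in> U" for y
      using that by (intro continuous_on_slice[OF f]) (auto simp: U_def)
    have "continuous_on (U \<times> T) (\<lambda>p. (\<lambda>(x, t). f' i x t) (x(i := fst p), snd p))"
      by (rule continuous_on_compose2[OF f'[OF i] c]) (auto simp: U_def)
    then show "continuous_on (U \<times> T) (\<lambda>(y, t). f' i (x(i := y)) t)"
      by (simp add: split_beta)
    show "((\<lambda>y. f (x(i := y)) t) has_derivative (\<lambda>h. h *\<^sub>R f' i (x(i := y)) t)) (at y)" if "y \<in> U" "t \<in> T" for y t
      using D[OF i, of "x(i := y)" t] that by (simp add: U_def has_vector_derivative_def)
  qed
  then show "((\<lambda>y. \<integral>t. f (x(i := y)) t \<partial>P) has_vector_derivative (\<integral>t. f' i x t \<partial>P)) (at (x i))"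
    by (simp add: has_vector_derivative_def)
qed

section \<open>The averaged kernel solves the transformed equation\<close>

text \<open>
  The squared distance of the generalized translation. It runs from \<open>r\<^sup>2\<close> at \<open>t = 0\<close> to the squared
  distance from the point reflected in all of the first \<open>n\<close> coordinates at \<open>t = (1, \<dots>, 1)\<close>.
\<close>

definition sqd :: "nat \<Rightarrow> nat \<Rightarrow> (nat \<Rightarrow> real) \<Rightarrow> (nat \<Rightarrow> real) \<Rightarrow> (nat \<Rightarrow> real) \<Rightarrow> real" where
  "sqd m n x0 x t = (\<Sum>i=1..m. (x i - x0 i)\<^sup>2) + (\<Sum>j=1..n. 4 * x j * x0 j * t j)"

definition sqd' :: "nat \<Rightarrow> (nat \<Rightarrow> real) \<Rightarrow> nat \<Rightarrow> (nat \<Rightarrow> real) \<Rightarrow> (nat \<Rightarrow> real) \<Rightarrow> real" where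
  "sqd' n x0 i x t = 2 * (x i - x0 i) + (if i \<in> {1..n} then 4 * x0 i * t i else 0)"

lemma line_open_positive_part: "line_open m (positive_part m n - {x0})"
  unfolding line_open_def
proof (intro ballI)
  fix x i assume x: "x \<in> positive_part m n - {x0}" and i: "i \<in> {1..m}"
  define c where "c \<longleftrightarrow> x(i := x0 i) = x0"
  have e1: "x(i := y) = x0 \<longleftrightarrow> y = x0 i \<and> c" for y
    unfolding c_def by (metis fun_upd_same)
  have e2: "x(i := y) \<in> positive_part m n \<longleftrightarrow> (i \<in> {1..n} \<longrightarrow> 0 < y)" for y
  proof -
    have "x(i := y) \<in> {1..m} \<rightarrow>\<^sub>E UNIV"
      using x i by (intro PiE_I) (auto simp: positive_part_def PiE_def extensional_def)
    then show ?thesis using x by (auto simp: positive_part_def)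
  qed
  have "{y. x(i := y) \<in> positive_part m n - {x0}} =
      (if i \<in> {1..n} then {0<..} else UNIV) - (if c then {x0 i} else {})"
    unfolding Diff_iff singleton_iff e1 e2
    by (cases "i \<in> {1..n}"; cases c) (auto simp del: atLeastAtMost_iff)
  moreover have "open ((if i \<in> {1..n} then {0<..} else UNIV) - (if c then {x0 i} else {}))"
    by (rule open_Diff) simp_all
  ultimately show "open {y. x(i := y) \<in> positive_part m n - {x0}}" by simp
qed

lemma positive_part_diff:
  assumes "x \<in> positive_part m n - {x0}" "x0 \<in> positive_part m n"
  shows "(\<Sum>i=1..m. (x i - x0 i)\<^sup>2) > 0"
proof -
  have "\<exists>i\<in>{1..m}. x i \<noteq> x0 i"
  proof (rule ccontr)
    assume "\<not> ?thesis"
    then have "x = x0"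
      using assms by (intro PiE_ext[of x "{1..m}" "\<lambda>_. UNIV" x0]) (auto simp: positive_part_def)
    then show False using assms by simp
  qed
  then obtain i where "i \<in> {1..m}" "x i \<noteq> x0 i" by auto
  then show ?thesis by (intro sum_pos2[of _ i]) auto
qed

lemma sqd_pos:
  assumes "x \<in> positive_part m n - {x0}" "x0 \<in> positive_part m n" "t \<in> unit_box n"
  shows "sqd m n x0 x t > 0"
proof -
  have "0 \<le> (\<Sum>j=1..n. 4 * x j * x0 j * t j)"
    using assms unit_boxD[OF assms(3)]
    by (intro sum_nonneg mult_nonneg_nonneg) (auto simp: positive_part_def intro: less_imp_le)
  then show ?thesis using positive_part_diff[OF assms(1,2)] by (simp add: sqd_def)
qed

lemma sqd_deriv:
  assumes "i \<in> {1..m}"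
  shows "((\<lambda>y. sqd m n x0 (x(i := y)) t) has_real_derivative sqd' n x0 i x t) (at (x i))"
proof -
  have 1: "((\<lambda>y. ((x(i := y)) l - x0 l)\<^sup>2) has_real_derivative (if l = i then 2 * (x i - x0 i) else 0)) (at (x i))" for l
    by (cases "l = i") (auto intro!: derivative_eq_intros)
  have 2: "((\<lambda>y. 4 * (x(i := y)) l * x0 l * t l) has_real_derivative (if l = i then 4 * x0 i * t i else 0)) (at (x i))" for l
    by (cases "l = i") (auto intro!: derivative_eq_intros)
  have "((\<lambda>y. sqd m n x0 (x(i := y)) t) has_real_derivative
     (\<Sum>l=1..m. (if l = i then 2 * (x i - x0 i) else 0)) + (\<Sum>l=1..n. (if l = i then 4 * x0 i * t i else 0))) (at (x i))"
    unfolding sqd_def by (intro DERIV_add DERIV_sum 1 2)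
  then show ?thesis using assms by (simp add: sqd'_def)
qed

lemma sqd_deriv_t:
  assumes "j \<in> {1..n}"
  shows "((\<lambda>y. sqd m n x0 x (t(j := y))) has_real_derivative 4 * x j * x0 j) (at (t j))"
proof -
  have "((\<lambda>y. 4 * x l * x0 l * (t(j := y)) l) has_real_derivative (if l = j then 4 * x j * x0 j else 0)) (at (t j))" for l
    by (cases "l = j") (auto intro!: derivative_eq_intros)
  then have "((\<lambda>y. sqd m n x0 x (t(j := y))) has_real_derivative
     0 + (\<Sum>l=1..n. (if l = j then 4 * x j * x0 j else 0))) (at (t j))"
    unfolding sqd_def by (intro DERIV_add DERIV_sum DERIV_const)
  then show ?thesis using assms by simp
qed

lemma rker_chain:
  assumes "a \<notin> \<int>" "(g has_real_derivative g') (at z)" "g z > 0"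
  shows "((\<lambda>y. rker a \<mu> (of_real (g y))) has_vector_derivative - a * rker (a + 1) \<mu> (of_real (g z)) * of_real g') (at z)"
proof -
  have "((\<lambda>y. complex_of_real (g y)) has_vector_derivative of_real g') (at z)"
    using bounded_linear.has_vector_derivative[OF bounded_linear_of_real assms(2)[unfolded has_real_derivative_iff_has_vector_derivative]] .
  from field_vector_diff_chain_at[OF this rker_deriv[OF assms(1), of "of_real (g z)" \<mu>]] assms(3)
  show ?thesis by (simp add: o_def mult_ac)
qed

text \<open>
  The last assumption says that \<open>2a + 2\<close>, the dimension belonging to the radial kernel, equals
  \<open>m + 2(b\<^sub>1 + \<dots> + b\<^sub>n)\<close>, the dimension belonging to the operator. Below, \<open>V\<close> is the averaged kernel, and \<open>dV\<close>,
  \<open>ddV\<close> are its partial derivatives.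
\<close>

locale kernel_average =
  fixes m n :: nat and x0 :: "nat \<Rightarrow> real" and a \<mu> :: complex and b :: "nat \<Rightarrow> real"
  assumes x0: "x0 \<in> positive_part m n" and a: "a \<notin> \<int>" and b: "\<And>j. b j > 0" and nm: "n \<le> m"
    and a_eq: "a = of_real (real m / 2 - 1 + (\<Sum>j=1..n. b j))"
begin

abbreviation S :: "(nat \<Rightarrow> real) set" where "S \<equiv> positive_part m n - {x0}"

interpretation compact_measure "unit_box_law n b" "unit_box n" by (rule compact_measure_unit_box_law[OF b])

definition "R c x t = rker c \<mu> (of_real (sqd m n x0 x t))"
definition "dR i x t = - a * R (a + 1) x t * of_real (sqd' n x0 i x t)"
definition "ddR i j x t = a * (a + 1) * R (a + 2) x t * of_real (sqd' n x0 i x t * sqd' n x0 j x t)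
   - a * R (a + 1) x t * (if i = j then 2 else 0)"

definition "V x = (\<integral>t. R a x t \<partial>unit_box_law n b)"
definition "dV i x = (\<integral>t. dR i x t \<partial>unit_box_law n b)"
definition "ddV i j x = (\<integral>t. ddR i j x t \<partial>unit_box_law n b)"

lemma a1: "a + 1 \<notin> \<int>" "a + 2 \<notin> \<int>"
proof -
  have "a + of_int k \<notin> \<int>" for k using a Ints_diff[of "a + of_int k" "of_int k"] by auto
  from this[of 1] this[of 2] show "a + 1 \<notin> \<int>" "a + 2 \<notin> \<int>" by simp_all
qed

lemma sqd_positive: "x \<in> S \<Longrightarrow> t \<in> unit_box n \<Longrightarrow> sqd m n x0 x t > 0"
  by (rule sqd_pos[OF _ x0])

lemma R_continuous: "continuous_on (S \<times> unit_box n) (\<lambda>(x, t). R c x t)"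
proof -
  have "continuous_on (S \<times> unit_box n) (\<lambda>p. complex_of_real (sqd m n x0 (fst p) (snd p)))"
    unfolding sqd_def by (intro continuous_intros)
  then show ?thesis unfolding R_def split_beta
    by (intro continuous_intros) (simp_all add: sqd_positive mem_Times_iff del: Diff_iff)
qed

lemma sqd'_continuous: "continuous_on A (\<lambda>p. sqd' n x0 i (fst p) (snd p))"
  unfolding sqd'_def by (cases "i \<in> {1..n}") (auto intro!: continuous_intros)

lemma dR_continuous: "continuous_on (S \<times> unit_box n) (\<lambda>(x, t). dR i x t)"
  using R_continuous[of "a + 1"] unfolding dR_def split_beta
  by (intro continuous_intros sqd'_continuous)

lemma ddR_continuous: "continuous_on (S \<times> unit_box n) (\<lambda>(x, t). ddR i j x t)"
  using R_continuous[of "a + 1"] R_continuous[of "a + 2"] unfolding ddR_def split_beta of_real_mult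
  by (intro continuous_intros sqd'_continuous)

lemma R_deriv:
  assumes "i \<in> {1..m}" "x \<in> S" "t \<in> unit_box n" "c \<notin> \<int>"
  shows "((\<lambda>y. R c (x(i := y)) t) has_vector_derivative - c * R (c + 1) x t * of_real (sqd' n x0 i x t)) (at (x i))"
  unfolding R_def using rker_chain[OF assms(4) sqd_deriv[OF assms(1), of n x0 x t], of \<mu>] sqd_positive[OF assms(2,3)] by simp

lemma dR_deriv:
  assumes i: "i \<in> {1..m}" and j: "j \<in> {1..m}" and x: "x \<in> S" and t: "t \<in> unit_box n"
  shows "((\<lambda>y. dR i (x(j := y)) t) has_vector_derivative ddR i j x t) (at (x j))"
proof -
  have "((\<lambda>y. sqd' n x0 i (x(j := y)) t) has_real_derivative (if i = j then 2 else 0)) (at (x j))"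
    unfolding sqd'_def by (cases "i = j") (auto intro!: derivative_eq_intros)
  then have "((\<lambda>y. complex_of_real (sqd' n x0 i (x(j := y)) t)) has_vector_derivative of_real (if i = j then 2 else 0)) (at (x j))"
    by (intro bounded_linear.has_vector_derivative[OF bounded_linear_of_real])
       (simp add: has_real_derivative_iff_has_vector_derivative)
  from has_vector_derivative_mult[OF has_vector_derivative_mult_right[OF R_deriv[OF j x t a1(1)], of "- a"] this]
  have "((\<lambda>y. dR i (x(j := y)) t) has_vector_derivative
     - a * R (a + 1) x t * of_real (if i = j then 2 else 0) +
     - a * (- (a + 1) * R (a + 1 + 1) x t * of_real (sqd' n x0 j x t)) * of_real (sqd' n x0 i x t)) (at (x j))"
    by (simp add: dR_def)
  moreover have "- a * R (a + 1) x t * of_real (if i = j then 2 else 0) +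
     - a * (- (a + 1) * R (a + 1 + 1) x t * of_real (sqd' n x0 j x t)) * of_real (sqd' n x0 i x t) = ddR i j x t"
  proof -
    have e: "a + 1 + 1 = a + 2" by simp
    show ?thesis unfolding e by (cases "i = j") (simp_all add: ddR_def algebra_simps)
  qed
  ultimately show ?thesis by (simp only:)
qed

lemma V_partials: "has_partials m V dV S" "\<And>i. i \<in> {1..m} \<Longrightarrow> has_partials m (dV i) (ddV i) S"
proof -
  have S: "line_open m S" by (rule line_open_positive_part)
  show "has_partials m V dV S"
    unfolding V_def[abs_def] dV_def[abs_def]
    by (rule has_partials_integral[OF S R_continuous dR_continuous]) (use R_deriv a in \<open>simp add: dR_def\<close>)
  show "has_partials m (dV i) (ddV i) S" if i: "i \<in> {1..m}" for i
    unfolding ddV_def[abs_def] dV_def[abs_def]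
    by (rule has_partials_integral[OF S dR_continuous ddR_continuous]) (use dR_deriv i in simp)
qed

text \<open>
  With \<open>s = \<dots> + (x\<^sub>i - x\<^sub>0\<^sub>i)\<^sup>2 + 4x\<^sub>i x\<^sub>0\<^sub>i t\<^sub>i\<close>, the integrands of the two sides differ by \<open>4a x\<^sub>0\<^sub>i/x\<^sub>i\<close> times
  \<open>b\<^sub>i(1 - 2t\<^sub>i) h + t\<^sub>i(1 - t\<^sub>i) \<partial>h/\<partial>t\<^sub>i\<close> for \<open>h = R (a + 1) x\<close>, and the expectation of this expression vanishes.
  On the right, the coefficient of the second derivative is the share of the \<open>i\<close>-th coordinate in \<open>4s\<close>.
\<close>

lemma one_variable_identity:
  assumes i: "i \<in> {1..n}" and x: "x \<in> S"
  shows "ddV i i x + of_real (2 * b i / x i) * dV i x =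
    (\<integral>t. 4 * a * (a + 1) * R (a + 2) x t * of_real ((x i - x0 i)\<^sup>2 + 4 * x i * x0 i * t i)
        - a * of_real (2 + 4 * b i) * R (a + 1) x t \<partial>unit_box_law n b)"
proof -
  have "x i > 0" using x i by (auto simp: positive_part_def)
  then have xi: "x i \<noteq> 0" by simp
  let ?L = "\<lambda>t. ddR i i x t + of_real (2 * b i / x i) * dR i x t"
  let ?M = "\<lambda>t. 4 * a * (a + 1) * R (a + 2) x t * of_real ((x i - x0 i)\<^sup>2 + 4 * x i * x0 i * t i)
        - a * of_real (2 + 4 * b i) * R (a + 1) x t"
  let ?B = "\<lambda>t. of_real (b i * (1 - 2 * t i)) * R (a + 1) x t + of_real (t i * (1 - t i)) * (- (a + 1) * R (a + 2) x t * of_real (4 * x i * x0 i))"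
  have c: "continuous_on (unit_box n) (R c x)" for c by (rule continuous_on_slice[OF R_continuous x])
  have cd: "continuous_on (unit_box n) (dR j x)" "continuous_on (unit_box n) (ddR j l x)" for j l
    by (rule continuous_on_slice[OF dR_continuous x], rule continuous_on_slice[OF ddR_continuous x])
  have alg: "a * (a + 1) * R2 * ((2 * (X - Y) + 4 * Y * T) * (2 * (X - Y) + 4 * Y * T)) - a * R1 * 2
      + (2 * B / X) * (- a * R1 * (2 * (X - Y) + 4 * Y * T)) =
     (4 * a * (a + 1) * R2 * ((X - Y)\<^sup>2 + 4 * X * Y * T) - a * (2 + 4 * B) * R1) +
     (4 * a * Y / X) * ((B * (1 - 2 * T)) * R1 + (T * (1 - T)) * (- (a + 1) * R2 * (4 * X * Y)))"
    if "X \<noteq> 0" for X Y T B R1 R2 :: complex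
  proof -
    have e: "(4 * a * Y / X) * ((B * (1 - 2 * T)) * R1 + (T * (1 - T)) * (- (a + 1) * R2 * (4 * X * Y)))
      = (4 * a * Y / X) * B * (1 - 2 * T) * R1 - 16 * a * (a + 1) * Y\<^sup>2 * T * (1 - T) * R2"
      using that by (simp add: field_simps power2_eq_square)
    have f: "(2 * B / X) * (- a * R1 * (2 * (X - Y) + 4 * Y * T)) = - 4 * a * B * R1 + (4 * a * Y / X) * B * (1 - 2 * T) * R1"
      using that by (simp add: field_simps)
    show ?thesis unfolding e f by (simp add: algebra_simps power2_eq_square)
  qed
  have pt: "?L t = ?M t + of_real (4 * x0 i / x i) * a * ?B t" for t
    using alg[of "of_real (x i)" "R (a + 2) x t" "of_real (x0 i)" "of_real (t i)" "R (a + 1) x t" "of_real (b i)"] xi i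
    unfolding ddR_def dR_def sqd'_def by (simp add: mult_ac)
  have "(\<integral>t. ?B t \<partial>unit_box_law n b) = 0"
  proof (rule unit_box_law_integration_by_parts[OF b i])
    fix t assume t: "t \<in> unit_box n"
    have p: "sqd m n x0 x (t(i := t i)) > 0" using sqd_positive[OF x t] by simp
    have "a + 1 + 1 = a + 2" by simp
    with rker_chain[OF a1(1) sqd_deriv_t[OF i, of m x0 x t] p, of \<mu>]
    show "((\<lambda>y. R (a + 1) x (t(i := y))) has_vector_derivative - (a + 1) * R (a + 2) x t * of_real (4 * x i * x0 i)) (at (t i))"
      by (simp add: R_def fun_upd_def)
  qed (intro continuous_intros c)+
  then have B0: "(\<integral>t. of_real (4 * x0 i / x i) * a * ?B t \<partial>unit_box_law n b) = 0" by simp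
  have "ddV i i x + of_real (2 * b i / x i) * dV i x = (\<integral>t. ?L t \<partial>unit_box_law n b)"
    unfolding ddV_def dV_def
    by (subst Bochner_Integration.integral_add) (auto intro!: integrable_cont continuous_intros cd simp: xi)
  also have "\<dots> = (\<integral>t. ?M t \<partial>unit_box_law n b) + (\<integral>t. of_real (4 * x0 i / x i) * a * ?B t \<partial>unit_box_law n b)"
    unfolding pt by (rule Bochner_Integration.integral_add; intro integrable_cont continuous_intros c)
  finally show ?thesis unfolding B0 by simp
qed

text \<open>
  The shares of the coordinates add up to \<open>4s\<close>, the coefficients of the first derivative to \<open>4(a + 1)\<close>,
  and the integrand becomes the radial equation of the kernel.
\<close>

lemma V_pde:
  assumes x: "x \<in> S"
  shows "(\<Sum>i=1..m. ddV i i x + (if i \<in> {1..n} then of_real (2 * b i / x i) else 0) * dV i x) = 4 * \<mu> * V x"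
proof -
  have c: "continuous_on (unit_box n) (R c x)" for c by (rule continuous_on_slice[OF R_continuous x])
  let ?q = "\<lambda>i t. (x i - x0 i)\<^sup>2 + (if i \<in> {1..n} then 4 * x i * x0 i * t i else 0)"
  let ?M = "\<lambda>i t. 4 * a * (a + 1) * R (a + 2) x t * of_real (?q i t)
        - a * of_real (2 + (if i \<in> {1..n} then 4 * b i else 0)) * R (a + 1) x t"
  have cM: "continuous_on (unit_box n) (?M i)" for i
    by (cases "i \<in> {1..n}") (auto intro!: continuous_intros c)
  have one: "ddV i i x + (if i \<in> {1..n} then of_real (2 * b i / x i) else 0) * dV i x = (\<integral>t. ?M i t \<partial>unit_box_law n b)" for i
  proof (cases "i \<in> {1..n}")
    case True
    then show ?thesis using one_variable_identity[OF True x] by simp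
  next
    case False
    then have "ddR i i x t = ?M i t" for t
      by (simp add: ddR_def sqd'_def power2_eq_square algebra_simps del: atLeastAtMost_iff One_nat_def)
    then show ?thesis using False by (simp add: ddV_def del: atLeastAtMost_iff One_nat_def)
  qed
  have sum1: "(\<Sum>i=1..m. if i \<in> {1..n} then f i else 0) = (\<Sum>i=1..n. f i)" for f :: "nat \<Rightarrow> real"
    using nm by (intro sum.mono_neutral_cong_right) auto
  have sq: "(\<Sum>i=1..m. ?q i t) = sqd m n x0 x t" for t
    unfolding sum.distrib sum1 sqd_def ..
  have sb: "of_real (\<Sum>i=1..m. 2 + (if i \<in> {1..n} then 4 * b i else 0)) = 4 * (a + 1)"
    unfolding sum.distrib sum1 a_eq by (simp add: sum_distrib_left)
  have pt: "(\<Sum>i=1..m. ?M i t) = 4 * \<mu> * R a x t" if t: "t \<in> unit_box n" for t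
  proof -
    have s: "complex_of_real (sqd m n x0 x t) \<noteq> 0" using sqd_positive[OF x t] by simp
    have "(\<Sum>i=1..m. ?M i t) = 4 * a * (a + 1) * R (a + 2) x t * of_real (\<Sum>i=1..m. ?q i t)
        - a * of_real (\<Sum>i=1..m. 2 + (if i \<in> {1..n} then 4 * b i else 0)) * R (a + 1) x t"
      by (simp only: sum_subtractf sum_distrib_left sum_distrib_right of_real_sum)
    also have "\<dots> = 4 * (a * (a + 1) * (of_real (sqd m n x0 x t) * R (a + 2) x t - R (a + 1) x t))"
      unfolding sq sb by (simp add: algebra_simps)
    also have "\<dots> = 4 * (\<mu> * R a x t)" unfolding R_def by (simp only: rker_ode[OF a s])
    finally show ?thesis by simp
  qed
  have "(\<Sum>i=1..m. ddV i i x + (if i \<in> {1..n} then of_real (2 * b i / x i) else 0) * dV i x) =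
     (\<integral>t. (\<Sum>i=1..m. ?M i t) \<partial>unit_box_law n b)"
    unfolding one by (rule Bochner_Integration.integral_sum[symmetric]) (rule integrable_cont[OF cM])
  also have "\<dots> = (\<integral>t. 4 * \<mu> * R a x t \<partial>unit_box_law n b)"
    using pt space_T by (intro Bochner_Integration.integral_cong) auto
  finally show ?thesis by (simp add: V_def)
qed

end

section \<open>Laplace transforms of beta laws\<close>

definition gamma_kernel :: "real \<Rightarrow> real \<Rightarrow> real \<Rightarrow> real" where
  "gamma_kernel a s v = indicator {0..} v * (v powr (a - 1) * exp (- (s * v)))"

lemma gamma_kernel_measurable [measurable]: "gamma_kernel a s \<in> borel_measurable borel"
  unfolding gamma_kernel_def[abs_def] by measurable

lemma gamma_kernel_nonneg: "gamma_kernel a s v \<ge> 0"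
  by (simp add: gamma_kernel_def)

lemma gamma_kernel_integral:
  assumes a: "a > 0" and s: "s > 0"
  shows "has_bochner_integral lborel (gamma_kernel a s) (Gamma a * s powr (- a))"
proof -
  have "(\<integral>\<^sup>+v. ennreal (gamma_kernel a 1 v) \<partial>lborel) = ennreal (Gamma a)"
    using Gamma_conv_nn_integral_real[OF a]
    by (simp add: gamma_kernel_def exp_minus field_simps)
  then have 1: "has_bochner_integral lborel (gamma_kernel a 1) (Gamma a)"
    using Gamma_real_pos[OF a] gamma_kernel_nonneg by (intro has_bochner_integral_nn_integral) auto
  have "has_bochner_integral lborel (\<lambda>v. gamma_kernel a 1 (0 + s * v)) (Gamma a /\<^sub>R \<bar>s\<bar>)"
    using 1 s by (subst lborel_has_bochner_integral_real_affine_iff[symmetric]) auto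
  also have "(\<lambda>v. gamma_kernel a 1 (0 + s * v)) = (\<lambda>v. s powr (a - 1) * gamma_kernel a s v)"
    using s by (auto simp: gamma_kernel_def fun_eq_iff powr_mult indicator_def zero_le_mult_iff)
  finally have "has_bochner_integral lborel (\<lambda>v. s powr (1 - a) * (s powr (a - 1) * gamma_kernel a s v)) (s powr (1 - a) * (Gamma a /\<^sub>R \<bar>s\<bar>))"
    by (rule has_bochner_integral_mult_right)
  also have "(\<lambda>v. s powr (1 - a) * (s powr (a - 1) * gamma_kernel a s v)) = gamma_kernel a s"
    using s by (simp add: mult.assoc[symmetric] flip: powr_add)
  also have "s powr (1 - a) * (Gamma a /\<^sub>R \<bar>s\<bar>) = Gamma a * s powr (- a)"
    using s by (simp add: powr_diff powr_minus field_simps)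
  finally show ?thesis .
qed

definition beta_laplace :: "real \<Rightarrow> real \<Rightarrow> real" where
  "beta_laplace b y = (\<integral>t. exp (- (y * t)) \<partial>beta_law b)"

lemma beta_laplace_bounds:
  assumes "b > 0"
  shows "beta_laplace b y \<ge> 0" "y \<ge> 0 \<Longrightarrow> beta_laplace b y \<le> 1"
proof -
  interpret compact_measure "beta_law b" "{0..1}" by (rule compact_measure_beta_law[OF assms])
  show "beta_laplace b y \<ge> 0" unfolding beta_laplace_def by (intro integral_nonneg_AE) auto
  assume y: "y \<ge> 0"
  have "beta_laplace b y \<le> (\<integral>t. 1 \<partial>beta_law b)"
    unfolding beta_laplace_def using y
    by (intro integral_mono integrable_cont continuous_intros) auto
  then show "beta_laplace b y \<le> 1"
    using emeasure_beta_law[OF assms] by (simp add: measure_def)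
qed

text \<open>
  For large \<open>y\<close> only small \<open>t\<close> matter, and there the density is \<open>t\<^bsup>b-1\<^esup>\<close> up to a factor close to \<open>1\<close>; for the
  density \<open>t\<^bsup>b-1\<^esup>\<close> on \<open>[0, \<infinity>)\<close> the value is exactly \<open>\<Gamma>(b) y\<^sup>-\<^sup>b\<close>. The difference of the two integrals,
  multiplied by \<open>y\<^sup>b\<close>, tends to \<open>0\<close> by dominated convergence: below \<open>1\<close> the estimate \<open>(yt)\<^sup>b e\<^bsup>-yt\<^esup> \<le> 1\<close> leaves
  \<open>(1 - t)\<^bsup>b-1\<^esup>\<close> as a majorant, and above \<open>1\<close> the integrand at \<open>y = 1\<close> is one.
\<close>

lemma beta_laplace_asymp:
  assumes b: "0 < b" "b \<le> 1"
  shows "((\<lambda>y. y powr b * beta_laplace b y) \<longlongrightarrow> Gamma b / Beta b b) at_top"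
proof -
  define \<beta> where "\<beta> = (\<lambda>y t. indicator {0..1} t * (t powr (b - 1) * (1 - t) powr (b - 1) * exp (- (y * t))))"
  define \<phi> where "\<phi> = (\<lambda>y t. y powr b * (gamma_kernel b y t - \<beta> y t))"
  have [measurable]: "\<beta> y \<in> borel_measurable borel" for y unfolding \<beta>_def by measurable
  have B: "Beta b b > 0" by (rule Beta_pos) fact
  have iB: "integrable lborel (\<beta> y)" and vB: "(\<integral>t. \<beta> y t \<partial>lborel) = Beta b b * beta_laplace b y" for y
  proof -
    interpret compact_measure "beta_law b" "{0..1}" by (rule compact_measure_beta_law) fact
    have c: "continuous_on {0..1} (\<lambda>t. exp (- (y * t)))" by (intro continuous_intros)
    have m: "(\<lambda>t. exp (- (y * t))) \<in> borel_measurable (restrict_space borel {0..1})"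
      by (rule borel_measurable_continuous_on_restrict[OF c])
    have e: "indicator {0..1} t *\<^sub>R ((t powr (b - 1) * (1 - t) powr (b - 1) / Beta b b) *\<^sub>R exp (- (y * t))) = \<beta> y t / Beta b b" for t
      by (simp add: \<beta>_def)
    have "integrable lborel (\<lambda>t. \<beta> y t / Beta b b)"
      using integrable_beta_law_iff[OF b(1) m] integrable_cont[OF c] unfolding set_integrable_def e by simp
    from integrable_mult_right[OF this, of "Beta b b"] show "integrable lborel (\<beta> y)" using B by simp
    have "beta_laplace b y = (\<integral>t. \<beta> y t / Beta b b \<partial>lborel)"
      unfolding beta_laplace_def integral_beta_law[OF b(1) m] set_lebesgue_integral_def e ..
    then show "(\<integral>t. \<beta> y t \<partial>lborel) = Beta b b * beta_laplace b y" using B by simp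
  qed
  have "((\<lambda>y. \<integral>t. \<phi> y t \<partial>lborel) \<longlongrightarrow> integral\<^sup>L lborel (\<lambda>_::real. 0)) at_top"
  proof -
    let ?w = "\<lambda>t. indicator {0..1} t *\<^sub>R (t powr (1 - 1) * (1 - t) powr (b - 1)) + gamma_kernel b 1 t"
    have w: "integrable lborel ?w"
      using integrable_Beta[of 1 b] b gamma_kernel_integral[of b 1]
      by (intro Bochner_Integration.integrable_add) (auto simp: set_integrable_def has_bochner_integral_iff)
    have bound: "norm (\<phi> y t) \<le> ?w t" if y: "y \<ge> 1" for y t
    proof -
      consider "t \<le> 0" | "0 < t" "t < 1" | "t \<ge> 1" by linarith
      then show "norm (\<phi> y t) \<le> ?w t"
      proof cases
        case 1
        then show ?thesis by (cases "t = 0") (auto simp: \<phi>_def \<beta>_def gamma_kernel_def)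
      next
        case 2
        let ?p = "(1 - t) powr (b - 1)"
        have "1 - t \<le> (1 - t) powr (1 - b)"
          using 2 b powr_mono'[of "1 - b" 1 "1 - t"] by simp
        then have "(1 - t) * ?p \<le> (1 - t) powr (1 - b) * ?p" by (rule mult_right_mono) simp
        also have "\<dots> = 1" using 2 by (simp flip: powr_add)
        finally have p1: "?p - 1 \<le> t * ?p" by (simp add: algebra_simps)
        have p2: "1 \<le> ?p" using 2 b powr_mono'[of "b - 1" 0 "1 - t"] by simp
        have "(y * t) powr b \<le> exp (y * t)"
        proof -
          have yt: "y * t > 0" using y 2 by simp
          have "(y * t) powr b \<le> 1 + y * t"
          proof (cases "y * t \<le> 1")
            case True
            then have "(y * t) powr b \<le> 1" using yt b powr_mono2[of b "y * t" 1] by simp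
            then show ?thesis using yt by simp
          next
            case False
            then have "(y * t) powr b \<le> (y * t) powr 1" using b by (intro powr_mono) auto
            then show ?thesis using yt by simp
          qed
          also have "\<dots> \<le> exp (y * t)" by (rule exp_ge_add_one_self)
          finally show ?thesis .
        qed
        then have e1: "(y * t) powr b * exp (- (y * t)) \<le> 1" by (simp add: exp_minus field_simps)
        have "norm (\<phi> y t) = y powr b * t powr (b - 1) * exp (- (y * t)) * (?p - 1)"
        proof -
          have "\<phi> y t = - (y powr b * t powr (b - 1) * exp (- (y * t)) * (?p - 1))"
            using 2 by (simp add: \<phi>_def \<beta>_def gamma_kernel_def algebra_simps)
          then show ?thesis using p2 by (simp add: abs_mult)
        qed
        also have "\<dots> \<le> y powr b * t powr (b - 1) * exp (- (y * t)) * (t * ?p)"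
          by (intro mult_left_mono p1) auto
        also have "\<dots> = ((y * t) powr b * exp (- (y * t))) * ?p"
          using 2 y by (simp add: powr_mult powr_diff)
        also have "\<dots> \<le> 1 * ?p" by (intro mult_right_mono e1) auto
        also have "\<dots> \<le> ?w t" using 2 gamma_kernel_nonneg[of b 1 t] by simp
        finally show ?thesis .
      next
        case 3
        have "y powr b \<le> y powr 1" using b y by (intro powr_mono) auto
        also have "\<dots> \<le> exp (y - 1)" using y exp_ge_add_one_self[of "y - 1"] by simp
        also have "\<dots> \<le> exp ((y - 1) * t)" using y 3 mult_left_mono[of 1 t "y - 1"] by simp
        finally have "y powr b * exp (- (y * t)) \<le> exp ((y - 1) * t) * exp (- (y * t))"
          by (intro mult_right_mono) auto
        also have "\<dots> = exp (- t)" by (simp add: algebra_simps flip: exp_add)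
        finally have e: "y powr b * exp (- (y * t)) \<le> exp (- t)" .
        have "\<beta> y t = 0" using 3 by (cases "t = 1") (auto simp: \<beta>_def)
        then have "norm (\<phi> y t) = t powr (b - 1) * (y powr b * exp (- (y * t)))"
          using 3 by (simp add: \<phi>_def gamma_kernel_def abs_mult)
        also have "\<dots> \<le> t powr (b - 1) * exp (- t)" by (intro mult_left_mono e) auto
        also have "\<dots> = gamma_kernel b 1 t" using 3 by (simp add: gamma_kernel_def)
        also have "\<dots> \<le> ?w t" by (simp add: indicator_def)
        finally show ?thesis .
      qed
    qed
    have lim: "((\<lambda>y. \<phi> y t) \<longlongrightarrow> 0) at_top" for t
    proof -
      show "((\<lambda>y. \<phi> y t) \<longlongrightarrow> 0) at_top"
      proof (cases "t > 0")
        case True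
        have "((\<lambda>y. y powr b * exp (- (y * t))) \<longlongrightarrow> 0) at_top" using True b by real_asymp
        from tendsto_mult[OF tendsto_const[of "t powr (b - 1) * (1 - indicator {0..1} t * (1 - t) powr (b - 1))"] this]
        have "((\<lambda>y. t powr (b - 1) * (1 - indicator {0..1} t * (1 - t) powr (b - 1)) * (y powr b * exp (- (y * t)))) \<longlongrightarrow> 0) at_top"
          by simp
        moreover have "\<phi> y t = t powr (b - 1) * (1 - indicator {0..1} t * (1 - t) powr (b - 1)) * (y powr b * exp (- (y * t)))" for y
          using True by (simp add: \<phi>_def \<beta>_def gamma_kernel_def algebra_simps)
        ultimately show ?thesis by simp
      next
        case False
        then have "\<phi> y t = 0" for y by (cases "t = 0") (auto simp: \<phi>_def \<beta>_def gamma_kernel_def)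
        then show ?thesis by simp
      qed
    qed
    show ?thesis
    proof (rule integral_dominated_convergence_at_top[OF _ _ w])
      show "\<forall>\<^sub>F y in at_top. AE t in lborel. norm (\<phi> y t) \<le> ?w t"
        using bound by (intro eventually_at_top_linorderI[of 1] AE_I2)
    qed (use lim in \<open>auto simp: \<phi>_def\<close>)
  qed
  then have "((\<lambda>y. \<integral>t. \<phi> y t \<partial>lborel) \<longlongrightarrow> 0) at_top" by simp
  moreover have "\<forall>\<^sub>F y in at_top. (\<integral>t. \<phi> y t \<partial>lborel) = Gamma b - Beta b b * (y powr b * beta_laplace b y)"
  proof (rule eventually_at_top_linorderI[of 1])
    fix y :: real assume y: "y \<ge> 1"
    have "(\<integral>t. \<phi> y t \<partial>lborel) = y powr b * (Gamma b * y powr (- b) - Beta b b * beta_laplace b y)"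
      using gamma_kernel_integral[of b y] b y iB[of y] vB[of y]
      by (simp add: \<phi>_def has_bochner_integral_iff)
    also have "\<dots> = (y powr b * y powr (- b)) * Gamma b - Beta b b * (y powr b * beta_laplace b y)"
      by (simp add: algebra_simps)
    also have "y powr b * y powr (- b) = 1" using y by (simp flip: powr_add)
    finally show "(\<integral>t. \<phi> y t \<partial>lborel) = Gamma b - Beta b b * (y powr b * beta_laplace b y)" by simp
  qed
  ultimately have "((\<lambda>y. Gamma b - Beta b b * (y powr b * beta_laplace b y)) \<longlongrightarrow> 0) at_top"
    by (rule Lim_transform_eventually)
  then have "((\<lambda>y. (Gamma b - (Gamma b - Beta b b * (y powr b * beta_laplace b y))) / Beta b b) \<longlongrightarrow> (Gamma b - 0) / Beta b b) at_top"
    using B by (intro tendsto_intros) auto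
  then show ?thesis using B by simp
qed

lemma beta_laplace_bounded:
  assumes b: "0 < b" "b \<le> 1"
  obtains D where "D > 0" "\<And>y. y > 0 \<Longrightarrow> y powr b * beta_laplace b y \<le> D"
proof -
  from beta_laplace_asymp[OF b] have "\<forall>\<^sub>F y in at_top. y powr b * beta_laplace b y < Gamma b / Beta b b + 1"
    by (rule order_tendstoD) simp
  then obtain Y where Y: "\<And>y. y \<ge> Y \<Longrightarrow> y powr b * beta_laplace b y < Gamma b / Beta b b + 1"
    by (auto simp: eventually_at_top_linorder)
  let ?D = "max (Gamma b / Beta b b + 1) (\<bar>Y\<bar> powr b)"
  show ?thesis
  proof (rule that[of ?D])
    have "Gamma b / Beta b b > 0" using b Beta_pos[of b] Gamma_real_pos[of b] by simp
    then show "?D > 0" by simp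
    fix y :: real assume y: "y > 0"
    show "y powr b * beta_laplace b y \<le> ?D"
    proof (cases "y \<ge> Y")
      case True
      from Y[OF this] show ?thesis by simp
    next
      case False
      have "y powr b * beta_laplace b y \<le> y powr b * 1"
        using beta_laplace_bounds[of b y] b y by (intro mult_left_mono) auto
      also have "\<dots> \<le> \<bar>Y\<bar> powr b" using False y b by simp (intro powr_mono2, auto)
      finally show ?thesis by simp
    qed
  qed
qed

text \<open>
  Writing the power as a Gamma integral and exchanging the integrals, the exponential of a sum
  factorizes over the independent coordinates.
\<close>

lemma expectation_powr_laplace:
  assumes b: "\<And>j. b j > 0" and a: "a > 0" and c: "\<And>j. j \<in> {1..n} \<Longrightarrow> c j \<ge> 0"
  shows "has_bochner_integral lborel (\<lambda>v. gamma_kernel a 1 v * (\<Prod>j=1..n. beta_laplace (b j) (c j * v)))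
     (Gamma a * (\<integral>t. (1 + (\<Sum>j=1..n. c j * t j)) powr (- a) \<partial>unit_box_law n b))"
proof -
  interpret P: compact_measure "unit_box_law n b" "unit_box n" by (rule compact_measure_unit_box_law[OF b])
  interpret product_sigma_finite "\<lambda>j. beta_law (b j)"
    using finite_measure_beta_law[OF b]
    by (intro product_sigma_finite.intro) (auto simp: finite_measure.axioms(1))
  interpret pair_sigma_finite "unit_box_law n b" lborel ..
  define w where "w = (\<lambda>t::nat \<Rightarrow> real. 1 + (\<Sum>j=1..n. c j * t j))"
  have cw: "continuous_on (unit_box n) w" unfolding w_def by (intro continuous_intros)
  have [measurable]: "w \<in> borel_measurable (unit_box_law n b)" by (rule P.borel_measurable_cont[OF cw])
  have w: "w t \<ge> 1" if "t \<in> unit_box n" for t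
    using c unit_boxD[OF that] by (auto simp: w_def intro!: sum_nonneg)
  let ?f = "\<lambda>t v. gamma_kernel a (w t) v"
  have m: "(\<lambda>(t, v). ?f t v) \<in> borel_measurable (unit_box_law n b \<Otimes>\<^sub>M lborel)"
    unfolding gamma_kernel_def by measurable
  have hb: "has_bochner_integral lborel (?f t) (Gamma a * w t powr (- a))" if "t \<in> unit_box n" for t
    using w[OF that] a by (intro gamma_kernel_integral) auto
  have int: "integrable (unit_box_law n b \<Otimes>\<^sub>M lborel) (\<lambda>(t, v). ?f t v)"
  proof (rule Fubini_integrable[OF m])
    have "integrable (unit_box_law n b) (\<lambda>t. Gamma a * w t powr (- a))"
      using w by (intro P.integrable_cont continuous_intros cw) fastforce
    moreover have "(\<integral>v. norm (?f t v) \<partial>lborel) = Gamma a * w t powr (- a)" if "t \<in> unit_box n" for t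
      using hb[OF that] gamma_kernel_nonneg by (simp add: has_bochner_integral_iff)
    ultimately show "integrable (unit_box_law n b) (\<lambda>t. \<integral>v. norm (case (t, v) of (t, v) \<Rightarrow> ?f t v) \<partial>lborel)"
      using P.space_T Bochner_Integration.integrable_cong[OF refl, of "unit_box_law n b"
        "\<lambda>t. \<integral>v. norm (?f t v) \<partial>lborel" "\<lambda>t. Gamma a * w t powr (- a)"] by simp
    show "AE t in unit_box_law n b. integrable lborel (\<lambda>v. case (t, v) of (t, v) \<Rightarrow> ?f t v)"
      using hb P.space_T by (intro AE_I2) (auto simp: has_bochner_integral_iff)
  qed
  have inner: "(\<integral>t. ?f t v \<partial>unit_box_law n b) = gamma_kernel a 1 v * (\<Prod>j=1..n. beta_laplace (b j) (c j * v))" for v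
  proof -
    have "?f t v = gamma_kernel a 1 v * (\<Prod>j=1..n. exp (- ((c j * v) * t j)))" for t
    proof -
      have "exp (- (w t * v)) = exp (- v) * exp (\<Sum>j=1..n. - ((c j * v) * t j))"
        unfolding w_def exp_add[symmetric] by (simp add: algebra_simps sum_distrib_left sum_negf)
      then show ?thesis by (simp add: gamma_kernel_def exp_sum)
    qed
    moreover have "(\<integral>t. (\<Prod>j=1..n. exp (- ((c j * v) * t j))) \<partial>unit_box_law n b) = (\<Prod>j=1..n. beta_laplace (b j) (c j * v))"
      unfolding unit_box_law_def beta_laplace_def
      by (rule product_integral_prod)
         (auto intro!: compact_measure.integrable_cont[OF compact_measure_beta_law[OF b]] continuous_intros)
    ultimately show ?thesis by simp
  qed
  have "(\<integral>v. (\<integral>t. ?f t v \<partial>unit_box_law n b) \<partial>lborel) = (\<integral>t. (\<integral>v. ?f t v \<partial>lborel) \<partial>unit_box_law n b)"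
    by (rule Fubini_integral[OF int])
  also have "\<dots> = (\<integral>t. Gamma a * w t powr (- a) \<partial>unit_box_law n b)"
    using hb P.space_T by (intro Bochner_Integration.integral_cong) (auto simp: has_bochner_integral_iff)
  finally have "(\<integral>v. gamma_kernel a 1 v * (\<Prod>j=1..n. beta_laplace (b j) (c j * v)) \<partial>lborel) =
     Gamma a * (\<integral>t. w t powr (- a) \<partial>unit_box_law n b)" unfolding inner by simp
  moreover have "integrable lborel (\<lambda>v. gamma_kernel a 1 v * (\<Prod>j=1..n. beta_laplace (b j) (c j * v)))"
    using integrable_snd[OF int] unfolding inner by simp
  ultimately show ?thesis unfolding w_def by (simp add: has_bochner_integral_iff)
qed

section \<open>Asymptotics of the averaged kernel at the pole\<close>

text \<open>
  The explicit value of the limit at the pole. It depends on the limits \<open>k\<^sub>j\<close> only, hence is the same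
  along all sequences that approach the pole.
\<close>

definition kernel_limit :: "nat \<Rightarrow> real \<Rightarrow> (nat \<Rightarrow> real) \<Rightarrow> (nat \<Rightarrow> real) \<Rightarrow> real" where
  "kernel_limit n a b k = (\<Prod>j=1..n. k j powr (- b j) * (Gamma (b j) / Beta (b j) (b j)))
     * Gamma (a - (\<Sum>j=1..n. b j)) / Gamma a"

lemma kernel_limit_pos:
  assumes b: "\<And>j. 0 < b j" and a: "a > (\<Sum>j=1..n. b j)" and k: "\<And>j. j \<in> {1..n} \<Longrightarrow> k j > 0"
  shows "kernel_limit n a b k > 0"
proof -
  have "a > 0" using a b sum_nonneg[of "{1..n}" b] by (auto simp: less_imp_le intro: le_less_trans)
  moreover have "(\<Prod>j=1..n. k j powr (- b j) * (Gamma (b j) / Beta (b j) (b j))) > 0"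
  proof (rule prod_pos)
    show "0 < k j powr (- b j) * (Gamma (b j) / Beta (b j) (b j))" if "j \<in> {1..n}" for j
      using k[OF that] b[of j] Beta_pos[of "b j"] Gamma_real_pos[of "b j"] by simp
  qed
  ultimately show ?thesis
    unfolding kernel_limit_def using a by (intro divide_pos_pos mult_pos_pos Gamma_real_pos) auto
qed

text \<open>
  After the Laplace representation and the substitution \<open>y = v/R\<close>, each factor,
  multiplied by \<open>R\<^bsup>-b\<^sub>j\<^esup>\<close>, is \<open>(\<kappa>\<^sub>j v)\<^bsup>-b\<^sub>j\<^esup>\<close> times
  \<open>y\<^bsup>b\<^sub>j\<^esup> beta_laplace b\<^sub>j y\<close> at \<open>y = \<kappa>\<^sub>j v / R \<rightarrow> \<infinity>\<close>. The latter is bounded and converges, and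
  \<open>v\<^bsup>a-1\<^esup> e\<^bsup>-v\<^esup> \<Prod>\<^sub>j v\<^bsup>-b\<^sub>j\<^esup>\<close> is integrable because \<open>a\<close> exceeds the sum of the \<open>b\<^sub>j\<close>. The lower bounds \<open>c\<^sub>j\<close> make
  the majorant independent of \<open>i\<close>.
\<close>

lemma expectation_powr_limit:
  fixes \<kappa> :: "nat \<Rightarrow> nat \<Rightarrow> real" and R :: "nat \<Rightarrow> real"
  assumes b: "\<And>j. 0 < b j" "\<And>j. b j \<le> 1" and a: "a > (\<Sum>j=1..n. b j)"
    and R: "\<And>i. R i > 0" "R \<longlonglongrightarrow> 0"
    and c: "\<And>j. j \<in> {1..n} \<Longrightarrow> c j > 0" "\<And>i j. j \<in> {1..n} \<Longrightarrow> c j \<le> \<kappa> i j"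
    and k: "\<And>j. j \<in> {1..n} \<Longrightarrow> (\<lambda>i. \<kappa> i j) \<longlonglongrightarrow> k j"
  shows "(\<lambda>i. R i powr (a - (\<Sum>j=1..n. b j)) * (\<integral>t. (R i + (\<Sum>j=1..n. \<kappa> i j * t j)) powr (- a) \<partial>unit_box_law n b))
     \<longlonglongrightarrow> kernel_limit n a b k"
proof -
  define A where "A = (\<Sum>j=1..n. b j)"
  have A: "A \<ge> 0" "a > A" "a > 0" using a b(1) sum_nonneg[of "{1..n}" b] by (auto simp: A_def less_imp_le intro: le_less_trans)
  interpret compact_measure "unit_box_law n b" "unit_box n" by (rule compact_measure_unit_box_law[OF b(1)])
  define N where "N = (\<lambda>j y. y powr b j * beta_laplace (b j) y)"
  define C where "C = (\<lambda>j. Gamma (b j) / Beta (b j) (b j))"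
  have C: "C j > 0" for j using b(1)[of j] Beta_pos[of "b j"] Gamma_real_pos[of "b j"] by (simp add: C_def)
  have "\<exists>D. D > 0 \<and> (\<forall>y>0. N j y \<le> D)" for j
    using beta_laplace_bounded[OF b(1)[of j] b(2)[of j]] unfolding N_def by metis
  then obtain D where D: "\<And>j. D j > 0" "\<And>j y. y > 0 \<Longrightarrow> N j y \<le> D j" by metis
  have N0: "N j y \<ge> 0" for j y using beta_laplace_bounds(1)[OF b(1)] by (simp add: N_def)
  have \<kappa>: "\<kappa> i j > 0" if "j \<in> {1..n}" for i j using c(2)[OF that, of i] c(1)[OF that] by linarith
  have kpos: "k j > 0" if "j \<in> {1..n}" for j
    using LIMSEQ_le_const[OF k[OF that], of "c j"] c[OF that] by (auto intro: less_le_trans)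
  define h where "h = (\<lambda>i v. (\<Prod>j=1..n. \<kappa> i j powr (- b j) * N j (\<kappa> i j / R i * v)) * gamma_kernel (a - A) 1 v)"
  have h: "R i powr (- A) * (gamma_kernel a 1 v * (\<Prod>j=1..n. beta_laplace (b j) (\<kappa> i j / R i * v))) = h i v" for i v
  proof (cases "v > 0")
    case True
    have r: "R i > 0" by (rule R)
    have "(\<Prod>j=1..n. \<kappa> i j powr (- b j) * N j (\<kappa> i j / R i * v)) =
        (\<Prod>j=1..n. (v / R i) powr b j * beta_laplace (b j) (\<kappa> i j / R i * v))"
    proof (rule prod.cong[OF refl])
      fix j assume j: "j \<in> {1..n}"
      have "(\<kappa> i j / R i * v) powr b j = \<kappa> i j powr b j * (v / R i) powr b j"
        using \<kappa>[OF j, of i] r True by (simp flip: powr_mult)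
      then have "\<kappa> i j powr (- b j) * (\<kappa> i j / R i * v) powr b j = (\<kappa> i j powr (- b j) * \<kappa> i j powr b j) * (v / R i) powr b j"
        by simp
      also have "\<kappa> i j powr (- b j) * \<kappa> i j powr b j = 1"
        using \<kappa>[OF j, of i] by (simp flip: powr_add)
      finally show "\<kappa> i j powr (- b j) * N j (\<kappa> i j / R i * v) = (v / R i) powr b j * beta_laplace (b j) (\<kappa> i j / R i * v)"
        by (simp add: N_def mult.assoc[symmetric])
    qed
    also have "\<dots> = (v / R i) powr A * (\<Prod>j=1..n. beta_laplace (b j) (\<kappa> i j / R i * v))"
      unfolding prod.distrib A_def using True r by (subst powr_sum) auto
    finally have "h i v = ((v / R i) powr A * gamma_kernel (a - A) 1 v) * (\<Prod>j=1..n. beta_laplace (b j) (\<kappa> i j / R i * v))"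
      by (simp add: h_def)
    also have "(v / R i) powr A * gamma_kernel (a - A) 1 v = R i powr (- A) * gamma_kernel a 1 v"
      using True r by (simp add: gamma_kernel_def powr_divide powr_minus divide_simps flip: powr_add)
    finally show ?thesis by simp
  next
    case False
    then have "gamma_kernel d 1 v = 0" for d by (cases "v = 0") (auto simp: gamma_kernel_def)
    then show ?thesis by (simp add: h_def)
  qed
  have val: "R i powr (a - A) * (\<integral>t. (R i + (\<Sum>j=1..n. \<kappa> i j * t j)) powr (- a) \<partial>unit_box_law n b) = (\<integral>v. h i v \<partial>lborel) / Gamma a"
    and hm: "h i \<in> borel_measurable borel" for i
  proof -
    have r: "R i > 0" by (rule R)
    have "has_bochner_integral lborel (\<lambda>v. gamma_kernel a 1 v * (\<Prod>j=1..n. beta_laplace (b j) (\<kappa> i j / R i * v)))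
       (Gamma a * (\<integral>t. (1 + (\<Sum>j=1..n. \<kappa> i j / R i * t j)) powr (- a) \<partial>unit_box_law n b))"
      using \<kappa> r by (intro expectation_powr_laplace b A) (auto simp: less_imp_le)
    from has_bochner_integral_mult_right[OF this, of "R i powr (- A)"]
    have H: "has_bochner_integral lborel (h i) (R i powr (- A) * (Gamma a * (\<integral>t. (1 + (\<Sum>j=1..n. \<kappa> i j / R i * t j)) powr (- a) \<partial>unit_box_law n b)))"
      unfolding h .
    then have "h i \<in> borel_measurable lborel" by (auto simp: has_bochner_integral_iff dest: borel_measurable_integrable)
    then show "h i \<in> borel_measurable borel" by simp
    have pt: "(R i + (\<Sum>j=1..n. \<kappa> i j * t j)) powr (- a) = R i powr (- a) * (1 + (\<Sum>j=1..n. \<kappa> i j / R i * t j)) powr (- a)"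
      if t: "t \<in> unit_box n" for t
    proof -
      have "0 \<le> (\<Sum>j=1..n. \<kappa> i j / R i * t j)"
        using \<kappa> r unit_boxD[OF t] by (intro sum_nonneg mult_nonneg_nonneg) (auto simp: less_imp_le)
      moreover have "R i + (\<Sum>j=1..n. \<kappa> i j * t j) = R i * (1 + (\<Sum>j=1..n. \<kappa> i j / R i * t j))"
        using r by (simp add: distrib_left sum_distrib_left)
      ultimately show ?thesis using r by (simp add: powr_mult)
    qed
    have "(\<integral>t. (R i + (\<Sum>j=1..n. \<kappa> i j * t j)) powr (- a) \<partial>unit_box_law n b) =
       (\<integral>t. R i powr (- a) * (1 + (\<Sum>j=1..n. \<kappa> i j / R i * t j)) powr (- a) \<partial>unit_box_law n b)"
      using pt space_T by (intro Bochner_Integration.integral_cong) auto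
    moreover have "R i powr (a - A) * R i powr (- a) = R i powr (- A)" by (simp flip: powr_add)
    ultimately have "R i powr (a - A) * (\<integral>t. (R i + (\<Sum>j=1..n. \<kappa> i j * t j)) powr (- a) \<partial>unit_box_law n b) =
       R i powr (- A) * (\<integral>t. (1 + (\<Sum>j=1..n. \<kappa> i j / R i * t j)) powr (- a) \<partial>unit_box_law n b)"
      by (simp add: mult.assoc[symmetric])
    then show "R i powr (a - A) * (\<integral>t. (R i + (\<Sum>j=1..n. \<kappa> i j * t j)) powr (- a) \<partial>unit_box_law n b) = (\<integral>v. h i v \<partial>lborel) / Gamma a"
      using H Gamma_real_pos[OF A(3)] by (simp add: has_bochner_integral_iff)
  qed
  define f where "f = (\<lambda>v. (\<Prod>j=1..n. k j powr (- b j) * C j) * gamma_kernel (a - A) 1 v)"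
  have "(\<lambda>i. \<integral>v. h i v \<partial>lborel) \<longlonglongrightarrow> (\<integral>v. f v \<partial>lborel)"
  proof (rule integral_dominated_convergence)
    let ?w = "\<lambda>v. (\<Prod>j=1..n. c j powr (- b j) * D j) * gamma_kernel (a - A) 1 v"
    show "integrable lborel ?w"
      using gamma_kernel_integral[of "a - A" 1] A by (simp add: has_bochner_integral_iff)
    show "AE v in lborel. norm (h i v) \<le> ?w v" for i
    proof (rule AE_I2)
      fix v :: real
      show "norm (h i v) \<le> ?w v"
      proof (cases "v > 0")
        case True
        have "(\<Prod>j=1..n. \<kappa> i j powr (- b j) * N j (\<kappa> i j / R i * v)) \<le> (\<Prod>j=1..n. c j powr (- b j) * D j)"
        proof (rule prod_mono, intro conjI mult_mono)
          fix j assume j: "j \<in> {1..n}"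
          show "\<kappa> i j powr (- b j) \<le> c j powr (- b j)"
            using c[OF j] b(1)[of j] by (intro powr_mono2') auto
          show "N j (\<kappa> i j / R i * v) \<le> D j" using \<kappa>[OF j] R True by (intro D) simp
        qed (use N0 in auto)
        moreover have "0 \<le> (\<Prod>j=1..n. \<kappa> i j powr (- b j) * N j (\<kappa> i j / R i * v))"
          using N0 by (intro prod_nonneg) auto
        ultimately show ?thesis
          unfolding h_def using gamma_kernel_nonneg[of "a - A" 1 v] by (simp add: abs_mult mult_right_mono)
      next
        case False
        then have "gamma_kernel (a - A) 1 v = 0" by (cases "v = 0") (auto simp: gamma_kernel_def)
        then show ?thesis by (simp add: h_def)
      qed
    qed
    show "AE v in lborel. (\<lambda>i. h i v) \<longlonglongrightarrow> f v"
    proof (rule AE_I2)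
      fix v :: real
      show "(\<lambda>i. h i v) \<longlonglongrightarrow> f v"
      proof (cases "v > 0")
        case True
        have "(\<lambda>i. \<kappa> i j powr (- b j) * N j (\<kappa> i j / R i * v)) \<longlonglongrightarrow> k j powr (- b j) * C j" if j: "j \<in> {1..n}" for j
        proof (rule tendsto_mult)
          show "(\<lambda>i. \<kappa> i j powr (- b j)) \<longlonglongrightarrow> k j powr (- b j)"
            using kpos[OF j] by (intro tendsto_powr k[OF j] tendsto_const) simp
          have "filterlim (\<lambda>i. inverse (R i)) at_top sequentially"
            using R by (intro filterlim_inverse_at_top) auto
          then have "filterlim (\<lambda>i. \<kappa> i j * v * inverse (R i)) at_top sequentially"
            using kpos[OF j] True
            by (intro filterlim_tendsto_pos_mult_at_top[of "\<lambda>i. \<kappa> i j * v" "k j * v"] tendsto_mult k[OF j] tendsto_const) auto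
          then have "filterlim (\<lambda>i. \<kappa> i j / R i * v) at_top sequentially"
            by (simp add: divide_inverse mult_ac)
          with beta_laplace_asymp[OF b(1)[of j] b(2)[of j]]
          show "(\<lambda>i. N j (\<kappa> i j / R i * v)) \<longlonglongrightarrow> C j"
            unfolding N_def C_def by (rule filterlim_compose)
        qed
        then show ?thesis unfolding h_def f_def by (intro tendsto_mult[OF tendsto_prod tendsto_const])
      next
        case False
        then have "gamma_kernel (a - A) 1 v = 0" by (cases "v = 0") (auto simp: gamma_kernel_def)
        then show ?thesis by (simp add: h_def f_def)
      qed
    qed
  qed (use hm in \<open>auto simp: f_def\<close>)
  then have "(\<lambda>i. (\<integral>v. h i v \<partial>lborel) / Gamma a) \<longlonglongrightarrow> (\<integral>v. f v \<partial>lborel) / Gamma a"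
    using Gamma_real_pos[OF A(3)] by (intro tendsto_intros) auto
  then have lim: "(\<lambda>i. R i powr (a - A) * (\<integral>t. (R i + (\<Sum>j=1..n. \<kappa> i j * t j)) powr (- a) \<partial>unit_box_law n b))
      \<longlonglongrightarrow> (\<integral>v. f v \<partial>lborel) / Gamma a"
    unfolding val .
  have "(\<integral>v. f v \<partial>lborel) = (\<Prod>j=1..n. k j powr (- b j) * C j) * Gamma (a - A)"
    using gamma_kernel_integral[of "a - A" 1] A by (simp add: f_def has_bochner_integral_iff)
  then show ?thesis using lim by (simp add: kernel_limit_def A_def C_def)
qed

lemma rker_of_real:
  assumes "s > 0"
  shows "rker (of_real a) \<mu> (of_real s) = of_real (s powr (- a)) * hyp01 (1 - of_real a) (\<mu> * of_real s)"
  using assms by (simp add: rker_def powr_of_real flip: of_real_minus)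

text \<open>
  Compared with \<open>s\<^sup>-\<^sup>a\<close>, the kernel carries a factor \<open>0F1\<close> that is within \<open>\<epsilon>\<close> of \<open>1\<close> for small \<open>s\<close>. For the
  remaining \<open>s\<close> it is bounded, and so is \<open>s\<^sup>-\<^sup>a\<close>; that part is annihilated by the positive power of \<open>R\<close>.
\<close>

lemma expectation_rker_limit:
  fixes \<kappa> :: "nat \<Rightarrow> nat \<Rightarrow> real" and R :: "nat \<Rightarrow> real" and \<mu> :: complex
  assumes b: "\<And>j. 0 < b j" "\<And>j. b j \<le> 1" and a: "a > (\<Sum>j=1..n. b j)"
    and R: "\<And>i. R i > 0" "R \<longlonglongrightarrow> 0"
    and c: "\<And>j. j \<in> {1..n} \<Longrightarrow> c j > 0" "\<And>i j. j \<in> {1..n} \<Longrightarrow> c j \<le> \<kappa> i j"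
    and k: "\<And>j. j \<in> {1..n} \<Longrightarrow> (\<lambda>i. \<kappa> i j) \<longlonglongrightarrow> k j"
  shows "(\<lambda>i. of_real (R i powr (a - (\<Sum>j=1..n. b j))) *
        (\<integral>t. rker (of_real a) \<mu> (of_real (R i + (\<Sum>j=1..n. \<kappa> i j * t j))) \<partial>unit_box_law n b)) \<longlonglongrightarrow> complex_of_real (kernel_limit n a b k)"
proof -
  define A where "A = (\<Sum>j=1..n. b j)"
  have A: "a > A" using a by (simp add: A_def)
  interpret compact_measure "unit_box_law n b" "unit_box n" by (rule compact_measure_unit_box_law[OF b(1)])
  have T1: "measure (unit_box_law n b) (unit_box n) = 1" by (rule compact_measure_unit_box_law[OF b(1)])
  have kpos: "k j > 0" if "j \<in> {1..n}" for j
    using LIMSEQ_le_const[OF k[OF that], of "c j"] c[OF that] by (auto intro: less_le_trans)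
  define L where "L = kernel_limit n a b k"
  have L: "L > 0" unfolding L_def by (rule kernel_limit_pos[OF b(1) a kpos])
  define s where "s = (\<lambda>i t. R i + (\<Sum>j=1..n. \<kappa> i j * t j))"
  define E where "E = (\<lambda>i. \<integral>t. s i t powr (- a) \<partial>unit_box_law n b)"
  have \<kappa>: "\<kappa> i j > 0" if "j \<in> {1..n}" for i j using c(2)[OF that, of i] c(1)[OF that] by linarith
  have spos: "s i t > 0" if "t \<in> unit_box n" for i t
    using R(1)[of i] \<kappa>[of _ i] unit_boxD[OF that] unfolding s_def
    by (intro add_pos_nonneg sum_nonneg mult_nonneg_nonneg) (auto simp: less_imp_le)
  have cs: "continuous_on (unit_box n) (s i)" for i unfolding s_def by (intro continuous_intros)
  have csp: "continuous_on (unit_box n) (\<lambda>t. s i t powr (- a))" for i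
    using spos by (intro continuous_intros cs ballI) (metis less_irrefl)
  have cr: "continuous_on (unit_box n) (\<lambda>t. rker (of_real a) \<mu> (of_real (s i t)))" for i
    using spos by (intro continuous_intros cs) auto
  have LE: "(\<lambda>i. R i powr (a - A) * E i) \<longlonglongrightarrow> L"
    unfolding E_def s_def A_def L_def by (rule expectation_powr_limit[OF b a R c k])
  have "Bseq R" using R(2) by (intro convergent_imp_Bseq convergentI)
  then obtain K0 where K0: "\<And>i. norm (R i) \<le> K0" by (auto simp: Bseq_def)
  have "\<exists>K. \<forall>i. norm (\<kappa> i j) \<le> K" if "j \<in> {1..n}" for j
    using k[OF that] convergent_imp_Bseq[of "\<lambda>i. \<kappa> i j"] by (auto simp: Bseq_def convergent_def)
  then obtain K where K: "\<And>i j. j \<in> {1..n} \<Longrightarrow> norm (\<kappa> i j) \<le> K j" by metis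
  define S where "S = K0 + (\<Sum>j=1..n. K j)"
  have sS: "s i t \<le> S" if t: "t \<in> unit_box n" for i t
  proof -
    have "(\<Sum>j=1..n. \<kappa> i j * t j) \<le> (\<Sum>j=1..n. K j)"
    proof (rule sum_mono)
      fix j assume j: "j \<in> {1..n}"
      have "\<kappa> i j * t j \<le> \<kappa> i j" using unit_boxD[OF t j] \<kappa>[OF j, of i] by (simp add: mult_left_le)
      also have "\<dots> \<le> K j" using K[OF j, of i] by simp
      finally show "\<kappa> i j * t j \<le> K j" .
    qed
    then show ?thesis using K0[of i] by (simp add: s_def S_def)
  qed
  let ?H = "hyp01 (1 - of_real a)"
  have cH: "continuous_on X ?H" for X by (intro continuous_intros)
  have "bounded (?H ` cball 0 (norm \<mu> * S))"
    by (intro compact_imp_bounded compact_continuous_image cH) simp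
  then obtain B where B: "\<And>z. z \<in> cball 0 (norm \<mu> * S) \<Longrightarrow> norm (?H z) \<le> B"
    unfolding bounded_iff by blast
  define d where "d = (\<lambda>i. (\<integral>t. rker (of_real a) \<mu> (of_real (s i t)) \<partial>unit_box_law n b) - of_real (E i))"
  have "(\<lambda>i. of_real (R i powr (a - A)) * d i) \<longlonglongrightarrow> 0"
  proof (rule tendstoI)
    fix e :: real assume e: "e > 0"
    define \<epsilon> where "\<epsilon> = e / (2 * (L + 1))"
    have "e / (2 * p) * p = e / 2" if "p > 0" for p using that by simp
    from this[of "L + 1"] have \<epsilon>: "\<epsilon> * (L + 1) = e / 2" "\<epsilon> > 0"
      using e L unfolding \<epsilon>_def by (simp_all only:) simp_all
    have "isCont ?H 0" using cH[of UNIV] by (simp add: continuous_on_eq_continuous_at)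
    then obtain \<delta> where \<delta>: "\<delta> > 0" "\<And>z. norm z < \<delta> \<Longrightarrow> norm (?H z - 1) < \<epsilon>"
      using \<epsilon>(2) unfolding continuous_at_eps_delta by (auto simp: dist_norm)
    define \<rho> where "\<rho> = \<delta> / (norm \<mu> + 1)"
    have n1: "norm \<mu> + 1 > 0" using norm_ge_zero[of \<mu>] by linarith
    have \<rho>: "\<rho> > 0" "(norm \<mu> + 1) * \<rho> = \<delta>" using \<delta>(1) n1 by (auto simp: \<rho>_def)
    define M where "M = (B + 1) * \<rho> powr (- a)"
    have aux: "norm (d i) \<le> \<epsilon> * E i + M" for i
    proof -
      have pt: "norm (rker (of_real a) \<mu> (of_real (s i t)) - of_real (s i t powr (- a))) \<le> \<epsilon> * s i t powr (- a) + M" if t: "t \<in> unit_box n" for t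
      proof -
        have sp: "s i t > 0" by (rule spos[OF t])
        let ?z = "\<mu> * complex_of_real (s i t)"
        have nz: "norm ?z = norm \<mu> * s i t" using sp by (simp add: norm_mult)
        have "norm (?H ?z) \<le> B" using sS[OF t, of i] sp by (intro B) (simp add: nz mult_left_mono)
        then have HB: "norm (?H ?z - 1) \<le> B + 1" using norm_triangle_ineq4[of "?H ?z" 1] by simp
        then have B1: "0 \<le> B + 1" using norm_ge_zero order_trans by blast
        have "rker (of_real a) \<mu> (of_real (s i t)) - of_real (s i t powr (- a)) = of_real (s i t powr (- a)) * (?H ?z - 1)"
          unfolding rker_of_real[OF sp] by (simp add: algebra_simps)
        then have n: "norm (rker (of_real a) \<mu> (of_real (s i t)) - of_real (s i t powr (- a))) = s i t powr (- a) * norm (?H ?z - 1)"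
          by (simp add: norm_mult)
        show ?thesis
        proof (cases "s i t < \<rho>")
          case True
          have "norm ?z \<le> (norm \<mu> + 1) * s i t" unfolding nz using sp by (intro mult_right_mono) auto
          also have "\<dots> < \<delta>" using True n1 unfolding \<rho>(2)[symmetric] by (intro mult_strict_left_mono)
          finally have "s i t powr (- a) * norm (?H ?z - 1) \<le> s i t powr (- a) * \<epsilon>"
            using \<delta>(2)[of ?z] by (intro mult_left_mono) auto
          moreover have "M \<ge> 0" using B1 by (simp add: M_def)
          ultimately show ?thesis unfolding n by (simp add: mult.commute)
        next
          case False
          have "a > 0" using A b(1) sum_nonneg[of "{1..n}" b] by (auto simp: A_def less_imp_le intro: le_less_trans)
          then have "s i t powr (- a) \<le> \<rho> powr (- a)" using False \<rho> by (intro powr_mono2') auto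
          then have "s i t powr (- a) * norm (?H ?z - 1) \<le> \<rho> powr (- a) * (B + 1)"
            using HB by (intro mult_mono) auto
          moreover have "0 \<le> \<epsilon> * s i t powr (- a)" using \<epsilon> by simp
          ultimately show ?thesis unfolding n M_def by (simp add: mult.commute)
        qed
      qed
      have cc: "continuous_on (unit_box n) (\<lambda>t. complex_of_real (s i t powr (- a)))"
        by (intro continuous_intros csp)
      have "d i = (\<integral>t. rker (of_real a) \<mu> (of_real (s i t)) - of_real (s i t powr (- a)) \<partial>unit_box_law n b)"
        unfolding d_def E_def using integrable_cont[OF cr[of i]] integrable_cont[OF cc]
        by (simp flip: integral_complex_of_real)
      then have "norm (d i) \<le> (\<integral>t. norm (rker (of_real a) \<mu> (of_real (s i t)) - of_real (s i t powr (- a))) \<partial>unit_box_law n b)"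
        using integral_norm_bound by metis
      also have "\<dots> \<le> (\<integral>t. \<epsilon> * s i t powr (- a) + M \<partial>unit_box_law n b)"
        using pt space_T by (intro integral_mono integrable_cont continuous_intros cr csp cc) auto
      also have "\<dots> = \<epsilon> * E i + M"
        using integrable_cont[OF csp[of i]] T1 by (simp add: E_def space_T)
      finally show ?thesis .
    qed
    have "(\<lambda>i. R i powr (a - A) * M) \<longlonglongrightarrow> 0 powr (a - A) * M"
      using A R by (intro tendsto_intros tendsto_powr' R(2)) (auto simp: less_imp_le)
    then have "\<forall>\<^sub>F i in sequentially. R i powr (a - A) * M < e / 2"
      using e by (intro order_tendstoD) auto
    moreover have "\<forall>\<^sub>F i in sequentially. R i powr (a - A) * E i < L + 1"
      using LE by (rule order_tendstoD) simp
    ultimately show "\<forall>\<^sub>F i in sequentially. dist (of_real (R i powr (a - A)) * d i) 0 < e"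
    proof eventually_elim
      case (elim i)
      have "norm (of_real (R i powr (a - A)) * d i) \<le> R i powr (a - A) * (\<epsilon> * E i + M)"
        unfolding norm_mult using aux[of i] by (simp add: mult_left_mono)
      also have "\<dots> = \<epsilon> * (R i powr (a - A) * E i) + R i powr (a - A) * M" by (simp add: algebra_simps)
      also have "\<dots> < \<epsilon> * (L + 1) + e / 2"
        using elim \<epsilon> by (intro add_strict_mono mult_strict_left_mono) auto
      also have "\<dots> = e" using \<epsilon> by simp
      finally show ?case by simp
    qed
  qed
  from tendsto_add[OF this tendsto_of_real[OF LE]]
  have "(\<lambda>i. of_real (R i powr (a - A)) * (\<integral>t. rker (of_real a) \<mu> (of_real (s i t)) \<partial>unit_box_law n b)) \<longlonglongrightarrow> complex_of_real L"
    by (simp add: d_def algebra_simps)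
  then show ?thesis unfolding A_def s_def L_def .
qed

section \<open>The fundamental solutions\<close>

lemma HA_cong:
  assumes "\<And>j. j \<in> {1..n} \<Longrightarrow> b j = b' j" "\<And>j. j \<in> {1..n} \<Longrightarrow> c j = c' j"
  shows "HA n a b c = HA n a b' c'"
proof -
  have b: "(\<Prod>j=1..n. pochhammer (b j) (\<mu> j)) = (\<Prod>j=1..n. pochhammer (b' j) (\<mu> j))"
   and c: "(\<Prod>j=1..n. pochhammer (c j) (\<mu> j)) = (\<Prod>j=1..n. pochhammer (c' j) (\<mu> j))" for \<mu> :: "nat \<Rightarrow> nat"
    using assms by (auto intro!: prod.cong)
  have series: "HA_series n a b c = HA_series n a b' c'"
    unfolding HA_series_def b c ..
  have "HA_continuation n a b c = HA_continuation n a b' c'"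
    unfolding fun_eq_iff HA_continuation_def series by blast
  then show ?thesis unfolding HA_def series by (simp only:)
qed

lemma rdist_sq: "(rdist m x x0)\<^sup>2 = (\<Sum>i=1..m. (x i - x0 i)\<^sup>2)"
  by (simp add: rdist_def sum_nonneg)

lemma rdist_refl_sq:
  assumes "j \<in> {1..m}"
  shows "(rdist m x x0)\<^sup>2 - (rdist_refl m j x x0)\<^sup>2 = - 4 * x j * x0 j"
proof -
  have "(rdist_refl m j x x0)\<^sup>2 = (x j + x0 j)\<^sup>2 + (\<Sum>i\<in>{1..m} - {j}. (x i - x0 i)\<^sup>2)"
    unfolding rdist_refl_def by (intro real_sqrt_pow2 add_nonneg_nonneg sum_nonneg) auto
  then show ?thesis
    unfolding rdist_sq sum.remove[OF finite_atLeastAtMost assms] by (simp add: power2_eq_square algebra_simps)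
qed

text \<open>
  At the points of the claim, \<open>r\<^sup>2(1 - \<Sum>\<^sub>j \<xi>\<^sub>j t\<^sub>j) = s(x, t)\<close>, and the power of \<open>r\<close> turns the kernel at \<open>s/r\<^sup>2\<close> into
  the kernel at \<open>s\<close>.
\<close>

lemma HA_at_xi_var:
  assumes n: "n \<ge> 1" "n \<le> m" and a: "a \<notin> \<int>" and b: "\<And>j. b j > 0"
    and x: "x \<in> positive_part m n - {x0}" and x0: "x0 \<in> positive_part m n"
  shows "of_real (rdist m x x0 powr (- 2 * a)) * HA n (of_real a) (\<lambda>j. of_real (b j)) (\<lambda>j. of_real (2 * b j))
      (xi_var m n x x0, eta_var m lam x x0) =
    (\<integral>t. rker (of_real a) (lam\<^sup>2 / 4) (of_real (sqd m n x0 x t)) \<partial>unit_box_law n b)"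
proof -
  define r2 where "r2 = (rdist m x x0)\<^sup>2"
  have r2: "r2 > 0" using positive_part_diff[OF x x0] by (simp add: r2_def rdist_sq)
  have r: "rdist m x x0 \<ge> 0" by (simp add: rdist_def sum_nonneg)
  have rp: "rdist m x x0 powr (- 2 * a) = r2 powr (- a)"
  proof -
    have "rdist m x x0 > 0" using r r2 by (auto simp: r2_def less_le)
    then have "r2 powr (- a) = (rdist m x x0 powr 2) powr (- a)" by (simp add: r2_def)
    then show ?thesis by (simp add: powr_powr)
  qed
  have \<xi>: "xi_var m n x x0 j = of_real (- 4 * x j * x0 j / r2)" if "j \<in> {1..n}" for j
  proof -
    have jm: "j \<in> {1..m}" using that n by simp
    show ?thesis unfolding xi_var_def restrict_apply'[OF that] rdist_refl_sq[OF jm] r2_def ..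
  qed
  have dom: "(xi_var m n x x0, eta_var m lam x x0) \<in> HA_domain n"
  proof -
    have "Re (xi_var m n x x0 j) < 1 / real n" if j: "j \<in> {1..n}" for j
    proof -
      have "x j * x0 j > 0" using x x0 j by (auto simp: positive_part_def)
      then have "- 4 * x j * x0 j / r2 < 0" using r2 by (simp add: divide_neg_pos mult.assoc)
      then have "Re (xi_var m n x x0 j) < 0" unfolding \<xi>[OF j] by (simp only: Re_complex_of_real)
      then show ?thesis using n by (auto intro: less_trans)
    qed
    then have "xi_var m n x x0 \<in> {1..n} \<rightarrow>\<^sub>E {z. Re z < 1 / real n}"
      by (intro PiE_I) (auto simp: xi_var_def)
    then show ?thesis by (simp add: HA_domain_def)
  qed
  interpret compact_measure "unit_box_law n b" "unit_box n" by (rule compact_measure_unit_box_law[OF b])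
  have pt: "of_real (r2 powr (- a)) * rker (of_real a) (- eta_var m lam x x0) (1 - (\<Sum>j=1..n. xi_var m n x x0 j * of_real (t j)))
     = rker (of_real a) (lam\<^sup>2 / 4) (of_real (sqd m n x0 x t))" if t: "t \<in> unit_box n" for t
  proof -
    define s where "s = sqd m n x0 x t"
    have s: "s > 0" unfolding s_def by (rule sqd_pos[OF x x0 t])
    have "(\<Sum>j=1..n. xi_var m n x x0 j * of_real (t j)) = (\<Sum>j=1..n. of_real (- 4 * x j * x0 j / r2) * of_real (t j))"
      by (intro sum.cong) (simp_all only: \<xi>)
    then have "1 - (\<Sum>j=1..n. xi_var m n x x0 j * of_real (t j)) = of_real (1 + (\<Sum>j=1..n. 4 * x j * x0 j * t j) / r2)"
      by (simp add: sum_divide_distrib sum_negf)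
    also have "1 + (\<Sum>j=1..n. 4 * x j * x0 j * t j) / r2 = s / r2"
      using r2 by (simp add: s_def sqd_def r2_def rdist_sq field_simps)
    finally have w: "1 - (\<Sum>j=1..n. xi_var m n x x0 j * of_real (t j)) = of_real (s / r2)" .
    have arg: "- eta_var m lam x x0 * of_real (s / r2) = lam\<^sup>2 / 4 * of_real s"
      using r2 by (simp add: eta_var_def flip: r2_def)
    have "r2 powr (- a) * (s / r2) powr (- a) = s powr (- a)"
      using r2 s by (simp flip: powr_mult)
    then show ?thesis
      unfolding w s_def[symmetric] using r2 s arg
      by (subst rker_of_real, simp, subst rker_of_real, simp) (simp only: mult.assoc[symmetric] flip: of_real_mult)
  qed
  have "HA n (of_real a) (\<lambda>j. of_real (b j)) (\<lambda>j. of_real (2 * b j)) (xi_var m n x x0, eta_var m lam x x0) =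
     HA_integral n (of_real a) b (xi_var m n x x0, eta_var m lam x x0)"
    by (rule HA_eq_integral[OF n(1) _ b dom]) (use a in simp)
  then have "of_real (rdist m x x0 powr (- 2 * a)) * HA n (of_real a) (\<lambda>j. of_real (b j)) (\<lambda>j. of_real (2 * b j)) (xi_var m n x x0, eta_var m lam x x0)
    = (\<integral>t. of_real (r2 powr (- a)) * rker (of_real a) (- eta_var m lam x x0) (1 - (\<Sum>j=1..n. xi_var m n x x0 j * of_real (t j))) \<partial>unit_box_law n b)"
    unfolding rp HA_integral_def prod.case integral_mult_right_zero by simp
  also have "\<dots> = (\<integral>t. rker (of_real a) (lam\<^sup>2 / 4) (of_real (sqd m n x0 x t)) \<partial>unit_box_law n b)"
    using pt space_T by (intro Bochner_Integration.integral_cong) auto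
  finally show ?thesis .
qed

definition prefactor :: "nat \<Rightarrow> (nat \<Rightarrow> real) \<Rightarrow> (nat \<Rightarrow> real) \<Rightarrow> (nat \<Rightarrow> real) \<Rightarrow> real" where
  "prefactor k \<epsilon> x0 x = (\<Prod>i=1..k. (x i * x0 i) powr \<epsilon> i)"

definition log_deriv :: "nat \<Rightarrow> (nat \<Rightarrow> real) \<Rightarrow> nat \<Rightarrow> (nat \<Rightarrow> real) \<Rightarrow> complex" where
  "log_deriv k \<epsilon> i x = (if i \<in> {1..k} then of_real (\<epsilon> i / x i) else 0)"

definition log_deriv' :: "nat \<Rightarrow> (nat \<Rightarrow> real) \<Rightarrow> nat \<Rightarrow> nat \<Rightarrow> (nat \<Rightarrow> real) \<Rightarrow> complex" where
  "log_deriv' k \<epsilon> i j x = (if i = j \<and> i \<in> {1..k} then of_real (- \<epsilon> i / (x i)\<^sup>2) else 0)"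

lemma prefactor_partials:
  assumes k: "k \<le> n" and x0: "x0 \<in> positive_part m n"
  shows "has_partials m (\<lambda>x. of_real (c * prefactor k \<epsilon> x0 x)) (\<lambda>i x. log_deriv k \<epsilon> i x * of_real (c * prefactor k \<epsilon> x0 x))
     (positive_part m n - {x0})"
    and "has_partials m (log_deriv k \<epsilon> i) (log_deriv' k \<epsilon> i) (positive_part m n - {x0})"
proof -
  let ?S = "positive_part m n - {x0}"
  have pos: "x i > 0" "x0 i > 0" if "x \<in> ?S" "i \<in> {1..k}" for x i
    using that x0 k by (auto simp: positive_part_def)
  have nz: "x i \<noteq> 0" "x0 i \<noteq> 0" if "x \<in> ?S" "i \<in> {1..k}" for x i
    using pos[OF that] by auto
  have c0: "continuous_on ?S (\<lambda>x. complex_of_real (c * prefactor k \<epsilon> x0 x))"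
    unfolding prefactor_def using pos by (intro continuous_intros ballI) (use nz in auto)
  have c1: "continuous_on ?S (log_deriv k \<epsilon> i)" for i
  proof (cases "i \<in> {1..k}")
    case True
    show ?thesis unfolding log_deriv_def[abs_def] if_P[OF True]
      by (intro continuous_intros ballI) (use nz[OF _ True] in auto)
  next
    case False
    show ?thesis unfolding log_deriv_def[abs_def] if_not_P[OF False] by simp
  qed
  have c2: "continuous_on ?S (log_deriv' k \<epsilon> i j)" for i j
  proof (cases "i = j \<and> i \<in> {1..k}")
    case True
    show ?thesis unfolding log_deriv'_def[abs_def] if_P[OF True]
      by (intro continuous_intros ballI) (use nz[of _ i] True in auto)
  next
    case False
    show ?thesis unfolding log_deriv'_def[abs_def] if_not_P[OF False] by simp
  qed
  show "has_partials m (\<lambda>x. of_real (c * prefactor k \<epsilon> x0 x)) (\<lambda>i x. log_deriv k \<epsilon> i x * of_real (c * prefactor k \<epsilon> x0 x)) ?S"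
  proof (rule has_partialsI[OF c0])
    show "continuous_on ?S (\<lambda>x. log_deriv k \<epsilon> i x * of_real (c * prefactor k \<epsilon> x0 x))" for i
      by (intro continuous_on_mult c0 c1)
    fix i x assume x: "x \<in> ?S"
    have "((\<lambda>y. c * prefactor k \<epsilon> x0 (x(i := y))) has_real_derivative (if i \<in> {1..k} then \<epsilon> i / x i else 0) * (c * prefactor k \<epsilon> x0 x)) (at (x i))"
    proof (cases "i \<in> {1..k}")
      case True
      define Q where "Q = (\<Prod>l\<in>{1..k} - {i}. (x l * x0 l) powr \<epsilon> l)"
      have Q: "prefactor k \<epsilon> x0 (x(i := y)) = (y * x0 i) powr \<epsilon> i * Q" for y
        unfolding prefactor_def Q_def prod.remove[OF finite_atLeastAtMost True] by simp
      have Q': "prefactor k \<epsilon> x0 x = (x i * x0 i) powr \<epsilon> i * Q" using Q[of "x i"] by simp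
      have p: "x i > 0" "x0 i > 0" using pos[OF x True] by auto
      have "((\<lambda>y. c * ((y * x0 i) powr \<epsilon> i * Q)) has_real_derivative c * (\<epsilon> i / x i * (x i * x0 i) powr \<epsilon> i * Q)) (at (x i))"
        using p by (auto intro!: derivative_eq_intros simp: powr_diff)
      then show ?thesis unfolding Q Q' using True by (simp add: mult_ac)
    next
      case False
      then have "prefactor k \<epsilon> x0 (x(i := y)) = prefactor k \<epsilon> x0 x" for y
        unfolding prefactor_def by (intro prod.cong) auto
      then show ?thesis using False by (simp del: atLeastAtMost_iff)
    qed
    then have "((\<lambda>y. complex_of_real (c * prefactor k \<epsilon> x0 (x(i := y)))) has_vector_derivative
        of_real ((if i \<in> {1..k} then \<epsilon> i / x i else 0) * (c * prefactor k \<epsilon> x0 x))) (at (x i))"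
      unfolding has_real_derivative_iff_has_vector_derivative
      by (rule bounded_linear.has_vector_derivative[OF bounded_linear_of_real])
    moreover have "complex_of_real ((if i \<in> {1..k} then \<epsilon> i / x i else 0) * (c * prefactor k \<epsilon> x0 x)) =
        log_deriv k \<epsilon> i x * of_real (c * prefactor k \<epsilon> x0 x)" by (simp add: log_deriv_def)
    ultimately show "((\<lambda>y. complex_of_real (c * prefactor k \<epsilon> x0 (x(i := y)))) has_vector_derivative
       log_deriv k \<epsilon> i x * of_real (c * prefactor k \<epsilon> x0 x)) (at (x i))" by (simp only:)
  qed
  show "has_partials m (log_deriv k \<epsilon> i) (log_deriv' k \<epsilon> i) ?S"
  proof (rule has_partialsI[OF c1 c2])
    fix j x assume x: "x \<in> ?S"
    show "((\<lambda>y. log_deriv k \<epsilon> i (x(j := y))) has_vector_derivative log_deriv' k \<epsilon> i j x) (at (x j))"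
    proof (cases "i = j \<and> i \<in> {1..k}")
      case True
      then have "x i > 0" using pos[OF x, of i] by simp
      then have "((\<lambda>y. \<epsilon> i / y) has_real_derivative - \<epsilon> i / (x i)\<^sup>2) (at (x i))"
        by (auto intro!: derivative_eq_intros simp: power2_eq_square)
      then have "((\<lambda>y. complex_of_real (\<epsilon> i / y)) has_vector_derivative of_real (- \<epsilon> i / (x i)\<^sup>2)) (at (x i))"
        unfolding has_real_derivative_iff_has_vector_derivative
        by (rule bounded_linear.has_vector_derivative[OF bounded_linear_of_real])
      then show ?thesis using True by (simp add: log_deriv_def log_deriv'_def)
    next
      case False
      then have "log_deriv k \<epsilon> i (x(j := y)) = log_deriv k \<epsilon> i x" for y
        by (auto simp: log_deriv_def)
      then show ?thesis using False by (auto simp: log_deriv'_def)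
    qed
  qed
qed

text \<open>
  Conjugation by the prefactor: with logarithmic derivative \<open>g = (1 - 2\<alpha>\<^sub>i)/x\<^sub>i\<close>, \<open>i \<le> k\<close>, one has
  \<open>2g + 2\<alpha>\<^sub>i/x\<^sub>i = (2 - 2\<alpha>\<^sub>i)/x\<^sub>i\<close>, and the terms without derivatives of the average cancel,
  \<open>g\<^sup>2 + \<partial>g/\<partial>x\<^sub>i + (2\<alpha>\<^sub>i/x\<^sub>i) g = 0\<close>.
\<close>

lemma average_solves_gen_Helmholtz:
  fixes m n k :: nat and \<alpha> :: "nat \<Rightarrow> real"
  assumes k: "k \<le> n" and nm: "n \<le> m" and x0: "x0 \<in> positive_part m n"
    and \<alpha>: "\<And>j. j \<in> {1..n} \<Longrightarrow> b j = (if j \<le> k then 1 - \<alpha> j else \<alpha> j)"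
    and b: "\<And>j. b j > 0" and a: "a \<notin> \<int>" and a_eq: "a = real m / 2 - 1 + (\<Sum>j=1..n. b j)"
  shows "solves_gen_Helmholtz m n \<alpha> lam
    (\<lambda>x. of_real (c * prefactor k (\<lambda>i. 1 - 2 * \<alpha> i) x0 x) *
       (\<integral>t. rker (of_real a) (lam\<^sup>2 / 4) (of_real (sqd m n x0 x t)) \<partial>unit_box_law n b)) (positive_part m n - {x0})"
proof -
  interpret K: kernel_average m n x0 "of_real a" "lam\<^sup>2 / 4" b
  proof unfold_locales
    show "complex_of_real a \<notin> \<int>" using a by simp
  qed (use x0 b nm a_eq in simp_all)
  let ?\<epsilon> = "\<lambda>i. 1 - 2 * \<alpha> i"
  let ?P = "\<lambda>x. complex_of_real (c * prefactor k ?\<epsilon> x0 x)"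
  let ?g = "log_deriv k ?\<epsilon>" and ?g' = "log_deriv' k ?\<epsilon>"
  let ?u = "\<lambda>x. ?P x * K.V x"
  define D where "D = (\<lambda>i x. ?P x * K.dV i x + (?g i x * ?P x) * K.V x)"
  define DD where "DD = (\<lambda>i j x. (?P x * K.ddV i j x + (?g j x * ?P x) * K.dV i x)
      + ((?g i x * ?P x) * K.dV j x + (?g i x * (?g j x * ?P x) + ?g' i j x * ?P x) * K.V x))"
  note P = prefactor_partials(1)[OF k x0, where c = c and \<epsilon> = ?\<epsilon>] and g = prefactor_partials(2)[OF k x0, where \<epsilon> = ?\<epsilon>]
  have u: "has_partials m ?u D K.S"
    unfolding D_def by (rule has_partials_mult[OF P K.V_partials(1)])
  have Du: "has_partials m (D i) (DD i) K.S" if i: "i \<in> {1..m}" for i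
    unfolding D_def DD_def
    by (rule has_partials_add[OF has_partials_mult[OF P K.V_partials(2)[OF i]]
         has_partials_mult[OF has_partials_mult[OF g P] K.V_partials(1)]])
  note C2 = C2_on_partials[OF u line_open_positive_part Du]
  have pde: "(\<Sum>i=1..m. pderiv_fun i (pderiv_fun i ?u) x) + (\<Sum>j=1..n. complex_of_real (2 * \<alpha> j / x j) * pderiv_fun j ?u x) - lam\<^sup>2 * ?u x = 0"
    if x: "x \<in> K.S" for x
  proof -
    have summand: "DD i i x + (if i \<in> {1..n} then of_real (2 * \<alpha> i / x i) else 0) * D i x =
       ?P x * (K.ddV i i x + (if i \<in> {1..n} then of_real (2 * b i / x i) else 0) * K.dV i x)" if i: "i \<in> {1..m}" for i
    proof -
      let ?B = "if i \<in> {1..n} then complex_of_real (2 * \<alpha> i / x i) else 0"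
      have 1: "2 * ?g i x + ?B = (if i \<in> {1..n} then of_real (2 * b i / x i) else 0)"
      proof (cases "i \<in> {1..n}")
        case True
        have "2 * (if i \<in> {1..k} then (1 - 2 * \<alpha> i) / x i else 0) + 2 * \<alpha> i / x i = 2 * b i / x i"
          using True \<alpha>[OF True] by (auto simp: add_divide_distrib[symmetric])
        then have "complex_of_real (2 * (if i \<in> {1..k} then (1 - 2 * \<alpha> i) / x i else 0) + 2 * \<alpha> i / x i) = of_real (2 * b i / x i)"
          by (simp only:)
        then show ?thesis using True by (simp add: log_deriv_def if_distrib del: atLeastAtMost_iff split: if_splits)
      next
        case False
        then have "i \<notin> {1..k}" using k by auto
        then show ?thesis using False by (simp add: log_deriv_def del: atLeastAtMost_iff)
      qed
      have 2: "?g i x * ?g i x + ?g' i i x + ?B * ?g i x = 0"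
      proof (cases "i \<in> {1..k}")
        case True
        then have inn: "i \<in> {1..n}" using k by auto
        then have "x i > 0" using x by (auto simp: positive_part_def)
        then have "(1 - 2 * \<alpha> i) / x i * ((1 - 2 * \<alpha> i) / x i) + - (1 - 2 * \<alpha> i) / (x i)\<^sup>2 + 2 * \<alpha> i / x i * ((1 - 2 * \<alpha> i) / x i) = 0"
          by (simp add: field_simps power2_eq_square)
        then have "complex_of_real ((1 - 2 * \<alpha> i) / x i * ((1 - 2 * \<alpha> i) / x i) + - (1 - 2 * \<alpha> i) / (x i)\<^sup>2 + 2 * \<alpha> i / x i * ((1 - 2 * \<alpha> i) / x i)) = 0"
          by (simp only: of_real_0)
        then show ?thesis using True inn by (simp add: log_deriv_def log_deriv'_def del: atLeastAtMost_iff)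
      next
        case False
        then show ?thesis by (simp add: log_deriv_def log_deriv'_def del: atLeastAtMost_iff)
      qed
      have "DD i i x + ?B * D i x = ?P x * (K.ddV i i x + (2 * ?g i x + ?B) * K.dV i x)
         + ?P x * K.V x * (?g i x * ?g i x + ?g' i i x + ?B * ?g i x)"
        unfolding DD_def D_def by (simp only: algebra_simps mult_2)
      then show ?thesis unfolding 1 2 by simp
    qed
    have "(\<Sum>j=1..n. complex_of_real (2 * \<alpha> j / x j) * D j x) = (\<Sum>i=1..m. (if i \<in> {1..n} then of_real (2 * \<alpha> i / x i) else 0) * D i x)"
      using nm by (intro sum.mono_neutral_cong_left) auto
    then have "(\<Sum>i=1..m. DD i i x) + (\<Sum>j=1..n. complex_of_real (2 * \<alpha> j / x j) * D j x) =
       (\<Sum>i=1..m. DD i i x + (if i \<in> {1..n} then of_real (2 * \<alpha> i / x i) else 0) * D i x)"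
      by (simp only: sum.distrib)
    also have "\<dots> = ?P x * (\<Sum>i=1..m. K.ddV i i x + (if i \<in> {1..n} then of_real (2 * b i / x i) else 0) * K.dV i x)"
      unfolding sum_distrib_left by (intro sum.cong refl summand)
    also have "\<dots> = lam\<^sup>2 * ?u x" unfolding K.V_pde[OF x] by simp
    finally have "(\<Sum>i=1..m. DD i i x) + (\<Sum>j=1..n. complex_of_real (2 * \<alpha> j / x j) * D j x) = lam\<^sup>2 * ?u x" .
    moreover have "(\<Sum>i=1..m. pderiv_fun i (pderiv_fun i ?u) x) = (\<Sum>i=1..m. DD i i x)"
      using C2(3) x by (intro sum.cong) auto
    moreover have "(\<Sum>j=1..n. complex_of_real (2 * \<alpha> j / x j) * pderiv_fun j ?u x) = (\<Sum>j=1..n. complex_of_real (2 * \<alpha> j / x j) * D j x)"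
      using C2(2) x nm by (intro sum.cong) auto
    ultimately show ?thesis by simp
  qed
  have "solves_gen_Helmholtz m n \<alpha> lam ?u K.S"
    unfolding solves_gen_Helmholtz_def using C2(1) pde by blast
  then show ?thesis by (simp add: K.V_def K.R_def)
qed

text \<open>
  \<open>q_fun\<close> equals the average only on the given set, while \<open>pderiv_fun\<close> refers to a function on the whole
  space; along coordinate lines the values on the set determine the derivatives.
\<close>

lemma solves_gen_Helmholtz_cong:
  assumes u: "solves_gen_Helmholtz m n \<alpha> lam u S" and S: "line_open m S" and nm: "n \<le> m"
    and eq: "\<And>x. x \<in> S \<Longrightarrow> u x = v x"
  shows "solves_gen_Helmholtz m n \<alpha> lam v S"
proof -
  have hp: "has_partials m f (\<lambda>i. pderiv_fun i f) S"
    if "continuous_on S f" "\<And>i. i \<in> {1..m} \<Longrightarrow> pdiff_on i f S \<and> continuous_on S (pderiv_fun i f)" for f :: "(nat \<Rightarrow> real) \<Rightarrow> complex"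
    using that by (intro has_partialsI) (auto simp: pdiff_on_def pderiv_fun_def vector_derivative_works[symmetric])
  have C: "C2_on m u S" using u by (simp add: solves_gen_Helmholtz_def)
  have v: "has_partials m v (\<lambda>i. pderiv_fun i u) S"
    by (rule has_partials_cong[OF hp S eq]) (use C in \<open>auto simp: C2_on_def\<close>)
  have dv: "has_partials m (pderiv_fun i u) (\<lambda>j. pderiv_fun j (pderiv_fun i u)) S" if "i \<in> {1..m}" for i
    by (rule hp) (use C that in \<open>auto simp: C2_on_def\<close>)
  note r = C2_on_partials[OF v S dv]
  show ?thesis
    unfolding solves_gen_Helmholtz_def
  proof (intro conjI ballI r(1))
    fix x assume x: "x \<in> S"
    have "(\<Sum>i=1..m. pderiv_fun i (pderiv_fun i v) x) = (\<Sum>i=1..m. pderiv_fun i (pderiv_fun i u) x)"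
      using r(3) x by (intro sum.cong) auto
    moreover have "(\<Sum>j=1..n. complex_of_real (2 * \<alpha> j / x j) * pderiv_fun j v x) = (\<Sum>j=1..n. complex_of_real (2 * \<alpha> j / x j) * pderiv_fun j u x)"
      using r(2) x nm by (intro sum.cong) auto
    ultimately show "(\<Sum>i=1..m. pderiv_fun i (pderiv_fun i v) x) + (\<Sum>j=1..n. complex_of_real (2 * \<alpha> j / x j) * pderiv_fun j v x) - lam\<^sup>2 * v x = 0"
      using u x eq[OF x] by (simp add: solves_gen_Helmholtz_def)
  qed
qed

theorem mainTheorem3:
  fixes m n k :: nat and \<alpha> :: "nat \<Rightarrow> real" and lam :: complex and x0 :: "nat \<Rightarrow> real"
  assumes "m \<ge> 2" and "n \<ge> 1" and "m \<ge> n"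
    and "\<forall>j\<in>{1..n}. 0 < 2 * \<alpha> j \<and> 2 * \<alpha> j < 1"
    and "lam \<in> \<real> \<or> Re lam = 0"
    and "x0 \<in> positive_part m n"
    and "k \<in> {0..n}"
    and "alpha_tilde m n \<alpha> k \<notin> real ` {1..}"
  shows "solves_gen_Helmholtz m n \<alpha> lam (\<lambda>x. q_fun m n \<alpha> lam k x x0) (positive_part m n - {x0})
    \<and> (m > 2 \<longrightarrow>
        (\<exists>L. L \<noteq> 0 \<and>
          ((\<lambda>x. complex_of_real (rdist m x x0 ^ (m - 2)) * q_fun m n \<alpha> lam k x x0) \<longlongrightarrow> L)
            (at x0 within positive_part m n)))"
proof -
  note x0 = assms(6) and nm = assms(3)
  have k: "k \<le> n" using assms(7) by simp
  \<comment> \<open>The value \<open>1\<close> outside \<open>{1..n}\<close> makes every \<open>beta_law (b j)\<close> a probability law.\<close>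
  define b where "b = (\<lambda>j. if j \<in> {1..n} then (if j \<le> k then 1 - \<alpha> j else \<alpha> j) else 1)"
  define a where "a = alpha_tilde m n \<alpha> k"
  define S where "S = positive_part m n - {x0}"
  have \<alpha>: "0 < \<alpha> j" "\<alpha> j < 1 / 2" if "j \<in> {1..n}" for j
    using bspec[OF assms(4) that] by linarith+
  have b: "b j > 0" "b j \<le> 1" for j
    using \<alpha>[of j] by (auto simp: b_def)
  have sum_b: "(\<Sum>j=1..n. b j) = real k - (\<Sum>i=1..k. \<alpha> i) + (\<Sum>i=k+1..n. \<alpha> i)"
  proof -
    have "{1..n} = {1..k} \<union> {k+1..n}" using k by auto
    then have "(\<Sum>j=1..n. b j) = (\<Sum>j=1..k. b j) + (\<Sum>j=k+1..n. b j)"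
      by (simp only:) (rule sum.union_disjoint, auto)
    also have "(\<Sum>j=1..k. b j) = (\<Sum>j=1..k. 1 - \<alpha> j)" using k by (intro sum.cong) (auto simp: b_def)
    also have "(\<Sum>j=k+1..n. b j) = (\<Sum>j=k+1..n. \<alpha> j)" by (intro sum.cong) (auto simp: b_def)
    finally show ?thesis by (simp add: sum_subtractf)
  qed
  have a_eq: "a = real m / 2 - 1 + (\<Sum>j=1..n. b j)"
    unfolding sum_b by (simp add: a_def alpha_tilde_def)
  have "(\<Sum>j=1..n. b j) > 0" using assms(2) b by (intro sum_pos) auto
  then have a_pos: "a > 0" using assms(1) unfolding a_eq by (simp add: add_nonneg_pos)
  \<comment> \<open>Being positive, \<open>a\<close> avoids all integers once it avoids the positive ones.\<close>
  have a_int: "a \<notin> \<int>"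
  proof
    assume "a \<in> \<int>"
    then obtain z where z: "a = of_int z" by (auto elim: Ints_cases)
    then have "z \<ge> 1" using a_pos by simp
    then have "a = real (nat z)" "nat z \<in> {1..}" using z by auto
    then show False using assms(8) unfolding a_def by blast
  qed
  define P where "P = (\<lambda>x. gamma_coeff m n \<alpha> k * prefactor k (\<lambda>i. 1 - 2 * \<alpha> i) x0 x)"
  define V where "V = (\<lambda>x. \<integral>t. rker (of_real a) (lam\<^sup>2 / 4) (of_real (sqd m n x0 x t)) \<partial>unit_box_law n b)"
  have q: "of_real (P x) * V x = q_fun m n \<alpha> lam k x x0" if x: "x \<in> S" for x
  proof -
    have HA: "HA n (of_real a) (\<lambda>i. complex_of_real (if i \<le> k then 1 - \<alpha> i else \<alpha> i)) (\<lambda>i. complex_of_real (if i \<le> k then 2 - 2 * \<alpha> i else 2 * \<alpha> i))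
       = HA n (of_real a) (\<lambda>j. of_real (b j)) (\<lambda>j. of_real (2 * b j))"
      by (rule HA_cong) (auto simp: b_def)
    have "V x = of_real (rdist m x x0 powr (- 2 * a)) * HA n (of_real a) (\<lambda>j. of_real (b j)) (\<lambda>j. of_real (2 * b j))
      (xi_var m n x x0, eta_var m lam x x0)"
      unfolding V_def by (rule HA_at_xi_var[symmetric]) (use assms(2) nm a_int b x x0 in \<open>auto simp: S_def\<close>)
    then show ?thesis
      unfolding q_fun_def a_def[symmetric] HA by (simp add: P_def prefactor_def mult.assoc)
  qed
  have "solves_gen_Helmholtz m n \<alpha> lam (\<lambda>x. of_real (P x) * V x) S"
    unfolding P_def V_def S_def
    by (rule average_solves_gen_Helmholtz[OF k nm x0 _ b(1) a_int a_eq]) (simp add: b_def)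
  then have pde: "solves_gen_Helmholtz m n \<alpha> lam (\<lambda>x. q_fun m n \<alpha> lam k x x0) S"
    by (rule solves_gen_Helmholtz_cong[OF _ _ nm q]) (simp_all add: S_def line_open_positive_part)
  have "\<exists>L. L \<noteq> 0 \<and> ((\<lambda>x. complex_of_real (rdist m x x0 ^ (m - 2)) * q_fun m n \<alpha> lam k x x0) \<longlongrightarrow> L) (at x0 within positive_part m n)"
    if m: "m > 2"
  proof -
    define K where "K = kernel_limit n a b (\<lambda>j. 4 * x0 j * x0 j)"
    have ab: "a > (\<Sum>j=1..n. b j)" "a - (\<Sum>j=1..n. b j) = real m / 2 - 1" using m by (auto simp: a_eq)
    have x0p: "x0 j > 0" if "j \<in> {1..n}" for j using x0 that by (auto simp: positive_part_def)
    have K: "K > 0" unfolding K_def using x0p by (intro kernel_limit_pos b(1) ab(1)) auto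
    have "gamma_coeff m n \<alpha> k > 0"
      unfolding gamma_coeff_def a_def[symmetric]
    proof (intro mult_pos_pos divide_pos_pos prod_pos Gamma_real_pos)
      fix j assume "j \<in> {1..k}"
      then have "\<alpha> j < 1 / 2" using \<alpha>[of j] k by simp
      then show "0 < 1 - \<alpha> j" "0 < 2 - 2 * \<alpha> j" by simp_all
    next
      fix j assume "j \<in> {k+1..n}"
      then show "0 < \<alpha> j" "0 < \<alpha> j" using \<alpha>[of j] by simp_all
    qed (use a_pos in simp_all)
    moreover have "prefactor k (\<lambda>i. 1 - 2 * \<alpha> i) x0 x0 > 0"
      unfolding prefactor_def
    proof (rule prod_pos)
      show "0 < (x0 i * x0 i) powr (1 - 2 * \<alpha> i)" if "i \<in> {1..k}" for i
        using x0p[of i] that k by simp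
    qed
    ultimately have P0: "P x0 > 0" by (simp add: P_def)
    have "((\<lambda>x. complex_of_real (rdist m x x0 ^ (m - 2)) * q_fun m n \<alpha> lam k x x0) \<longlongrightarrow> of_real (P x0) * of_real K) (at x0 within positive_part m n)"
      unfolding tendsto_at_iff_sequentially
    proof (intro allI impI)
      fix X assume X: "\<forall>i. X i \<in> positive_part m n - {x0}" and lim: "X \<longlonglongrightarrow> x0"
      have XS: "X i \<in> S" for i using X by (simp add: S_def)
      have Xj: "(\<lambda>i. X i j) \<longlonglongrightarrow> x0 j" for j
        using continuous_on_tendsto_compose[OF continuous_on_product_coordinates lim] by simp
      define R where "R = (\<lambda>i. (rdist m (X i) x0)\<^sup>2)"
      define \<kappa> where "\<kappa> = (\<lambda>i j. 4 * X i j * x0 j)"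
      have R: "R i > 0" for i unfolding R_def rdist_sq using positive_part_diff[of "X i"] X x0 by auto
      have "(\<lambda>i. \<Sum>l=1..m. (X i l - x0 l)\<^sup>2) \<longlonglongrightarrow> (\<Sum>l=1..m. (x0 l - x0 l)\<^sup>2)"
        by (intro tendsto_intros Xj)
      then have R0: "R \<longlonglongrightarrow> 0" by (simp add: R_def rdist_sq)
      have \<kappa>lim: "(\<lambda>i. \<kappa> i j) \<longlonglongrightarrow> 4 * x0 j * x0 j" for j unfolding \<kappa>_def by (intro tendsto_intros Xj)
      have "\<forall>\<^sub>F i in sequentially. \<forall>j\<in>{1..n}. 2 * x0 j * x0 j \<le> \<kappa> i j"
      proof (rule eventually_ball_finite, simp, intro ballI)
        fix j assume "j \<in> {1..n}"
        then have "2 * x0 j * x0 j < 4 * x0 j * x0 j" using x0p by simp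
        then have "\<forall>\<^sub>F i in sequentially. 2 * x0 j * x0 j < \<kappa> i j" by (rule order_tendstoD(1)[OF \<kappa>lim])
        then show "\<forall>\<^sub>F i in sequentially. 2 * x0 j * x0 j \<le> \<kappa> i j" by eventually_elim simp
      qed
      \<comment> \<open>From some index on, \<open>\<kappa> i j\<close> has the positive lower bound that the limit theorem asks for.\<close>
      then obtain N where N: "\<And>i j. i \<ge> N \<Longrightarrow> j \<in> {1..n} \<Longrightarrow> 2 * x0 j * x0 j \<le> \<kappa> i j"
        unfolding eventually_sequentially by blast
      have "(\<lambda>i. of_real (R (i + N) powr (a - (\<Sum>j=1..n. b j))) *
          (\<integral>t. rker (of_real a) (lam\<^sup>2 / 4) (of_real (R (i + N) + (\<Sum>j=1..n. \<kappa> (i + N) j * t j))) \<partial>unit_box_law n b))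
          \<longlonglongrightarrow> complex_of_real K"
        unfolding K_def
      proof (rule expectation_rker_limit[OF b ab(1), where c = "\<lambda>j. 2 * x0 j * x0 j"])
        show "(\<lambda>i. R (i + N)) \<longlonglongrightarrow> 0" by (rule LIMSEQ_ignore_initial_segment[OF R0])
        show "(\<lambda>i. \<kappa> (i + N) j) \<longlonglongrightarrow> 4 * x0 j * x0 j" for j by (rule LIMSEQ_ignore_initial_segment[OF \<kappa>lim])
      qed (use R N x0p in auto)
      then have 1: "(\<lambda>i. of_real (R i powr (a - (\<Sum>j=1..n. b j))) *
          (\<integral>t. rker (of_real a) (lam\<^sup>2 / 4) (of_real (R i + (\<Sum>j=1..n. \<kappa> i j * t j))) \<partial>unit_box_law n b))
          \<longlonglongrightarrow> complex_of_real K"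
        by (rule LIMSEQ_offset)
      have 2: "(\<lambda>i. P (X i)) \<longlonglongrightarrow> P x0"
        unfolding P_def prefactor_def
      proof (intro tendsto_mult tendsto_prod tendsto_powr Xj tendsto_const)
        show "x0 i * x0 i \<noteq> 0" if "i \<in> {1..k}" for i using x0p[of i] that k by simp
      qed
      have "complex_of_real (rdist m (X i) x0 ^ (m - 2)) * q_fun m n \<alpha> lam k (X i) x0 =
         of_real (P (X i)) * (of_real (R i powr (a - (\<Sum>j=1..n. b j))) *
          (\<integral>t. rker (of_real a) (lam\<^sup>2 / 4) (of_real (R i + (\<Sum>j=1..n. \<kappa> i j * t j))) \<partial>unit_box_law n b))" for i
      proof -
        have "rdist m (X i) x0 > 0" using R[of i] by (simp add: R_def rdist_def sum_nonneg less_le)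
        then have "R i powr (real m / 2 - 1) = rdist m (X i) x0 powr (2 * (real m / 2 - 1))"
          unfolding R_def by (simp flip: powr_numeral add: powr_powr)
        also have "2 * (real m / 2 - 1) = real (m - 2)" using m by (simp add: of_nat_diff)
        also have "rdist m (X i) x0 powr real (m - 2) = rdist m (X i) x0 ^ (m - 2)"
          using \<open>rdist m (X i) x0 > 0\<close> by (rule powr_realpow)
        finally have r: "rdist m (X i) x0 ^ (m - 2) = R i powr (a - (\<Sum>j=1..n. b j))" unfolding ab(2) by simp
        have "sqd m n x0 (X i) t = R i + (\<Sum>j=1..n. \<kappa> i j * t j)" for t
          by (simp add: sqd_def R_def rdist_sq \<kappa>_def)
        then show ?thesis unfolding q[OF XS, symmetric] r V_def by simp
      qed
      then show "((\<lambda>x. complex_of_real (rdist m x x0 ^ (m - 2)) * q_fun m n \<alpha> lam k x x0) \<circ> X) \<longlonglongrightarrow> of_real (P x0) * of_real K"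
        unfolding o_def using tendsto_mult[OF tendsto_of_real[OF 2] 1] by simp
    qed
    moreover have "complex_of_real (P x0) * of_real K \<noteq> 0" using P0 K by simp
    ultimately show ?thesis by blast
  qed
  with pde show ?thesis unfolding S_def by blast
qed

end
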